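(* Let $k$ be a field of characteristic zero, $A$ an associative unital $k$-algebra and $V$ a nonzero finite-dimensional $k$-vector space. For all $n\ge0$, the following two squares commute: $$\mathrm{S}_V\circ\widetilde{\mathrm{Tr}}_V(A)_n=\widetilde{\mathrm{Tr}}_V(A)_{n-2}\circ S:\ \overline{\mathrm{HC}}_n(A)\to\mathrm{HC}_{n-2}(A,V),$$ $$B_V\circ\mathrm{Tr}_V=\mathrm{Tr}_V\circ B:\ \overline{\mathrm{HC}}_n(A)\to\mathrm H_n(\Omega^1A,V),$$ where $S:\overline{\mathrm{HC}}_n(A)\to\overline{\mathrm{HC}}_{n-2}(A)$ is Connes' periodicity operator, $B:\overline{\mathrm{HC}}_n(A)\to\overline{\mathrm{HH}}_{n+1}(A)$ is the Connes differential, $\mathrm S_V:\mathrm{HC}_n(A,V)\to\mathrm{HC}_{n-2}(A,V)$ is given by $$(r_n,\bar\omega_{n-1},\bar\omega_{n-3},\dots)\mapsto(r_{n-2},\bar\omega_{n-3},\dots),\qquad \bar\partial_V(r_{n-2})=d\omega_{n-1},$$ ($\omega_{n-1}$ any representative of $\bar\omega_{n-1}$), and $B_V:\bar{\mathrm H}_n(A,V)\to\mathrm H_n(\Omega^1A,V)$ is induced by the derivation $\partial_V:R_V\to\Omega^1_{\mathrm{com}}(R_V)$.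
   Context: Differentials have degree $-1$. Fix an almost free resolution $R\to A$ (a surjective quasi-isomorphism from a non-negatively graded DG algebra that is free as a graded algebra). Write $\bar R=R/k$, $\bar R_\natural=R/(k+[R,R])$. $\Omega^1(R)=\ker(R\otimes R\to R)$ is the DG bimodule of noncommutative 1-forms with universal derivation $\partial$; for a bimodule $M$, $M_\natural=M/[R,M]$. Let $\beta:\Omega^1(R)_\natural\to\bar R$, $\beta(x\,dy)=[x,y]$, and let $\bar\partial:\bar R\to\Omega^1(R)_\natural$ be induced by $\partial$. Let $X^+(R)=[0\leftarrow\bar R\xleftarrow{\beta}\Omega^1(R)_\natural\xleftarrow{\bar\partial}\bar R\xleftarrow{\beta}\cdots]$ be the first-quadrant bicomplex with first column $\bar R$ in horizontal degree $0$ (the internal differential on the $\Omega^1(R)_\natural$ columns taken with opposite sign), and $X_2^+(R)$ the sub-bicomplex of its first two columns. One has $\mathrm H_n[\mathrm{Tot}\,X^+(R)]\cong\mathrm H_n(\bar R_\natural)\cong\overline{\mathrm{HC}}_n(A)$ (reduced cyclic homology; the first isomorphism via projection of the first column to $\bar R_\natural$), and $\mathrm H_n[\mathrm{Tot}\,X_2^+(R)]\cong\overline{\mathrm{HH}}_n(A)$ (reduced Hochschild homology); with these identifications the maps $S$ and $B$ are those in the long exact sequence of $0\to\mathrm{Tot}\,X_2^+(R)\to\mathrm{Tot}\,X^+(R)\xrightarrow{S}\mathrm{Tot}\,X^+(R)[2]\to0$ (Connes' periodicity sequence). Explicitly, a cycle $\bar r_n\in\bar R_\natural$ lifts to a cycle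 $(r_n,\omega_{n-1},r_{n-2},\omega_{n-3},\dots)\in\mathrm{Tot}[X^+(R)]_n=\bar R_n\oplus\Omega^1(R)_{\natural,n-1}\oplus\bar R_{n-2}\oplus\cdots$, so $\beta(\omega_{n-1})=-dr_n$, $\bar\partial(r_{n-2})=d\omega_{n-1}$, etc.; $S[\bar r_n]$ is the class of $r_{n-2}$ in $\bar R_\natural$. $R_V$ is the commutative DG algebra with $\mathrm{Hom}(R_V,C)\cong\mathrm{Hom}(R,\mathrm{End}\,V\otimes C)$ for commutative DG algebras $C$; $\bar R_V=R_V/k$; $\mathrm H_\bullet(A,V)=\mathrm H_\bullet(R_V)$, $\bar{\mathrm H}_\bullet(A,V)=\mathrm H_\bullet(\bar R_V)$. $\Omega^1_{\mathrm{com}}(R_V)$ is the DG module of Kähler differentials, $\partial_V:R_V\to\Omega^1_{\mathrm{com}}(R_V)$ the de Rham differential and $\bar\partial_V$ the induced map on $\bar R_V$ (injective). For a DG $R$-bimodule $M$ there is the DG $R_V$-module $M_V=M\otimes_{R^{\mathrm e}}(\mathrm{End}\,V\otimes R_V)$, with canonical trace $\mathrm{Tr}_V(M):M\to\mathrm{End}\,V\otimes M_V\xrightarrow{\mathrm{Tr}\otimes\mathrm{id}}M_V$ vanishing on $[R,M]$ (the first map corresponds to $\mathrm{id}_{M_V}$ under $\underline{\mathrm{Hom}}_{R_V}(M_V,L)\cong\underline{\mathrm{Hom}}_{R^{\mathrm e}}(M,\mathrm{End}\,V\otimes L)$). One has $\Omega^1(R)_V\cong\Omega^1_{\mathrm{com}}(R_V)$,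 giving $\mathrm{Tr}_V:\Omega^1(R)_\natural\to\Omega^1_{\mathrm{com}}(R_V)$; also $\mathrm{Tr}_V:\bar R\to\bar R_V$ is induced by $R\to\mathrm{End}\,V\otimes R_V\xrightarrow{\mathrm{Tr}\otimes\mathrm{id}}R_V$. $\mathrm H_n(\Omega^1A,V):=\mathrm H_n[\Omega^1_{\mathrm{com}}(R_V)]$ (the representation homology of the $A$-bimodule $\Omega^1A$). $X^+(R)_V=[0\leftarrow\bar R_V\xleftarrow{0}\Omega^1_{\mathrm{com}}(R_V)\xleftarrow{\bar\partial_V}\bar R_V\xleftarrow{0}\cdots]$ is defined with the same sign convention, and $\mathrm{HC}_n(A,V):=\mathrm H_n[\mathrm{Tot}\,X^+(R)_V]$ (zero for $n<0$). There is a quasi-isomorphism $$\mathrm{Tot}\,X^+(R)_V\to\bar R_V\oplus(\Omega^1_{\mathrm{com}}(R_V)/\partial R_V)[1]\oplus(\Omega^1_{\mathrm{com}}(R_V)/\partial R_V)[3]\oplus\cdots,\quad(r_n,\omega_{n-1},r_{n-2},\omega_{n-3},\dots)\mapsto(r_n,\bar\omega_{n-1},\bar\omega_{n-3},\dots),$$ with $\bar\omega=\omega\bmod\partial R_V$; classes in $\mathrm{HC}_n(A,V)$ are represented by cycles $(r_n,\bar\omega_{n-1},\bar\omega_{n-3},\dots)$ of the right-hand side. Trace maps: $\widetilde{\mathrm{Tr}}_V(A)_n:\overline{\mathrm{HC}}_n(A)\to\mathrm{HC}_n(A,V)$ is $[\bar r_n]\mapsto(\mathrm{Tr}_V(r_n),\overline{\mathrm{Tr}_V(\omega_{n-1})},\overline{\mathrm{Tr}_V(\omega_{n-3})},\dots)$,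 where $(r_n,\omega_{n-1},r_{n-2},\omega_{n-3},\dots)\in\mathrm{Tot}[X^+(R)]_n$ is a cycle lifting $\bar r_n$, i.e. the image of $r_n$ in $\bar R_\natural$ is $\bar r_n$, and $\beta(\omega_{n-1})=-dr_n$, $\bar\partial(r_{n-2})=d\omega_{n-1}$, $\beta(\omega_{n-3})=-dr_{n-2}$, etc. In the second square, $\mathrm{Tr}_V:\overline{\mathrm{HC}}_n(A)\to\bar{\mathrm H}_n(A,V)$ is induced by $\mathrm{Tr}_V:\bar R_\natural\to\bar R_V$, and $\mathrm{Tr}_V:\overline{\mathrm{HH}}_{n+1}(A)\to\mathrm H_n(\Omega^1A,V)$ sends the class of $(r_{n+1},\omega_n)\in\mathrm{Tot}[X_2^+(R)]_{n+1}$ to the class of $\mathrm{Tr}_V(\omega_n)$. *)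

theory Defs
  imports
    Complex_Main
    "HOL-Library.Poly_Mapping"
    "HOL-Library.Function_Algebras"
    "HOL-Library.Product_Plus"
    "HOL-Library.Set_Algebras"
    "HOL-Library.FuncSet"
begin

section \<open>Complexes and homology\<close>

text \<open>
  Almost every complex below is a quotient of a subspace of a vector space that is available as a
  type. Such a complex is given by representatives: its part of degree \<open>n\<close> is
  \<open>deg_part C n\<close> modulo those of its elements that lie in \<open>null_part C n\<close>, and the differential
  (of degree \<open>-1\<close>) is a map on representatives. Hence an equation in degree \<open>n\<close> of the complex is a
  congruence modulo \<open>null_part C n\<close>, and maps of complexes are maps of representatives.
\<close>

record 'c cplx =
  deg_part :: "int \<Rightarrow> 'c set"
  null_part :: "int \<Rightarrow> 'c set"
  differential :: "'c \<Rightarrow> 'c"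

definition cycles :: "'c::ab_group_add cplx \<Rightarrow> int \<Rightarrow> 'c set" where
  "cycles C n = {z \<in> deg_part C n. differential C z \<in> null_part C (n - 1)}"

definition boundaries :: "'c::ab_group_add cplx \<Rightarrow> int \<Rightarrow> 'c set" where
  "boundaries C n = {z \<in> deg_part C n. \<exists>w \<in> deg_part C (n + 1). z - differential C w \<in> null_part C n}"

definition homology :: "'c::ab_group_add cplx \<Rightarrow> int \<Rightarrow> 'c set set" where
  "homology C n = (\<lambda>z. z +o boundaries C n) ` cycles C n"

text \<open>
  \<open>induced D m \<rho>\<close> sends a homology class \<open>c\<close> to the class in degree \<open>m\<close> of \<open>D\<close> of any \<open>y\<close> with
  \<open>\<rho> x y\<close> for some representative \<open>x\<close> of \<open>c\<close>. As a union of cosets, the value is an element of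
  \<open>homology D m\<close> only if at least one such \<open>y\<close> exists and all of them are homologous cycles.
\<close>

definition induced :: "'d::ab_group_add cplx \<Rightarrow> int \<Rightarrow> ('c \<Rightarrow> 'd \<Rightarrow> bool) \<Rightarrow> 'c set \<Rightarrow> 'd set" where
  "induced D m \<rho> c = \<Union> {y +o boundaries D m | x y. x \<in> c \<and> \<rho> x y}"

definition induced_map :: "'d::ab_group_add cplx \<Rightarrow> int \<Rightarrow> ('c \<Rightarrow> 'd) \<Rightarrow> 'c set \<Rightarrow> 'd set" where
  "induced_map D m f = induced D m (\<lambda>x y. y = f x)"

definition quasi_isomorphism ::
  "'c::ab_group_add cplx \<Rightarrow> 'd::ab_group_add cplx \<Rightarrow> ('c \<Rightarrow> 'd) \<Rightarrow> bool" where
  "quasi_isomorphism C D f \<longleftrightarrow>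
    (\<forall>n. \<forall>x \<in> deg_part C n. f x \<in> deg_part D n) \<and>
    (\<forall>n. \<forall>x \<in> deg_part C n. \<forall>y \<in> deg_part C n.
       f (x + y) - (f x + f y) \<in> null_part D n \<and>
       (x - y \<in> null_part C n \<longrightarrow> f x - f y \<in> null_part D n)) \<and>
    (\<forall>n. \<forall>x \<in> deg_part C n. f (differential C x) - differential D (f x) \<in> null_part D (n - 1)) \<and>
    (\<forall>n. bij_betw (induced_map D n f) (homology C n) (homology D n))"


section \<open>DG algebras and almost free resolutions\<close>

definition k_algebra :: "('k::field \<Rightarrow> 'a::{ring, monoid_mult} \<Rightarrow> 'a) \<Rightarrow> bool" where
  "k_algebra s \<longleftrightarrow> vector_space s \<and>
    (\<forall>c x y. s c (x * y) = s c x * y \<and> s c (x * y) = x * s c y)"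

record ('k, 'r) dg_alg =
  scal :: "'k \<Rightarrow> 'r \<Rightarrow> 'r"
  piece :: "int \<Rightarrow> 'r set"
  dif :: "'r \<Rightarrow> 'r"

definition ksign :: "int \<Rightarrow> 'a::ring_1" where
  "ksign n = (if even n then 1 else - 1)"

definition is_decomposition :: "('k, 'r::ring_1) dg_alg \<Rightarrow> 'r \<Rightarrow> (int \<Rightarrow> 'r) \<Rightarrow> bool" where
  "is_decomposition R x f \<longleftrightarrow>
    finite {n. f n \<noteq> 0} \<and> (\<forall>n. f n \<in> piece R n) \<and> x = (\<Sum>n | f n \<noteq> 0. f n)"

definition dg_algebra :: "('k::field, 'r::ring_1) dg_alg \<Rightarrow> bool" where
  "dg_algebra R \<longleftrightarrow>
    k_algebra (scal R) \<and>
    (\<forall>n. module.subspace (scal R) (piece R n)) \<and>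
    (\<forall>x. \<exists>!f. is_decomposition R x f) \<and>
    1 \<in> piece R 0 \<and>
    (\<forall>m n. \<forall>x \<in> piece R m. \<forall>y \<in> piece R n. x * y \<in> piece R (m + n)) \<and>
    Vector_Spaces.linear (scal R) (scal R) (dif R) \<and>
    (\<forall>n. \<forall>x \<in> piece R n. dif R x \<in> piece R (n - 1)) \<and>
    (\<forall>x. dif R (dif R x) = 0) \<and>
    (\<forall>n. \<forall>x \<in> piece R n. \<forall>y. dif R (x * y) = dif R x * y + ksign n * (x * dif R y))"

definition free_graded_algebra :: "('k::field, 'r::ring_1) dg_alg \<Rightarrow> bool" where
  "free_graded_algebra R \<longleftrightarrow>
    (\<exists>X \<subseteq> (\<Union>n. piece R n).
       inj_on prod_list (lists X) \<and>
       \<not> module.dependent (scal R) (prod_list ` lists X) \<and>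
       module.span (scal R) (prod_list ` lists X) = UNIV)"

definition dga_cplx :: "('k, 'r::ring_1) dg_alg \<Rightarrow> 'r cplx" where
  "dga_cplx R = \<lparr>deg_part = piece R, null_part = (\<lambda>_. {0}), differential = dif R\<rparr>"

definition concentrated :: "'a::ab_group_add cplx" where
  "concentrated = \<lparr>deg_part = (\<lambda>n. if n = 0 then UNIV else {0}), null_part = (\<lambda>_. {0}), differential = (\<lambda>_. 0)\<rparr>"

definition almost_free_resolution ::
  "('k::field, 'r::ring_1) dg_alg \<Rightarrow> ('k \<Rightarrow> 'a::{ring, monoid_mult} \<Rightarrow> 'a) \<Rightarrow> ('r \<Rightarrow> 'a) \<Rightarrow> bool" where
  "almost_free_resolution R sA p \<longleftrightarrow>
    dg_algebra R \<and> (\<forall>n < 0. piece R n = {0}) \<and> free_graded_algebra R \<and>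
    Vector_Spaces.linear (scal R) sA p \<and> p 1 = 1 \<and> (\<forall>x y. p (x * y) = p x * p y) \<and>
    surj p \<and> quasi_isomorphism (dga_cplx R) concentrated p"

definition component :: "('k, 'r::ring_1) dg_alg \<Rightarrow> 'r \<Rightarrow> int \<Rightarrow> 'r" where
  "component R x = (THE f. is_decomposition R x f)"

definition parity :: "('k, 'r::ring_1) dg_alg \<Rightarrow> 'r \<Rightarrow> 'r" where
  "parity R x = (\<Sum>n | component R x n \<noteq> 0. ksign n * component R x n)"

text \<open>\<open>parity R\<close> is multiplication by \<open>(-1)\<^sup>n\<close> on degree \<open>n\<close>; the graded commutator is bilinear.\<close>

definition commutator :: "('k, 'r::ring_1) dg_alg \<Rightarrow> 'r \<Rightarrow> 'r \<Rightarrow> 'r" where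
  "commutator R x y = x * y -
    (\<Sum>m | component R x m \<noteq> 0. \<Sum>n | component R y n \<noteq> 0.
       ksign (m * n) * (component R y n * component R x m))"


section \<open>Finitely supported functions and tensor products\<close>

definition pscale :: "'k::comm_ring_1 \<Rightarrow> ('b \<Rightarrow>\<^sub>0 'k) \<Rightarrow> ('b \<Rightarrow>\<^sub>0 'k)" where
  "pscale c = Poly_Mapping.map ((*) c)"

text \<open>Linear extension of a map defined on the basis:\<close>

definition lin_ext :: "('k::comm_ring_1 \<Rightarrow> 'c::ab_group_add \<Rightarrow> 'c) \<Rightarrow> ('b \<Rightarrow> 'c) \<Rightarrow> ('b \<Rightarrow>\<^sub>0 'k) \<Rightarrow> 'c" where
  "lin_ext s f t = (\<Sum>b \<in> Poly_Mapping.keys t. s (Poly_Mapping.lookup t b) (f b))"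

text \<open>
  \<open>U \<otimes> U\<close> is the free vector space on the symbols \<open>tens u v\<close> modulo \<open>tensor_null s\<close>, where \<open>s\<close> is
  the scalar multiplication of \<open>U\<close>.
\<close>

type_synonym ('k, 'u) tensors = "'u \<times> 'u \<Rightarrow>\<^sub>0 'k"

definition tens :: "'u \<Rightarrow> 'u \<Rightarrow> ('u \<times> 'u \<Rightarrow>\<^sub>0 'k::comm_ring_1)" where
  "tens u v = Poly_Mapping.single (u, v) 1"

definition tensor_null :: "('k::field \<Rightarrow> 'u::ab_group_add \<Rightarrow> 'u) \<Rightarrow> ('k, 'u) tensors set" where
  "tensor_null s = module.span pscale
    (  {tens (u + u') v - (tens u v + tens u' v) | u u' v. True}
     \<union> {tens u (v + v') - (tens u v + tens u v') | u v v'. True}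
     \<union> {tens (s c u) v - pscale c (tens u v) | c u v. True}
     \<union> {tens u (s c v) - pscale c (tens u v) | c u v. True})"


section \<open>Noncommutative forms\<close>

text \<open>\<open>R \<otimes> R\<close> as a DG bimodule, and \<open>\<Omega>\<^sup>1(R)\<close> as the kernel of the multiplication map.\<close>

definition tens_deg :: "('k::field, 'r::ring_1) dg_alg \<Rightarrow> int \<Rightarrow> ('k, 'r) tensors set" where
  "tens_deg R n = module.span pscale {tens a b | a b p q. a \<in> piece R p \<and> b \<in> piece R q \<and> p + q = n}"

definition tens_dif :: "('k::field, 'r::ring_1) dg_alg \<Rightarrow> ('k, 'r) tensors \<Rightarrow> ('k, 'r) tensors" where
  "tens_dif R = lin_ext pscale (\<lambda>(a, b). tens (dif R a) b + tens (parity R a) (dif R b))"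

definition tens_mult :: "('k::field, 'r::ring_1) dg_alg \<Rightarrow> ('k, 'r) tensors \<Rightarrow> 'r" where
  "tens_mult R = lin_ext (scal R) (\<lambda>(a, b). a * b)"

definition lact :: "'r \<Rightarrow> ('r::ring_1 \<times> 'r \<Rightarrow>\<^sub>0 'k::field) \<Rightarrow> ('k, 'r) tensors" where
  "lact x = lin_ext pscale (\<lambda>(a, b). tens (x * a) b)"

definition ract :: "('r::ring_1 \<times> 'r \<Rightarrow>\<^sub>0 'k::field) \<Rightarrow> 'r \<Rightarrow> ('k, 'r) tensors" where
  "ract t x = lin_ext pscale (\<lambda>(a, b). tens a (b * x)) t"

definition Omega :: "('k::field, 'r::ring_1) dg_alg \<Rightarrow> ('k, 'r) tensors cplx" where
  "Omega R = \<lparr>deg_part = (\<lambda>n. {t \<in> tens_deg R n. tens_mult R t = 0}),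
              null_part = (\<lambda>_. tensor_null (scal R)), differential = tens_dif R\<rparr>"

definition univ_der :: "'r::ring_1 \<Rightarrow> ('r \<times> 'r \<Rightarrow>\<^sub>0 'k::field)" where
  "univ_der x = tens 1 x - tens x 1"

definition Omega_nat :: "('k::field, 'r::ring_1) dg_alg \<Rightarrow> ('k, 'r) tensors cplx" where
  "Omega_nat R = \<lparr>deg_part = deg_part (Omega R),
     null_part = (\<lambda>_. module.span pscale (tensor_null (scal R) \<union>
       {lact x \<omega> - pscale (ksign (m * n)) (ract \<omega> x) | x \<omega> m n. x \<in> piece R m \<and> \<omega> \<in> deg_part (Omega R) n})),
     differential = tens_dif R\<rparr>"

definition Rbar :: "('k::field, 'r::ring_1) dg_alg \<Rightarrow> 'r cplx" where
  "Rbar R = \<lparr>deg_part = piece R, null_part = (\<lambda>_. module.span (scal R) {1}), differential = dif R\<rparr>"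

definition Rbar_nat :: "('k::field, 'r::ring_1) dg_alg \<Rightarrow> 'r cplx" where
  "Rbar_nat R = \<lparr>deg_part = piece R,
     null_part = (\<lambda>_. module.span (scal R) (insert 1 {commutator R x y | x y. True})), differential = dif R\<rparr>"

text \<open>
  An element \<open>\<Sum> a \<otimes> b\<close> of \<open>\<Omega>\<^sup>1(R)\<close> equals \<open>\<Sum> a \<partial>b\<close>, because \<open>\<Sum> a b = 0\<close>. So a map given on forms
  by \<open>a \<partial>b \<mapsto> \<phi>(a, b)\<close> is the restriction of \<open>a \<otimes> b \<mapsto> \<phi>(a, b)\<close>; this is used for \<open>\<beta>\<close> here and for
  the traces of forms below.
\<close>

definition beta :: "('k::field, 'r::ring_1) dg_alg \<Rightarrow> ('k, 'r) tensors \<Rightarrow> 'r" where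
  "beta R = lin_ext (scal R) (\<lambda>(a, b). commutator R a b)"


section \<open>Total complexes\<close>

text \<open>
  The total complex of \<open>0 \<leftarrow> C \<leftarrow> D \<leftarrow> C \<leftarrow> D \<leftarrow> \<dots>\<close> with horizontal maps \<open>b : D \<rightarrow> C\<close> and \<open>e : C \<rightarrow> D\<close>
  and the sign of the internal differential of \<open>D\<close> changed. The element
  \<open>(r\<^sub>n, \<omega>\<^sub>n\<^sub>-\<^sub>1, r\<^sub>n\<^sub>-\<^sub>2, \<omega>\<^sub>n\<^sub>-\<^sub>3, \<dots>)\<close> of degree \<open>n\<close> is the sequence of pairs \<open>u j = (r\<^sub>n\<^sub>-\<^sub>2\<^sub>j, \<omega>\<^sub>n\<^sub>-\<^sub>1\<^sub>-\<^sub>2\<^sub>j)\<close>.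
\<close>

definition Tot :: "'c::ab_group_add cplx \<Rightarrow> 'd::ab_group_add cplx \<Rightarrow> ('d \<Rightarrow> 'c) \<Rightarrow> ('c \<Rightarrow> 'd)
    \<Rightarrow> (nat \<Rightarrow> 'c \<times> 'd) cplx" where
  "Tot C D b e = \<lparr>
     deg_part = (\<lambda>n. {u. \<forall>j. fst (u j) \<in> deg_part C (n - 2 * int j) \<and>
                              snd (u j) \<in> deg_part D (n - 1 - 2 * int j)}),
     null_part = (\<lambda>n. {u. \<forall>j. fst (u j) \<in> null_part C (n - 2 * int j) \<and>
                               snd (u j) \<in> null_part D (n - 1 - 2 * int j)}),
     differential = (\<lambda>u j. (differential C (fst (u j)) + b (snd (u j)),
                             e (fst (u (Suc j))) - differential D (snd (u j))))\<rparr>"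

text \<open>The subcomplex of the first two columns, its inclusion, and the projection onto \<open>Tot[2]\<close>:\<close>

definition Tot2 :: "'c::ab_group_add cplx \<Rightarrow> 'd::ab_group_add cplx \<Rightarrow> ('d \<Rightarrow> 'c) \<Rightarrow> ('c \<times> 'd) cplx" where
  "Tot2 C D b = \<lparr>
     deg_part = (\<lambda>n. deg_part C n \<times> deg_part D (n - 1)),
     null_part = (\<lambda>n. null_part C n \<times> null_part D (n - 1)),
     differential = (\<lambda>(r, \<omega>). (differential C r + b \<omega>, - differential D \<omega>))\<rparr>"

definition incl2 :: "'c::zero \<times> 'd::zero \<Rightarrow> nat \<Rightarrow> 'c \<times> 'd" where
  "incl2 w j = (if j = 0 then w else (0, 0))"

definition shift2 :: "(nat \<Rightarrow> 'c) \<Rightarrow> nat \<Rightarrow> 'c" where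
  "shift2 u j = u (Suc j)"

definition Xplus :: "('k::field, 'r::ring_1) dg_alg \<Rightarrow> (nat \<Rightarrow> 'r \<times> ('k, 'r) tensors) cplx" where
  "Xplus R = Tot (Rbar R) (Omega_nat R) (beta R) univ_der"

definition X2plus :: "('k::field, 'r::ring_1) dg_alg \<Rightarrow> ('r \<times> ('k, 'r) tensors) cplx" where
  "X2plus R = Tot2 (Rbar R) (Omega_nat R) (beta R)"


section \<open>Reduced cyclic and Hochschild homology, periodicity and the Connes differential\<close>

text \<open>
  Reduced cyclic homology of \<open>A\<close> is the homology of \<open>R/(k + [R,R])\<close>, and reduced Hochschild homology
  that of \<open>Tot X\<^sub>2\<^sup>+(R)\<close>, for the given almost free resolution \<open>R \<rightarrow> A\<close>.
\<close>

abbreviation HC_red :: "('k::field, 'r::ring_1) dg_alg \<Rightarrow> int \<Rightarrow> 'r set set" where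
  "HC_red R n \<equiv> homology (Rbar_nat R) n"

abbreviation HH_red :: "('k::field, 'r::ring_1) dg_alg \<Rightarrow> int \<Rightarrow> ('r \<times> ('k, 'r) tensors) set set" where
  "HH_red R n \<equiv> homology (X2plus R) n"

text \<open>\<open>u\<close> is a cycle of \<open>Tot X\<^sup>+(R)\<close> of degree \<open>n\<close> lifting the class of \<open>r\<close> in \<open>R/(k + [R,R])\<close>.\<close>

definition cycle_lift :: "('k::field, 'r::ring_1) dg_alg \<Rightarrow> int \<Rightarrow> 'r \<Rightarrow> (nat \<Rightarrow> 'r \<times> ('k, 'r) tensors) \<Rightarrow> bool" where
  "cycle_lift R n r u \<longleftrightarrow> u \<in> cycles (Xplus R) n \<and> fst (u 0) - r \<in> null_part (Rbar_nat R) n"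

definition connes_S :: "('k::field, 'r::ring_1) dg_alg \<Rightarrow> int \<Rightarrow> 'r set \<Rightarrow> 'r set" where
  "connes_S R n = induced (Rbar_nat R) (n - 2)
     (\<lambda>r y. \<exists>u. cycle_lift R n r u \<and> y = fst (shift2 u 0))"

text \<open>
  The connecting homomorphism of \<open>0 \<rightarrow> Tot X\<^sub>2\<^sup>+ \<rightarrow> Tot X\<^sup>+ \<rightarrow> Tot X\<^sup>+[2] \<rightarrow> 0\<close>: a cycle \<open>u\<close> of degree \<open>n\<close> in
  \<open>Tot X\<^sup>+\<close> has degree \<open>n + 2\<close> in \<open>Tot X\<^sup>+[2]\<close>; \<open>v\<close> is a preimage of it and \<open>w\<close> is the boundary of \<open>v\<close>.
\<close>

definition connes_B :: "('k::field, 'r::ring_1) dg_alg \<Rightarrow> int \<Rightarrow> 'r set \<Rightarrow> ('r \<times> ('k, 'r) tensors) set" where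
  "connes_B R n = induced (X2plus R) (n + 1)
     (\<lambda>r w. \<exists>u v. cycle_lift R n r u \<and>
        v \<in> deg_part (Xplus R) (n + 2) \<and> shift2 v - u \<in> null_part (Xplus R) n \<and>
        w \<in> deg_part (X2plus R) (n + 1) \<and>
        differential (Xplus R) v - incl2 w \<in> null_part (Xplus R) (n + 1))"


section \<open>The representation algebra\<close>

text \<open>
  Words form a free monoid, written additively so that \<open>'x word \<Rightarrow>\<^sub>0 'k\<close>, whose multiplication is
  convolution, is the free associative \<open>k\<close>-algebra on \<open>'x\<close>.
\<close>

datatype 'x word = Word (letters: "'x list")

instantiation word :: (type) monoid_add
begin
definition zero_word :: "'a word" where "zero_word = Word []"
definition plus_word :: "'a word \<Rightarrow> 'a word \<Rightarrow> 'a word" where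
  "plus_word v w = Word (letters v @ letters w)"
instance by standard (simp_all add: zero_word_def plus_word_def)
end

text \<open>
  Let \<open>B\<close> be a basis of \<open>V\<close>, so that \<open>End V \<otimes> C\<close> is the algebra of \<open>B \<times> B\<close>-matrices over \<open>C\<close>. The algebra
  \<open>R\<^sub>V\<close> is generated by the entries \<open>gen x i j\<close> of the universal matrix representation of \<open>R\<close>, subject to
  the relations saying that this is a representation and that homogeneous entries commute in the
  graded sense; see \<open>rep_algebra_universal\<close> below. Its degree \<open>n\<close> part is spanned by the products of
  entries of homogeneous elements of total degree \<open>n\<close>.
\<close>

type_synonym ('k, 'r, 'v) rep_alg = "('r \<times> 'v \<times> 'v) word \<Rightarrow>\<^sub>0 'k"

definition gen :: "'r \<Rightarrow> 'v \<Rightarrow> 'v \<Rightarrow> ('k::field, 'r, 'v) rep_alg" where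
  "gen x i j = Poly_Mapping.single (Word [(x, i, j)]) 1"

definition rep_relations :: "('k::field, 'r::ring_1) dg_alg \<Rightarrow> 'v set \<Rightarrow> ('k, 'r, 'v) rep_alg set" where
  "rep_relations R B =
     {gen (x + y) i j - (gen x i j + gen y i j) | x y i j. i \<in> B \<and> j \<in> B}
   \<union> {gen (scal R c x) i j - pscale c (gen x i j) | c x i j. i \<in> B \<and> j \<in> B}
   \<union> {gen 1 i j - (if i = j then 1 else 0) | i j. i \<in> B \<and> j \<in> B}
   \<union> {gen (x * y) i j - (\<Sum>l\<in>B. gen x i l * gen y l j) | x y i j. i \<in> B \<and> j \<in> B}
   \<union> {gen x i j * gen y k l - ksign (m * n) * (gen y k l * gen x i j) | x y i j k l m n.
        x \<in> piece R m \<and> y \<in> piece R n \<and> i \<in> B \<and> j \<in> B \<and> k \<in> B \<and> l \<in> B}"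

definition rep_ideal :: "('k::field, 'r::ring_1) dg_alg \<Rightarrow> 'v set \<Rightarrow> ('k, 'r, 'v) rep_alg set" where
  "rep_ideal R B = module.span pscale {f * g * h | f g h. g \<in> rep_relations R B}"

definition homogeneous_word :: "('k, 'r) dg_alg \<Rightarrow> 'v set \<Rightarrow> int \<Rightarrow> ('r \<times> 'v \<times> 'v) word \<Rightarrow> bool" where
  "homogeneous_word R B n w \<longleftrightarrow>
    (\<exists>ms. list_all2 (\<lambda>(x, i, j) m. x \<in> piece R m \<and> i \<in> B \<and> j \<in> B) (letters w) ms \<and> sum_list ms = n)"

definition rep_deg :: "('k::field, 'r) dg_alg \<Rightarrow> 'v set \<Rightarrow> int \<Rightarrow> ('k, 'r, 'v) rep_alg set" where
  "rep_deg R B n = module.span pscale {Poly_Mapping.single w 1 | w. homogeneous_word R B n w}"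

text \<open>
  \<open>rep_parity\<close> is multiplication by \<open>(-1)\<^sup>n\<close> in degree \<open>n\<close> modulo the relations, and \<open>rep_dif\<close> is the
  derivation with \<open>d(x\<^sub>i\<^sub>j) = (dx)\<^sub>i\<^sub>j\<close>.
\<close>

definition rep_parity :: "('k::field, 'r::ring_1) dg_alg \<Rightarrow> ('k, 'r, 'v) rep_alg \<Rightarrow> ('k, 'r, 'v) rep_alg" where
  "rep_parity R = lin_ext pscale
     (\<lambda>w. Poly_Mapping.single (Word (map (\<lambda>(x, i, j). (parity R x, i, j)) (letters w))) 1)"

fun dif_letters :: "('k::field, 'r::ring_1) dg_alg \<Rightarrow> ('r \<times> 'v \<times> 'v) list \<Rightarrow> ('k, 'r, 'v) rep_alg" where
  "dif_letters R [] = 0"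
| "dif_letters R ((x, i, j) # ls) =
     gen (dif R x) i j * Poly_Mapping.single (Word ls) 1 + gen (parity R x) i j * dif_letters R ls"

definition rep_dif :: "('k::field, 'r::ring_1) dg_alg \<Rightarrow> ('k, 'r, 'v) rep_alg \<Rightarrow> ('k, 'r, 'v) rep_alg" where
  "rep_dif R = lin_ext pscale (\<lambda>w. dif_letters R (letters w))"

definition RVbar :: "('k::field, 'r::ring_1) dg_alg \<Rightarrow> 'v set \<Rightarrow> ('k, 'r, 'v) rep_alg cplx" where
  "RVbar R B = \<lparr>deg_part = rep_deg R B, null_part = (\<lambda>_. module.span pscale (insert 1 (rep_ideal R B))),
                differential = rep_dif R\<rparr>"


subsection \<open>The universal property of the representation algebra\<close>

lemma lookup_pscale: "Poly_Mapping.lookup (pscale c t) b = c * Poly_Mapping.lookup t b"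
  by (simp add: pscale_def Poly_Mapping.map.rep_eq when_def)

lemma vector_space_pscale: "vector_space (pscale :: 'k::field \<Rightarrow> ('b \<Rightarrow>\<^sub>0 'k) \<Rightarrow> _)"
  by unfold_locales (auto intro!: poly_mapping_eqI simp: lookup_pscale lookup_add algebra_simps)

lemma pscale_single: "pscale c (Poly_Mapping.single b d) = Poly_Mapping.single b (c * d)"
  by (rule poly_mapping_eqI) (simp add: lookup_pscale lookup_single when_def)

lemma pm_sum_single: "t = (\<Sum>b\<in>Poly_Mapping.keys t. Poly_Mapping.single b (Poly_Mapping.lookup t b))"
  by (rule poly_mapping_eqI)
    (auto simp: lookup_sum lookup_single when_def in_keys_iff sum.delta[OF finite_keys] sum.delta'[OF finite_keys])

lemma pm_induct [case_names zero add]: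
  assumes "P 0" and "\<And>t b c. P t \<Longrightarrow> P (t + Poly_Mapping.single b c)"
  shows "P (t :: 'b \<Rightarrow>\<^sub>0 'k::ab_group_add)"
proof -
  have "P (\<Sum>b\<in>S. Poly_Mapping.single b (f b))" if "finite S" for S and f :: "'b \<Rightarrow> 'k"
    using that by (induction S) (simp_all add: assms add.commute[of "Poly_Mapping.single _ _"])
  from this[OF finite_keys, where f = "Poly_Mapping.lookup t"] show ?thesis
    using pm_sum_single[of t] by metis
qed

lemma lin_ext_alt:
  assumes "vector_space s" "finite S" "Poly_Mapping.keys t \<subseteq> S"
  shows "lin_ext s f t = (\<Sum>b\<in>S. s (Poly_Mapping.lookup t b) (f b))"
proof -
  interpret vector_space s by fact
  show ?thesis unfolding lin_ext_def
    by (rule sum.mono_neutral_left) (use assms in \<open>auto simp: in_keys_iff\<close>)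
qed

lemma lin_ext_add:
  assumes "vector_space s"
  shows "lin_ext s f (t + u) = lin_ext s f t + lin_ext s f u"
proof -
  interpret vector_space s by fact
  let ?S = "Poly_Mapping.keys t \<union> Poly_Mapping.keys u"
  have "finite ?S" by simp
  note * = lin_ext_alt[OF assms this]
  have "Poly_Mapping.keys (t + u) \<subseteq> ?S" by (rule Poly_Mapping.keys_add)
  then show ?thesis
    by (simp add: * lookup_add scale_left_distrib sum.distrib)
qed

lemma lin_ext_single:
  assumes "vector_space s"
  shows "lin_ext s f (Poly_Mapping.single b c) = s c (f b)"
proof -
  interpret vector_space s by fact
  show ?thesis by (simp add: lin_ext_alt[OF assms, where S="{b}"])
qed

lemma lin_ext_0: "lin_ext s f 0 = 0"
  by (simp add: lin_ext_def)

lemma lin_ext_scale: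
  fixes s :: "'k::field \<Rightarrow> 'c::ab_group_add \<Rightarrow> 'c" and t :: "'b \<Rightarrow>\<^sub>0 'k"
  assumes "vector_space s"
  shows "lin_ext s f (pscale c t) = s c (lin_ext s f t)"
proof -
  interpret vector_space s by fact
  interpret p: vector_space "pscale :: 'k \<Rightarrow> ('b \<Rightarrow>\<^sub>0 'k) \<Rightarrow> _" by (rule vector_space_pscale)
  show ?thesis
    by (induction t rule: pm_induct)
      (simp_all add: lin_ext_0 lin_ext_add[OF assms] lin_ext_single[OF assms] p.scale_right_distrib
        scale_right_distrib pscale_single)
qed

lemma lin_ext_linear:
  fixes s :: "'k::field \<Rightarrow> 'c::ab_group_add \<Rightarrow> 'c" and f :: "'b \<Rightarrow> 'c"
  assumes "vector_space s"
  shows "Vector_Spaces.linear pscale s (lin_ext s f)"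
proof -
  interpret vector_space s by fact
  interpret p: vector_space "pscale :: 'k \<Rightarrow> ('b \<Rightarrow>\<^sub>0 'k) \<Rightarrow> _" by (rule vector_space_pscale)
  show ?thesis
    unfolding Vector_Spaces.linear_iff
    using vector_space_axioms p.vector_space_axioms by (simp add: lin_ext_add[OF assms] lin_ext_scale[OF assms])
qed

lemma lin_ext_mult:
  assumes C: "k_algebra s" and F: "\<And>v w. F (v + w) = F v * F w"
  shows "lin_ext s F (f * g) = lin_ext s F f * lin_ext s F (g :: ('x::monoid_add) \<Rightarrow>\<^sub>0 'k::field)"
proof -
  have vs: "vector_space s" using C by (simp add: k_algebra_def)
  interpret vector_space s by fact
  have m1: "s c x * y = s c (x * y)" and m2: "x * s c y = s c (x * y)" for c x y
    using C by (metis k_algebra_def)+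
  note [simp] = lin_ext_0 lin_ext_add[OF vs] lin_ext_single[OF vs] mult_single F m1 m2 distrib_left distrib_right
  have *: "lin_ext s F (Poly_Mapping.single v c * g) = lin_ext s F (Poly_Mapping.single v c) * lin_ext s F g" for v c
    by (induction g rule: pm_induct) (simp_all add: algebra_simps)
  show ?thesis
    by (induction f rule: pm_induct) (use * in \<open>simp_all\<close>)
qed

definition comm_dg_algebra :: "('k::field, 'r::ring_1) dg_alg \<Rightarrow> bool" where
  "comm_dg_algebra C \<longleftrightarrow> dg_algebra C \<and>
    (\<forall>m n. \<forall>x \<in> piece C m. \<forall>y \<in> piece C n. x * y = ksign (m * n) * (y * x))"

text \<open>Homomorphisms of DG algebras \<open>R \<rightarrow> End V \<otimes> C\<close>, given by their matrix entries, and \<open>R\<^sub>V \<rightarrow> C\<close>.\<close>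

definition matrix_rep :: "('k::field, 'r::ring_1) dg_alg \<Rightarrow> 'v set \<Rightarrow> ('k, 'c::ring_1) dg_alg
    \<Rightarrow> ('r \<Rightarrow> 'v \<Rightarrow> 'v \<Rightarrow> 'c) \<Rightarrow> bool" where
  "matrix_rep R B C \<rho> \<longleftrightarrow> (\<forall>i \<in> B. \<forall>j \<in> B.
     (\<forall>x y. \<rho> (x + y) i j = \<rho> x i j + \<rho> y i j) \<and>
     (\<forall>c x. \<rho> (scal R c x) i j = scal C c (\<rho> x i j)) \<and>
     \<rho> 1 i j = (if i = j then 1 else 0) \<and>
     (\<forall>x y. \<rho> (x * y) i j = (\<Sum>l\<in>B. \<rho> x i l * \<rho> y l j)) \<and>
     (\<forall>n. \<forall>x \<in> piece R n. \<rho> x i j \<in> piece C n \<and> \<rho> (dif R x) i j = dif C (\<rho> x i j)))"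

definition rep_alg_hom :: "('k::field, 'r::ring_1) dg_alg \<Rightarrow> 'v set \<Rightarrow> ('k, 'c::ring_1) dg_alg
    \<Rightarrow> (('k, 'r, 'v) rep_alg \<Rightarrow> 'c) \<Rightarrow> bool" where
  "rep_alg_hom R B C \<phi> \<longleftrightarrow>
     Vector_Spaces.linear pscale (scal C) \<phi> \<and> \<phi> 1 = 1 \<and> (\<forall>f g. \<phi> (f * g) = \<phi> f * \<phi> g) \<and>
     (\<forall>f \<in> rep_ideal R B. \<phi> f = 0) \<and>
     (\<forall>n. \<forall>f \<in> rep_deg R B n. \<phi> f \<in> piece C n \<and> \<phi> (rep_dif R f) = dif C (\<phi> f))"

lemma ksign_mult: "ksign (m + n) = ksign m * ksign n"
  by (auto simp: ksign_def)

lemma parity_homogeneous: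
  assumes R: "dg_algebra R" and x: "x \<in> piece R n"
  shows "parity R x = ksign n * x"
proof -
  have "is_decomposition R x (\<lambda>m. if m = n then x else 0)"
  proof -
    have vs: "vector_space (scal R)" and sub: "\<And>m. module.subspace (scal R) (piece R m)"
      using R by (auto simp: dg_algebra_def k_algebra_def)
    interpret vector_space "scal R" by fact
    have "{m. (if m = n then x else 0) \<noteq> 0} = (if x = 0 then {} else {n})" by auto
    then show ?thesis
      unfolding is_decomposition_def using x subspace_0[OF sub] by auto
  qed
  moreover have "\<exists>!f. is_decomposition R x f" using R by (simp add: dg_algebra_def)
  ultimately have c: "component R x = (\<lambda>m. if m = n then x else 0)"
    unfolding component_def by (rule the1_equality[rotated])
  have "{m. (if m = n then x else 0) \<noteq> 0} = (if x = 0 then {} else {n})" by auto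
  then show ?thesis by (simp add: parity_def c)
qed

lemma single_Word_Cons:
  "Poly_Mapping.single (Word ((x, i, j) # ls)) 1 = gen x i j * Poly_Mapping.single (Word ls) (1 :: 'k::field)"
  by (simp add: gen_def mult_single plus_word_def)

lemma single_Word_Nil: "Poly_Mapping.single (Word []) 1 = 1"
  by (metis zero_word_def single_one)

lemma rep_dif_gen: "rep_dif R (gen x i j) = gen (dif R x) i j"
proof -
  have "rep_dif R (gen x i j) = pscale 1 (gen (dif R x) i j * 1)"
    unfolding rep_dif_def gen_def lin_ext_single[OF vector_space_pscale]
    by (simp add: single_Word_Nil gen_def)
  also have "\<dots> = gen (dif R x) i j"
    by (rule poly_mapping_eqI) (simp add: lookup_pscale)
  finally show ?thesis .
qed

lemma homogeneous_word_gen: "\<lbrakk>x \<in> piece R n; i \<in> B; j \<in> B\<rbrakk> \<Longrightarrow> homogeneous_word R B n (Word [(x, i, j)])"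
  unfolding homogeneous_word_def by (rule exI[of _ "[n]"]) simp

lemma gen_in_rep_deg:
  fixes R :: "('k::field, 'r::ring_1) dg_alg"
  assumes "x \<in> piece R n" "i \<in> B" "j \<in> B"
  shows "gen x i j \<in> rep_deg R B n"
proof -
  interpret p: vector_space "pscale :: 'k \<Rightarrow> (_ \<Rightarrow>\<^sub>0 'k) \<Rightarrow> _" by (rule vector_space_pscale)
  show ?thesis unfolding rep_deg_def gen_def
    by (rule p.span_base) (use homogeneous_word_gen[OF assms] in blast)
qed

lemma relation_in_ideal:
  fixes R :: "('k::field, 'r::ring_1) dg_alg"
  assumes "r \<in> rep_relations R B" shows "r \<in> rep_ideal R B"
proof -
  interpret p: vector_space "pscale :: 'k \<Rightarrow> (_ \<Rightarrow>\<^sub>0 'k) \<Rightarrow> _" by (rule vector_space_pscale)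
  have "1 * r * 1 \<in> rep_ideal R B"
    unfolding rep_ideal_def by (rule p.span_base) (use assms in blast)
  then show ?thesis by simp
qed

lemma rep_alg_hom_imp_matrix_rep:
  assumes C: "comm_dg_algebra C" and h: "rep_alg_hom R B C \<phi>"
  shows "matrix_rep R B C (\<lambda>x i j. \<phi> (gen x i j))"
proof -
  have lin: "Vector_Spaces.linear pscale (scal C) \<phi>" and one: "\<phi> 1 = 1" and mult: "\<And>f g. \<phi> (f * g) = \<phi> f * \<phi> g"
    and ideal: "\<And>f. f \<in> rep_ideal R B \<Longrightarrow> \<phi> f = 0"
    and deg: "\<And>f n. f \<in> rep_deg R B n \<Longrightarrow> \<phi> f \<in> piece C n"
    and dif: "\<And>f n. f \<in> rep_deg R B n \<Longrightarrow> \<phi> (rep_dif R f) = dif C (\<phi> f)"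
    using h by (auto simp: rep_alg_hom_def)
  interpret Vector_Spaces.linear pscale "scal C" \<phi> by (rule lin)
  have rel: "\<phi> a = \<phi> b" if "a - b \<in> rep_relations R B" for a b
    using ideal[OF relation_in_ideal[OF that]] by (simp add: diff)
  show ?thesis
    unfolding matrix_rep_def
  proof (intro ballI conjI allI)
    fix i j assume ij: "i \<in> B" "j \<in> B"
    show "\<phi> (gen (x + y) i j) = \<phi> (gen x i j) + \<phi> (gen y i j)" for x y
      unfolding add[symmetric] by (rule rel) (use ij in \<open>unfold rep_relations_def Un_iff mem_Collect_eq, blast\<close>)
    show "\<phi> (gen (scal R c x) i j) = scal C c (\<phi> (gen x i j))" for c x
      unfolding scale[symmetric] by (rule rel) (use ij in \<open>unfold rep_relations_def Un_iff mem_Collect_eq, blast\<close>)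
    have "\<phi> (gen 1 i j) = \<phi> (if i = j then 1 else 0)"
      by (rule rel) (use ij in \<open>unfold rep_relations_def Un_iff mem_Collect_eq, blast\<close>)
    then show "\<phi> (gen 1 i j) = (if i = j then 1 else 0)" by (auto simp: one zero)
    show "\<phi> (gen (x * y) i j) = (\<Sum>l\<in>B. \<phi> (gen x i l) * \<phi> (gen y l j))" for x y
      unfolding mult[symmetric] sum[symmetric] by (rule rel) (use ij in \<open>unfold rep_relations_def Un_iff mem_Collect_eq, blast\<close>)
    fix n x assume x: "x \<in> piece R n"
    show "\<phi> (gen x i j) \<in> piece C n" by (rule deg[OF gen_in_rep_deg[OF x ij]])
    show "\<phi> (gen (dif R x) i j) = dif C (\<phi> (gen x i j))"
      using dif[OF gen_in_rep_deg[OF x ij]] by (simp add: rep_dif_gen)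
  qed
qed

lemma rep_alg_hom_unique:
  assumes hom: "rep_alg_hom R B C \<phi>" "rep_alg_hom R B C \<psi>"
    and gen: "\<And>x i j. \<lbrakk>i \<in> B; j \<in> B\<rbrakk> \<Longrightarrow> \<phi> (gen x i j) = \<psi> (gen x i j)"
    and f: "f \<in> rep_deg R B n"
  shows "\<phi> f = \<psi> f"
proof -
  have lin: "Vector_Spaces.linear pscale (scal C) \<phi>" "Vector_Spaces.linear pscale (scal C) \<psi>"
    using hom by (auto simp: rep_alg_hom_def)
  interpret vector_space_pair pscale "scal C"
    using lin(1) vector_space_pscale by (auto simp: Vector_Spaces.linear_iff vector_space_pair_def)
  have "\<phi> (Poly_Mapping.single (Word ls) 1) = \<psi> (Poly_Mapping.single (Word ls) 1)"
    if "list_all2 (\<lambda>(x, i, j) m. x \<in> piece R m \<and> i \<in> B \<and> j \<in> B) ls ms" for ls ms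
    using that
  proof (induction ls ms rule: list_all2_induct)
    case Nil
    then show ?case using hom by (simp add: single_Word_Nil rep_alg_hom_def)
  next
    case (Cons y ls m ms)
    then show ?case using hom gen by (cases y) (simp add: single_Word_Cons rep_alg_hom_def)
  qed
  then have "\<phi> g = \<psi> g" if "g \<in> {Poly_Mapping.single w 1 | w. homogeneous_word R B n w}" for g
    using that by (auto simp: homogeneous_word_def) (metis word.collapse)
  then show ?thesis
    using linear_eq_on_span[OF lin] f unfolding rep_deg_def by blast
qed

lemma matrix_rep_imp_rep_alg_hom:
  fixes C :: "('k::field, 'c::ring_1) dg_alg" and R :: "('k, 'r::ring_1) dg_alg" and B :: "'v set"
  assumes R: "dg_algebra R" and C: "comm_dg_algebra C" and \<rho>: "matrix_rep R B C \<rho>"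
  shows "\<exists>\<phi>. rep_alg_hom R B C \<phi> \<and> (\<forall>x. \<forall>i\<in>B. \<forall>j\<in>B. \<phi> (gen x i j) = \<rho> x i j)"
proof -
  define L where "L = (\<lambda>(x, i, j). if i \<in> B \<and> j \<in> B then \<rho> x i j else 0)"
  define F where "F w = prod_list (map L (letters w))" for w
  define \<phi> where "\<phi> = lin_ext (scal C) F"
  have dg: "dg_algebra C" and comm: "\<And>m n x y. \<lbrakk>x \<in> piece C m; y \<in> piece C n\<rbrakk> \<Longrightarrow> x * y = ksign (m * n) * (y * x)"
    using C unfolding comm_dg_algebra_def by blast+
  have alg: "k_algebra (scal C)" and vs: "vector_space (scal C)"
    and sub: "\<And>n. module.subspace (scal C) (piece C n)" and one0: "1 \<in> piece C 0"
    and mdeg: "\<And>m n x y. \<lbrakk>x \<in> piece C m; y \<in> piece C n\<rbrakk> \<Longrightarrow> x * y \<in> piece C (m + n)"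
    and dlin: "Vector_Spaces.linear (scal C) (scal C) (dif C)"
    and leib: "\<And>n x y. x \<in> piece C n \<Longrightarrow> dif C (x * y) = dif C x * y + ksign n * (x * dif C y)"
    using dg unfolding dg_algebra_def k_algebra_def by blast+
  interpret c: vector_space "scal C" by fact
  interpret p: vector_space "pscale :: 'k \<Rightarrow> ('k, 'r, 'v) rep_alg \<Rightarrow> _" by (rule vector_space_pscale)
  have lin: "Vector_Spaces.linear pscale (scal C) \<phi>"
    unfolding \<phi>_def by (rule lin_ext_linear[OF vs])
  interpret \<phi>: Vector_Spaces.linear pscale "scal C" \<phi> by (rule lin)
  interpret d: Vector_Spaces.linear "scal C" "scal C" "dif C" by (rule dlin)
  have dp: "Vector_Spaces.linear pscale pscale (rep_dif R :: ('k, 'r, 'v) rep_alg \<Rightarrow> _)"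
    unfolding rep_dif_def by (rule lin_ext_linear[OF vector_space_pscale])
  have mult: "\<phi> (f * g) = \<phi> f * \<phi> g" for f g
    unfolding \<phi>_def by (rule lin_ext_mult[OF alg]) (simp add: F_def plus_word_def)
  have single: "\<phi> (Poly_Mapping.single (Word ls) 1) = prod_list (map L ls)" for ls
    by (simp add: \<phi>_def lin_ext_single[OF vs] F_def)
  have one: "\<phi> 1 = 1"
    using single[of "[]"] by (simp add: single_Word_Nil)
  have gen: "\<phi> (gen x i j) = \<rho> x i j" if "i \<in> B" "j \<in> B" for x i j
    using that by (simp add: gen_def single L_def)
  have ks: "\<phi> (ksign m * f) = ksign m * \<phi> f" for m f
    by (auto simp: ksign_def \<phi>.neg)
  have padd: "\<rho> (x + y) i j = \<rho> x i j + \<rho> y i j" and pscal: "\<rho> (scal R c x) i j = scal C c (\<rho> x i j)"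
    and p1: "\<rho> 1 i j = (if i = j then 1 else 0)" and pmult: "\<rho> (x * y) i j = (\<Sum>l\<in>B. \<rho> x i l * \<rho> y l j)"
    and pdeg: "\<And>n. x \<in> piece R n \<Longrightarrow> \<rho> x i j \<in> piece C n"
    and pdif: "\<And>n. x \<in> piece R n \<Longrightarrow> \<rho> (dif R x) i j = dif C (\<rho> x i j)"
    if "i \<in> B" "j \<in> B" for i j x y c
    using \<rho> that unfolding matrix_rep_def by blast+
  have pneg: "\<rho> (- x) i j = - \<rho> x i j" if "i \<in> B" "j \<in> B" for x i j
  proof -
    have "\<rho> 0 i j = 0" using padd[OF that, of 0 0] by simp
    then show ?thesis using padd[OF that, of x "- x"] by (simp add: eq_neg_iff_add_eq_0 add.commute)
  qed
  have rel: "\<phi> r = 0" if "r \<in> rep_relations R B" for r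
  proof -
    have 5: "\<phi> (gen x i j * gen y k l - ksign (m * n) * (gen y k l * gen x i j)) = 0"
      if "x \<in> piece R m" "y \<in> piece R n" "i \<in> B" "j \<in> B" "k \<in> B" "l \<in> B" for x y i j k l m n
      using comm[OF pdeg[OF that(3,4,1)] pdeg[OF that(5,6,2)]] that
      by (simp only: \<phi>.diff ks) (simp only: mult gen diff_self)
    have 4: "\<phi> (gen (x * y) i j - (\<Sum>l\<in>B. gen x i l * gen y l j)) = 0" if "i \<in> B" "j \<in> B" for x y i j
      using that by (simp add: \<phi>.diff \<phi>.sum gen mult pmult)
    have 3: "\<phi> (gen 1 i j - (if i = j then 1 else 0)) = 0" if "i \<in> B" "j \<in> B" for i j
      using that by (auto simp: \<phi>.diff \<phi>.zero gen p1 one)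
    have 2: "\<phi> (gen (scal R c x) i j - pscale c (gen x i j)) = 0" if "i \<in> B" "j \<in> B" for c x i j
      using that by (simp add: \<phi>.diff \<phi>.scale gen pscal)
    have 1: "\<phi> (gen (x + y) i j - (gen x i j + gen y i j)) = 0" if "i \<in> B" "j \<in> B" for x y i j
      using that by (simp add: \<phi>.diff \<phi>.add gen padd)
    show ?thesis
      using that 1 2 3 4 5 unfolding rep_relations_def Un_iff mem_Collect_eq by (elim disjE exE conjE) (simp_all only:)
  qed
  have ideal: "\<phi> f = 0" if "f \<in> rep_ideal R B" for f
    using that unfolding rep_ideal_def
    by (rule \<phi>.eq_0_on_span[rotated]) (auto simp: mult rel)
  have word: "prod_list (map L ls) \<in> piece C (sum_list ms) \<and> \<phi> (dif_letters R ls) = dif C (prod_list (map L ls))"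
    if "list_all2 (\<lambda>(x, i, j) m. x \<in> piece R m \<and> i \<in> B \<and> j \<in> B) ls ms" for ls ms
    using that
  proof (induction ls ms rule: list_all2_induct)
    case Nil
    have "dif C 1 = 0" using leib[OF one0, of 1] by (simp add: ksign_def)
    then show ?case by (simp add: one0 \<phi>.zero)
  next
    case (Cons y ls m ms)
    obtain x i j where y: "y = (x, i, j)" by (cases y)
    with Cons have x: "x \<in> piece R m" and ij: "i \<in> B" "j \<in> B" by auto
    have "\<rho> (parity R x) i j = ksign m * \<rho> x i j"
      unfolding parity_homogeneous[OF R x] by (simp add: ksign_def pneg ij)
    then have "\<phi> (dif_letters R (y # ls)) = \<rho> (dif R x) i j * prod_list (map L ls) +
        ksign m * (\<rho> x i j * dif C (prod_list (map L ls)))"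
      by (simp add: y \<phi>.add mult gen ij single Cons.IH mult.assoc)
    then show ?case
      using mdeg[OF pdeg[OF ij x] conjunct1[OF Cons.IH]] leib[OF pdeg[OF ij x]] ij
      by (simp add: y L_def pdif[OF ij x])
  qed
  have wordf: "\<phi> f \<in> piece C n \<and> \<phi> (rep_dif R f) = dif C (\<phi> f)"
    if fw: "f \<in> {Poly_Mapping.single w 1 | w. homogeneous_word R B n w}" for f n
  proof -
    obtain ls ms where f: "f = Poly_Mapping.single (Word ls) 1" and n: "sum_list ms = n"
      and ls: "list_all2 (\<lambda>(x, i, j) m. x \<in> piece R m \<and> i \<in> B \<and> j \<in> B) ls ms"
    proof -
      obtain w where w: "f = Poly_Mapping.single w 1" "homogeneous_word R B n w" using fw by blast
      then show thesis using that[of "letters w"] by (auto simp: homogeneous_word_def)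
    qed
    show ?thesis
      using word[OF ls] n by (simp add: f single rep_dif_def lin_ext_single[OF vector_space_pscale])
  qed
  have deg: "\<phi> f \<in> piece C n \<and> \<phi> (rep_dif R f) = dif C (\<phi> f)" if "f \<in> rep_deg R B n" for f n
    using that unfolding rep_deg_def
  proof (induction rule: p.span_induct_alt)
    case base
    interpret dp: Vector_Spaces.linear pscale pscale "rep_dif R :: ('k, 'r, 'v) rep_alg \<Rightarrow> _" by (rule dp)
    show ?case by (simp add: \<phi>.zero dp.zero d.zero c.subspace_0[OF sub])
  next
    case (step c g h)
    interpret dp: Vector_Spaces.linear pscale pscale "rep_dif R :: ('k, 'r, 'v) rep_alg \<Rightarrow> _" by (rule dp)
    show ?case
      using wordf[OF step(1)] step(2)
      by (simp add: \<phi>.add \<phi>.scale dp.add dp.scale d.add d.scale c.subspace_add[OF sub] c.subspace_scale[OF sub])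
  qed
  have "rep_alg_hom R B C \<phi>"
    unfolding rep_alg_hom_def using lin one mult ideal deg by blast
  with gen show ?thesis by blast
qed

theorem rep_algebra_universal:
  assumes R: "dg_algebra R" and C: "comm_dg_algebra C"
  shows "rep_alg_hom R B C \<phi> \<Longrightarrow> matrix_rep R B C (\<lambda>x i j. \<phi> (gen x i j))"
    and "matrix_rep R B C \<rho> \<Longrightarrow>
      \<exists>\<phi>. rep_alg_hom R B C \<phi> \<and> (\<forall>x. \<forall>i\<in>B. \<forall>j\<in>B. \<phi> (gen x i j) = \<rho> x i j)"
    and "\<lbrakk>rep_alg_hom R B C \<phi>; rep_alg_hom R B C \<psi>; \<forall>x. \<forall>i\<in>B. \<forall>j\<in>B. \<phi> (gen x i j) = \<psi> (gen x i j)\<rbrakk>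
      \<Longrightarrow> \<forall>n. \<forall>f \<in> rep_deg R B n. \<phi> f = \<psi> f"
proof -
  show "rep_alg_hom R B C \<phi> \<Longrightarrow> matrix_rep R B C (\<lambda>x i j. \<phi> (gen x i j))"
    by (rule rep_alg_hom_imp_matrix_rep[OF C])
  show "matrix_rep R B C \<rho> \<Longrightarrow>
      \<exists>\<phi>. rep_alg_hom R B C \<phi> \<and> (\<forall>x. \<forall>i\<in>B. \<forall>j\<in>B. \<phi> (gen x i j) = \<rho> x i j)"
    by (rule matrix_rep_imp_rep_alg_hom[OF R C])
  show "\<lbrakk>rep_alg_hom R B C \<phi>; rep_alg_hom R B C \<psi>; \<forall>x. \<forall>i\<in>B. \<forall>j\<in>B. \<phi> (gen x i j) = \<psi> (gen x i j)\<rbrakk>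
      \<Longrightarrow> \<forall>n. \<forall>f \<in> rep_deg R B n. \<phi> f = \<psi> f"
    by (intro allI ballI) (rule rep_alg_hom_unique, auto)
qed


section \<open>Kaehler differentials\<close>

type_synonym ('k, 'r, 'v) rep_forms = "('k, ('k, 'r, 'v) rep_alg) tensors"

text \<open>\<open>tens f g\<close> stands for \<open>f \<partial>g\<close>; the last set contains the Leibniz rule \<open>\<partial>(gh) = g \<partial>h + (\<partial>g) h\<close>.\<close>

definition kaehler_null :: "('k::field, 'r::ring_1) dg_alg \<Rightarrow> 'v set
    \<Rightarrow> ('k, 'r, 'v) rep_forms set" where
  "kaehler_null R B = module.span pscale
    (tensor_null pscale
     \<union> {tens f g | f g. f \<in> rep_ideal R B \<or> g \<in> rep_ideal R B}
     \<union> {tens f (g * h) - (tens (f * g) h + pscale (ksign (p * q)) (tens (f * h) g)) | f g h m p q.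
          f \<in> rep_deg R B m \<and> g \<in> rep_deg R B p \<and> h \<in> rep_deg R B q})"

definition kaehler_deg :: "('k::field, 'r::ring_1) dg_alg \<Rightarrow> 'v set \<Rightarrow> int
    \<Rightarrow> ('k, 'r, 'v) rep_forms set" where
  "kaehler_deg R B n =
     module.span pscale {tens f g | f g p q. f \<in> rep_deg R B p \<and> g \<in> rep_deg R B q \<and> p + q = n}"

definition kaehler_dif :: "('k::field, 'r::ring_1) dg_alg
    \<Rightarrow> ('k, 'r, 'v) rep_forms \<Rightarrow> ('k, 'r, 'v) rep_forms" where
  "kaehler_dif R = lin_ext pscale (\<lambda>(f, g). tens (rep_dif R f) g + tens (rep_parity R f) (rep_dif R g))"

definition Omega_com :: "('k::field, 'r::ring_1) dg_alg \<Rightarrow> 'v set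
    \<Rightarrow> ('k, 'r, 'v) rep_forms cplx" where
  "Omega_com R B = \<lparr>deg_part = kaehler_deg R B, null_part = (\<lambda>_. kaehler_null R B), differential = kaehler_dif R\<rparr>"

definition de_rham :: "('k::field, 'r, 'v) rep_alg \<Rightarrow> ('k, 'r, 'v) rep_forms" where
  "de_rham g = tens 1 g"


section \<open>Representation homology and cyclic representation homology\<close>

abbreviation H_rep :: "('k::field, 'r::ring_1) dg_alg \<Rightarrow> 'v set \<Rightarrow> int \<Rightarrow> ('k, 'r, 'v) rep_alg set set" where
  "H_rep R B n \<equiv> homology (RVbar R B) n"

abbreviation H_forms :: "('k::field, 'r::ring_1) dg_alg \<Rightarrow> 'v set \<Rightarrow> int
    \<Rightarrow> ('k, 'r, 'v) rep_forms set set" where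
  "H_forms R B n \<equiv> homology (Omega_com R B) n"

definition XplusV :: "('k::field, 'r::ring_1) dg_alg \<Rightarrow> 'v set
    \<Rightarrow> (nat \<Rightarrow> ('k, 'r, 'v) rep_alg \<times> ('k, 'r, 'v) rep_forms) cplx" where
  "XplusV R B = Tot (RVbar R B) (Omega_com R B) (\<lambda>_. 0) de_rham"

abbreviation HC_rep :: "('k::field, 'r::ring_1) dg_alg \<Rightarrow> 'v set \<Rightarrow> int
    \<Rightarrow> (nat \<Rightarrow> ('k, 'r, 'v) rep_alg \<times> ('k, 'r, 'v) rep_forms) set set" where
  "HC_rep R B n \<equiv> homology (XplusV R B) n"

text \<open>
  The complex \<open>R\<^sub>V/k \<oplus> (\<Omega>/\<partial>R\<^sub>V)[1] \<oplus> (\<Omega>/\<partial>R\<^sub>V)[3] \<oplus> \<dots>\<close> and the quasi-isomorphism from \<open>Tot X\<^sup>+(R)\<^sub>V\<close> to it.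
\<close>

definition Split :: "('k::field, 'r::ring_1) dg_alg \<Rightarrow> 'v set
    \<Rightarrow> (('k, 'r, 'v) rep_alg \<times> (nat \<Rightarrow> ('k, 'r, 'v) rep_forms)) cplx" where
  "Split R B = \<lparr>
     deg_part = (\<lambda>n. rep_deg R B n \<times> {\<omega>. \<forall>j. \<omega> j \<in> kaehler_deg R B (n - 1 - 2 * int j)}),
     null_part = (\<lambda>n. null_part (RVbar R B) n \<times>
       {\<omega>. \<forall>j. \<omega> j \<in> module.span pscale (kaehler_null R B \<union> de_rham ` rep_deg R B (n - 1 - 2 * int j))}),
     differential = (\<lambda>(r, \<omega>). (rep_dif R r, \<lambda>j. - kaehler_dif R (\<omega> j)))\<rparr>"

definition to_split :: "(nat \<Rightarrow> 'c \<times> 'd) \<Rightarrow> 'c \<times> (nat \<Rightarrow> 'd)" where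
  "to_split u = (fst (u 0), \<lambda>j. snd (u j))"

definition split_iso :: "('k::field, 'r::ring_1) dg_alg \<Rightarrow> 'v set \<Rightarrow> int
    \<Rightarrow> (nat \<Rightarrow> ('k, 'r, 'v) rep_alg \<times> ('k, 'r, 'v) rep_forms) set
    \<Rightarrow> (('k, 'r, 'v) rep_alg \<times> (nat \<Rightarrow> ('k, 'r, 'v) rep_forms)) set" where
  "split_iso R B n = induced_map (Split R B) n to_split"

text \<open>\<open>S_rep\<close> here and \<open>Tr_tilde\<close> below are given by representatives in \<open>Split\<close> and transported along \<open>split_iso\<close>.\<close>

definition S_rep :: "('k::field, 'r::ring_1) dg_alg \<Rightarrow> 'v set \<Rightarrow> int
    \<Rightarrow> (nat \<Rightarrow> ('k, 'r, 'v) rep_alg \<times> ('k, 'r, 'v) rep_forms) set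
    \<Rightarrow> (nat \<Rightarrow> ('k, 'r, 'v) rep_alg \<times> ('k, 'r, 'v) rep_forms) set" where
  "S_rep R B n h = inv_into (HC_rep R B (n - 2)) (split_iso R B (n - 2))
     (induced (Split R B) (n - 2)
        (\<lambda>(r, \<omega>) (r', \<omega>'). r' \<in> rep_deg R B (n - 2) \<and>
            de_rham r' - kaehler_dif R (\<omega> 0) \<in> kaehler_null R B \<and> (\<forall>j. \<omega>' j = \<omega> (Suc j)))
        (split_iso R B n h))"

definition B_rep :: "('k::field, 'r::ring_1) dg_alg \<Rightarrow> 'v set \<Rightarrow> int
    \<Rightarrow> ('k, 'r, 'v) rep_alg set \<Rightarrow> ('k, 'r, 'v) rep_forms set" where
  "B_rep R B n = induced_map (Omega_com R B) n de_rham"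


section \<open>Traces\<close>

definition tr_alg :: "'v set \<Rightarrow> 'r \<Rightarrow> ('k::field, 'r, 'v) rep_alg" where
  "tr_alg B x = (\<Sum>i\<in>B. gen x i i)"

text \<open>
  Under \<open>\<Omega>\<^sup>1(R)\<^sub>V \<cong> \<Omega>\<^sup>1(R\<^sub>V)\<close> the canonical map \<open>\<Omega>\<^sup>1(R) \<rightarrow> End V \<otimes> \<Omega>\<^sup>1(R)\<^sub>V\<close> is the bimodule map that sends
  \<open>\<partial>x\<close> to the matrix of the \<open>\<partial>(x\<^sub>i\<^sub>j)\<close>; thus \<open>a \<partial>b\<close> goes to the matrix with entries \<open>\<Sum>\<^sub>l a\<^sub>i\<^sub>l \<partial>(b\<^sub>l\<^sub>j)\<close>.
\<close>

definition form_matrix :: "'v set \<Rightarrow> ('r \<times> 'r \<Rightarrow>\<^sub>0 'k::field) \<Rightarrow> 'v \<Rightarrow> 'v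
    \<Rightarrow> ('k, 'r, 'v) rep_forms" where
  "form_matrix B t i j = lin_ext pscale (\<lambda>(a, b). \<Sum>l\<in>B. tens (gen a i l) (gen b l j)) t"

definition tr_form :: "'v set \<Rightarrow> ('r \<times> 'r \<Rightarrow>\<^sub>0 'k::field)
    \<Rightarrow> ('k, 'r, 'v) rep_forms" where
  "tr_form B t = (\<Sum>i\<in>B. form_matrix B t i i)"

definition Tr_HC :: "('k::field, 'r::ring_1) dg_alg \<Rightarrow> 'v set \<Rightarrow> int \<Rightarrow> 'r set \<Rightarrow> ('k, 'r, 'v) rep_alg set" where
  "Tr_HC R B n = induced_map (RVbar R B) n (tr_alg B)"

definition Tr_HH :: "('k::field, 'r::ring_1) dg_alg \<Rightarrow> 'v set \<Rightarrow> int
    \<Rightarrow> ('r \<times> ('k, 'r) tensors) set \<Rightarrow> ('k, 'r, 'v) rep_forms set" where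
  "Tr_HH R B n = induced_map (Omega_com R B) n (\<lambda>(r, \<omega>). tr_form B \<omega>)"

definition Tr_tilde :: "('k::field, 'r::ring_1) dg_alg \<Rightarrow> 'v set \<Rightarrow> int \<Rightarrow> 'r set
    \<Rightarrow> (nat \<Rightarrow> ('k, 'r, 'v) rep_alg \<times> ('k, 'r, 'v) rep_forms) set" where
  "Tr_tilde R B n c = inv_into (HC_rep R B n) (split_iso R B n)
     (induced (Split R B) n
        (\<lambda>r y. \<exists>u. cycle_lift R n r u \<and> y = (tr_alg B (fst (u 0)), \<lambda>j. tr_form B (snd (u j)))) c)"

end

theory Submission
  imports Defs
begin

text \<open>
  Both squares come from one morphism of bicomplexes. The trace sends \<open>r\<close> to \<open>\<Sum> r\<^sub>i\<^sub>i\<close> and \<open>a \<partial>b\<close> to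
  \<open>\<Sum> a\<^sub>i\<^sub>l \<partial>(b\<^sub>l\<^sub>i)\<close>. It kills graded commutators, so that \<open>\<beta>\<close> on the side of \<open>R\<close> corresponds to \<open>0\<close> on the
  side of \<open>R\<^sub>V\<close>; it kills \<open>[R, \<Omega>\<^sup>1(R)]\<close>, by the Leibniz rule and graded commutativity of \<open>R\<^sub>V\<close>
  (\<open>trf_form_null\<close>); and it carries \<open>\<partial>\<close> to \<open>\<partial>\<^sub>V\<close> (\<open>trf_univ_der\<close>). So it induces a chain map \<open>Tr_X\<close> from
  \<open>Tot X\<^sup>+(R)\<close> to \<open>Tot X\<^sup>+(R)\<^sub>V\<close>. If \<open>u = (r\<^sub>n, \<omega>\<^sub>n\<^sub>-\<^sub>1, r\<^sub>n\<^sub>-\<^sub>2, \<dots>)\<close> is a cycle lifting \<open>r\<^sub>n\<close>, then \<open>S\<close> takes the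
  class of \<open>r\<^sub>n\<close> to that of \<open>r\<^sub>n\<^sub>-\<^sub>2\<close>, of which \<open>shift2 u\<close> is a lift; the operator \<open>S\<^sub>V\<close> is induced by
  \<open>shift2\<close> as well (\<open>S_rep_class\<close>), and \<open>Tr_X\<close> commutes with \<open>shift2\<close>. The Connes differential takes the
  class of \<open>r\<close> to that of \<open>(0, \<partial>r)\<close> (\<open>connecting_class\<close>), so the second square says that
  \<open>\<partial>\<^sub>V (Tr r)\<close> and \<open>Tr (\<partial>r)\<close> are equal.

  What takes work is that the maps in the squares are well defined on homology. For \<open>R\<close> this means that a cycle of
  \<open>R/(k + [R, R])\<close> lifts to \<open>Tot X\<^sup>+(R)\<close>, uniquely up to boundaries. Both statements follow by
  climbing from column to column (\<open>cycle_lifting\<close>, \<open>cycle_is_boundary\<close>), given that the rows are exact: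
  \<open>ker \<partial> = k + [R, R]\<close> and \<open>ker \<beta> = im \<partial>\<close>. For \<open>R\<^sub>V\<close> it means that \<open>Tot X\<^sup>+(R)\<^sub>V\<close> maps
  quasi-isomorphically to \<open>R\<^sub>V/k \<oplus> (\<Omega>/\<partial>R\<^sub>V)[1] \<oplus> \<dots>\<close> (\<open>split_iso_bij\<close>), which holds because \<open>\<partial>\<^sub>V\<close> is
  injective on \<open>R\<^sub>V/k\<close>.

  These facts use that \<open>R\<close> is free and that \<open>k\<close> has characteristic zero, by way of the Euler derivation
  \<open>E\<close>, which multiplies a word in the generators by its length. The contraction \<open>a \<partial>b \<mapsto> a E(b)\<close> sends
  \<open>\<partial>r\<close> to \<open>E(r)\<close>, and \<open>E\<close> is invertible on words of positive length; this gives \<open>ker \<partial>\<close>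
  (\<open>kernel_univ_der\<close>) and, with the derivation of \<open>R\<^sub>V\<close> induced by \<open>E\<close>, also \<open>ker \<partial>\<^sub>V\<close>
  (\<open>de_rham_injective\<close>). For \<open>ker \<beta>\<close>, one writes a form modulo \<open>[R, \<Omega>\<^sup>1(R)]\<close> as \<open>\<Sum> a \<partial>x\<close> with generators
  \<open>x\<close>. Then \<open>\<beta>\<close> becomes \<open>1 - t\<close> for the signed rotation \<open>t\<close> of words, while \<open>\<partial>\<close> becomes the sum of all
  rotations; on the invariants of \<open>t\<close> the latter is multiplication by the length (\<open>rotation_homotopy\<close>).

  Since all complexes are given by representatives, an equation in a complex is a congruence modulo
  its null part. Where the null part is a subspace of finitely supported functions, the congruences
  are turned into equations by applying a linear map with exactly this kernel (\<open>mod_out\<close>).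
\<close>

section \<open>Complexes given by representatives\<close>

definition subgrp :: "'c::ab_group_add set \<Rightarrow> bool" where
  "subgrp S \<longleftrightarrow> 0 \<in> S \<and> (\<forall>x \<in> S. \<forall>y \<in> S. x - y \<in> S)"

lemma subgrp_zero: "subgrp S \<Longrightarrow> 0 \<in> S"
  by (simp add: subgrp_def)

lemma subgrp_diff: "\<lbrakk>subgrp S; x \<in> S; y \<in> S\<rbrakk> \<Longrightarrow> x - y \<in> S"
  by (simp add: subgrp_def)

lemma subgrp_uminus: "\<lbrakk>subgrp S; x \<in> S\<rbrakk> \<Longrightarrow> - x \<in> S"
  using subgrp_diff[of S 0 x] by (simp add: subgrp_zero)

lemma subgrp_add: "\<lbrakk>subgrp S; x \<in> S; y \<in> S\<rbrakk> \<Longrightarrow> x + y \<in> S"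
  using subgrp_diff[of S x "- y"] by (simp add: subgrp_uminus)

lemma subgrp_swap: "\<lbrakk>subgrp S; x - y \<in> S\<rbrakk> \<Longrightarrow> y - x \<in> S"
  using subgrp_uminus[of S "x - y"] by simp

lemma subgrp_coset_eq:
  assumes S: "subgrp S" and xy: "x - y \<in> S"
  shows "x +o S = y +o S"
proof (rule set_eqI)
  fix z
  have "z - x \<in> S \<longleftrightarrow> z - y \<in> S"
    using subgrp_add[OF S _ xy, of "z - x"] subgrp_diff[OF S _ xy, of "z - y"] by auto
  then show "z \<in> x +o S \<longleftrightarrow> z \<in> y +o S"
    by (simp add: set_minus_plus)
qed

lemma in_coset_iff: "z \<in> x +o S \<longleftrightarrow> z - x \<in> (S :: 'c::ab_group_add set)"
  by (simp add: set_minus_plus)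

text \<open>
  The null part of a degree need not lie in its \<open>deg_part\<close>, and \<open>univ_der\<close> is additive only modulo the
  null part. Therefore a homogeneous map of degree \<open>s\<close> is required to respect null elements of the right
  degree, and to be additive up to null elements.
\<close>

definition graded_map :: "'c::ab_group_add cplx \<Rightarrow> 'd::ab_group_add cplx \<Rightarrow> int \<Rightarrow> ('c \<Rightarrow> 'd) \<Rightarrow> bool" where
  "graded_map C D s f \<longleftrightarrow> (\<forall>n.
     (\<forall>x \<in> deg_part C n. f x \<in> deg_part D (n + s)) \<and>
     (\<forall>x \<in> deg_part C n. \<forall>y \<in> deg_part C n. f (x - y) - (f x - f y) \<in> null_part D (n + s)) \<and>
     (\<forall>x \<in> deg_part C n \<inter> null_part C n. f x \<in> null_part D (n + s)))"

definition chain_complex :: "'c::ab_group_add cplx \<Rightarrow> bool" where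
  "chain_complex C \<longleftrightarrow>
     (\<forall>n. subgrp (deg_part C n)) \<and> (\<forall>n. subgrp (null_part C n)) \<and>
     graded_map C C (- 1) (differential C) \<and>
     (\<forall>n. \<forall>x \<in> deg_part C n. differential C (differential C x) \<in> null_part C (n - 2))"

lemma chain_complexD:
  assumes "chain_complex C"
  shows "subgrp (deg_part C n)" "subgrp (null_part C n)" "graded_map C C (- 1) (differential C)"
    and "x \<in> deg_part C n \<Longrightarrow> m - n = - 2 \<Longrightarrow> differential C (differential C x) \<in> null_part C m"
proof -
  note a = assms[unfolded chain_complex_def]
  show "subgrp (deg_part C n)" "subgrp (null_part C n)" "graded_map C C (- 1) (differential C)"
    using a by blast+
  assume "x \<in> deg_part C n" "m - n = - 2"
  moreover from this have "m = n - 2" by simp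
  ultimately show "differential C (differential C x) \<in> null_part C m" using a by blast
qed

text \<open>
  The conditions on degrees are stated as \<open>m - n = s\<close>: as a rewrite rule this cannot loop, whereas
  \<open>m = n + s\<close> can.
\<close>

locale graded_map_between =
  fixes C :: "'c::ab_group_add cplx" and D :: "'d::ab_group_add cplx" and s f
  assumes f: "graded_map C D s f" and C: "chain_complex C" and D: "chain_complex D"
begin

lemma deg: "\<lbrakk>x \<in> deg_part C n; m - n = s\<rbrakk> \<Longrightarrow> f x \<in> deg_part D m"
  using f unfolding graded_map_def diff_eq_eq add.commute[of s] by blast

lemma diff: "\<lbrakk>x \<in> deg_part C n; y \<in> deg_part C n; m - n = s\<rbrakk> \<Longrightarrow> f (x - y) - (f x - f y) \<in> null_part D m"
  using f unfolding graded_map_def diff_eq_eq add.commute[of s] by blast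

lemma null: "\<lbrakk>x \<in> null_part C n; x \<in> deg_part C n; m - n = s\<rbrakk> \<Longrightarrow> f x \<in> null_part D m"
  using f unfolding graded_map_def diff_eq_eq add.commute[of s] by blast

lemma zero: "f 0 \<in> null_part D m"
  using null[of 0 "m - s" m] chain_complexD(1,2)[OF C] by (simp add: subgrp_zero)

lemma uminus: "\<lbrakk>x \<in> deg_part C n; m - n = s\<rbrakk> \<Longrightarrow> f (- x) + f x \<in> null_part D m"
  using diff[of 0 n x m] zero[of m] chain_complexD(1)[OF C, of n] subgrp_add[OF chain_complexD(2)[OF D]]
  by (fastforce simp: subgrp_zero algebra_simps)

lemma add:
  assumes "x \<in> deg_part C n" "y \<in> deg_part C n" "m - n = s"
  shows "f (x + y) - (f x + f y) \<in> null_part D m"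
proof -
  note N = chain_complexD(2)[OF D, of m]
  have "- y \<in> deg_part C n" using assms chain_complexD(1)[OF C] by (simp add: subgrp_uminus)
  from subgrp_diff[OF N diff[OF assms(1) this assms(3)] uminus[OF assms(2,3)]]
  show ?thesis by (simp add: algebra_simps)
qed

lemma cong:
  assumes "x - y \<in> null_part C n" "x \<in> deg_part C n" "y \<in> deg_part C n" "m - n = s"
  shows "f x - f y \<in> null_part D m"
proof -
  have "x - y \<in> deg_part C n" using assms chain_complexD(1)[OF C] by (simp add: subgrp_diff)
  from subgrp_diff[OF chain_complexD(2)[OF D] null[OF assms(1) this assms(4)] diff[OF assms(2-4)]]
  show ?thesis by simp
qed

end

lemma chain_complex_differential: "chain_complex C \<Longrightarrow> graded_map_between C C (- 1) (differential C)"
  by (simp add: graded_map_between_def chain_complexD)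

lemma cycles_subgrp:
  assumes "chain_complex C" shows "subgrp (cycles C n)"
  unfolding subgrp_def
proof (intro conjI ballI)
  interpret d: graded_map_between C C "- 1" "differential C" by (rule chain_complex_differential[OF assms])
  note cc = chain_complexD(1,2)[OF assms]
  show "0 \<in> cycles C n" using d.zero cc by (simp add: cycles_def subgrp_zero)
  fix x y assume "x \<in> cycles C n" "y \<in> cycles C n"
  then have xy: "x \<in> deg_part C n" "y \<in> deg_part C n"
    "differential C x \<in> null_part C (n - 1)" "differential C y \<in> null_part C (n - 1)"
    by (auto simp: cycles_def)
  have "differential C (x - y) - (differential C x - differential C y) \<in> null_part C (n - 1)"
    using d.diff[OF xy(1,2), of "n - 1"] by simp
  from subgrp_add[OF cc(2) this subgrp_diff[OF cc(2) xy(3,4)]]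
  show "x - y \<in> cycles C n" using subgrp_diff[OF cc(1) xy(1,2)] by (simp add: cycles_def)
qed

lemma boundaries_subgrp:
  assumes "chain_complex C" shows "subgrp (boundaries C n)"
  unfolding subgrp_def
proof (intro conjI ballI)
  interpret d: graded_map_between C C "- 1" "differential C" by (rule chain_complex_differential[OF assms])
  note cc = chain_complexD(1,2)[OF assms]
  show "0 \<in> boundaries C n"
    using d.zero[of n] cc subgrp_diff[of "null_part C n" 0 "differential C 0"]
    by (auto simp: boundaries_def subgrp_zero intro!: bexI[of _ 0])
  fix x y assume "x \<in> boundaries C n" "y \<in> boundaries C n"
  then obtain v w where x: "x \<in> deg_part C n" "v \<in> deg_part C (n + 1)" "x - differential C v \<in> null_part C n"
    and y: "y \<in> deg_part C n" "w \<in> deg_part C (n + 1)" "y - differential C w \<in> null_part C n"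
    by (auto simp: boundaries_def)
  have "x - y - differential C (v - w) \<in> null_part C n"
    using subgrp_diff[OF cc(2) subgrp_diff[OF cc(2) x(3) y(3)] d.diff[OF x(2) y(2), of n]]
    by (simp add: algebra_simps)
  then show "x - y \<in> boundaries C n"
    using subgrp_diff[OF cc(1)] x y by (auto simp: boundaries_def)
qed

lemma boundary_is_cycle:
  assumes "chain_complex C" "x \<in> boundaries C n" shows "x \<in> cycles C n"
proof -
  interpret d: graded_map_between C C "- 1" "differential C" by (rule chain_complex_differential[OF assms(1)])
  note cc = chain_complexD[OF assms(1)]
  obtain v where x: "x \<in> deg_part C n" "v \<in> deg_part C (n + 1)" "x - differential C v \<in> null_part C n"
    using assms(2) by (auto simp: boundaries_def)
  have "differential C v \<in> deg_part C n" using d.deg[OF x(2), of n] by simp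
  from subgrp_add[OF cc(2) d.cong[OF x(3) x(1) this, of "n - 1"] cc(4)[OF x(2), of "n - 1"]]
  show ?thesis using x(1) by (simp add: cycles_def)
qed

lemma boundariesI:
  "\<lbrakk>v \<in> deg_part C (n + 1); u - differential C v \<in> null_part C n; u \<in> deg_part C n\<rbrakk> \<Longrightarrow> u \<in> boundaries C n"
  by (auto simp: boundaries_def)

lemma homology_class_eq:
  "\<lbrakk>chain_complex C; x - y \<in> boundaries C n\<rbrakk> \<Longrightarrow> x +o boundaries C n = y +o boundaries C n"
  by (simp add: subgrp_coset_eq boundaries_subgrp)

lemma cycle_congruent:
  assumes "chain_complex C" "x \<in> cycles C n" "y - x \<in> boundaries C n"
  shows "y \<in> cycles C n"
  using subgrp_add[OF cycles_subgrp[OF assms(1)] boundary_is_cycle[OF assms(1,3)] assms(2)] by simp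

text \<open>
  A null element is the boundary of \<open>0\<close>, up to a null element.
\<close>

lemma null_is_boundary:
  assumes "chain_complex C" "x \<in> deg_part C n" "x \<in> null_part C n" shows "x \<in> boundaries C n"
proof -
  interpret d: graded_map_between C C "- 1" "differential C" by (rule chain_complex_differential[OF assms(1)])
  note cc = chain_complexD[OF assms(1)]
  show ?thesis
    using assms(2) subgrp_diff[OF cc(2) assms(3) d.zero] subgrp_zero[OF cc(1)]
    by (auto simp: boundaries_def)
qed

text \<open>
  This computes a map given by a relation \<open>\<rho>\<close> on representatives: it suffices to know one related pair,
  and that all elements related to a homologous representative are homologous.
\<close>

lemma induced_class:
  assumes C: "chain_complex C" and D: "chain_complex D" and xy: "\<rho> x y"
    and wd: "\<And>x' y'. \<lbrakk>x' - x \<in> boundaries C n; \<rho> x' y'\<rbrakk> \<Longrightarrow> y' - y \<in> boundaries D m"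
  shows "induced D m \<rho> (x +o boundaries C n) = y +o boundaries D m"
proof -
  have "x \<in> x +o boundaries C n"
    using subgrp_zero[OF boundaries_subgrp[OF C]] by (simp add: in_coset_iff)
  moreover have "y' +o boundaries D m = y +o boundaries D m" if "x' \<in> x +o boundaries C n" "\<rho> x' y'" for x' y'
    using that wd by (intro homology_class_eq[OF D]) (auto simp: in_coset_iff)
  ultimately show ?thesis
    unfolding induced_def using xy by blast
qed

definition chain_map :: "'c::ab_group_add cplx \<Rightarrow> 'd::ab_group_add cplx \<Rightarrow> ('c \<Rightarrow> 'd) \<Rightarrow> bool" where
  "chain_map C D f \<longleftrightarrow> graded_map C D 0 f \<and>
     (\<forall>n. \<forall>x \<in> deg_part C n. f (differential C x) - differential D (f x) \<in> null_part D (n - 1))"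

locale chain_map_between =
  fixes C :: "'c::ab_group_add cplx" and D :: "'d::ab_group_add cplx" and f
  assumes chain_map: "chain_map C D f" and C: "chain_complex C" and D: "chain_complex D"
begin

sublocale graded_map_between C D 0 f
  using chain_map C D by (simp add: graded_map_between_def chain_map_def)

lemma commute: "\<lbrakk>x \<in> deg_part C n; m - n = - 1\<rbrakk> \<Longrightarrow> f (differential C x) - differential D (f x) \<in> null_part D m"
  using chain_map unfolding chain_map_def diff_eq_eq by (metis add.commute uminus_add_conv_diff)

lemma cycles: assumes "x \<in> cycles C n" shows "f x \<in> cycles D n"
proof -
  interpret d: graded_map_between C C "- 1" "differential C" by (rule chain_complex_differential[OF C])
  have x: "x \<in> deg_part C n" "differential C x \<in> null_part C (n - 1)" using assms by (auto simp: cycles_def)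
  have "differential C x \<in> deg_part C (n - 1)" using d.deg[OF x(1), of "n - 1"] by simp
  from subgrp_diff[OF chain_complexD(2)[OF D] null[OF x(2) this, of "n - 1"] commute[OF x(1), of "n - 1"]]
  show ?thesis using deg[OF x(1), of n] by (simp add: cycles_def)
qed

lemma boundaries: assumes "x \<in> boundaries C n" shows "f x \<in> boundaries D n"
proof -
  interpret d: graded_map_between C C "- 1" "differential C" by (rule chain_complex_differential[OF C])
  note N = chain_complexD(2)[OF D]
  obtain v where x: "x \<in> deg_part C n" "v \<in> deg_part C (n + 1)" "x - differential C v \<in> null_part C n"
    using assms by (auto simp: boundaries_def)
  have "differential C v \<in> deg_part C n" using d.deg[OF x(2), of n] by simp
  from subgrp_add[OF N cong[OF x(3) x(1) this, of n] commute[OF x(2), of n]]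
  show ?thesis using deg[OF x(1), of n] deg[OF x(2), of "n + 1"] by (auto simp: boundaries_def)
qed

lemma boundaries_diff:
  assumes "x \<in> cycles C n" "y \<in> cycles C n" "x - y \<in> boundaries C n"
  shows "f x - f y \<in> boundaries D n"
proof -
  note N = chain_complexD(2)[OF D]
  have xy: "x \<in> deg_part C n" "y \<in> deg_part C n" using assms by (auto simp: cycles_def)
  have "f (x - y) - (f x - f y) \<in> boundaries D n"
  proof (rule null_is_boundary[OF D])
    show "f (x - y) - (f x - f y) \<in> null_part D n" using diff[OF xy, of n] by simp
    show "f (x - y) - (f x - f y) \<in> deg_part D n"
      using xy chain_complexD(1)[OF C, of n] chain_complexD(1)[OF D, of n] deg[where m = n] by (simp add: subgrp_diff)
  qed
  from subgrp_diff[OF boundaries_subgrp[OF D] boundaries[OF assms(3)] this] show ?thesis by simp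
qed

lemma induced_map_class:
  assumes "x \<in> cycles C n"
  shows "induced_map D n f (x +o boundaries C n) = f x +o boundaries D n"
  unfolding induced_map_def
  by (rule induced_class[OF C D]) (use assms boundaries_diff cycle_congruent[OF C] in blast)+

lemma induced_map_homology: "induced_map D n f \<in> homology C n \<rightarrow> homology D n"
  using induced_map_class cycles by (fastforce simp: homology_def)

end

section \<open>Periodic bicomplexes\<close>

text \<open>
  The rows \<open>C \<leftarrow> D \<leftarrow> C \<leftarrow> D \<leftarrow> \<dots>\<close> of a bicomplex such as \<open>X\<^sup>+(R)\<close> and \<open>X\<^sup>+(R)\<^sub>V\<close>.
\<close>

locale periodic =
  fixes C :: "'c::ab_group_add cplx" and D :: "'d::ab_group_add cplx" and b e
  assumes b_map: "chain_map D C b" and e_map: "chain_map C D e" and CC: "chain_complex C" and DD: "chain_complex D"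
    and be: "\<And>n x. x \<in> deg_part C n \<Longrightarrow> b (e x) \<in> null_part C n"
    and eb: "\<And>n y. y \<in> deg_part D n \<Longrightarrow> e (b y) \<in> null_part D n"
begin

sublocale b: chain_map_between D C b by (simp add: chain_map_between_def b_map CC DD)
sublocale e: chain_map_between C D e by (simp add: chain_map_between_def e_map CC DD)
sublocale dC: graded_map_between C C "- 1" "differential C" by (rule chain_complex_differential[OF CC])
sublocale dD: graded_map_between D D "- 1" "differential D" by (rule chain_complex_differential[OF DD])

lemmas gC = chain_complexD(1)[OF CC] and gD = chain_complexD(1)[OF DD]
lemmas nC = chain_complexD(2)[OF CC] and nD = chain_complexD(2)[OF DD]
lemmas ddC = chain_complexD(4)[OF CC] and ddD = chain_complexD(4)[OF DD]

abbreviation T where "T \<equiv> Tot C D b e"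
abbreviation PC where "PC \<equiv> deg_part C"
abbreviation PD where "PD \<equiv> deg_part D"
abbreviation NC where "NC \<equiv> null_part C"
abbreviation ND where "ND \<equiv> null_part D"
abbreviation dC where "dC \<equiv> differential C"
abbreviation dD where "dD \<equiv> differential D"

lemma Tot_deg: "u \<in> deg_part T n \<longleftrightarrow>
    (\<forall>j. fst (u j) \<in> PC (n - 2 * int j) \<and> snd (u j) \<in> PD (n - 1 - 2 * int j))"
  by (simp add: Tot_def)

lemma Tot_null: "u \<in> null_part T n \<longleftrightarrow>
    (\<forall>j. fst (u j) \<in> NC (n - 2 * int j) \<and> snd (u j) \<in> ND (n - 1 - 2 * int j))"
  by (simp add: Tot_def)

lemma Tot_dif: "differential T u j =
    (dC (fst (u j)) + b (snd (u j)), e (fst (u (Suc j))) - dD (snd (u j)))"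
  by (simp add: Tot_def)

lemma Tot_dif_fst:
  assumes "r \<in> PC m" "\<omega> \<in> PD (m - 1)"
  shows "dC (dC r + b \<omega>) + b (- dD \<omega>) \<in> NC (m - 2)"
proof -
  have 1: "dC r \<in> PC (m - 1)" "b \<omega> \<in> PC (m - 1)"
    using dC.deg[OF assms(1), of "m - 1"] b.deg[OF assms(2), of "m - 1"] by simp_all
  have 2: "dD \<omega> \<in> PD (m - 2)" using dD.deg[OF assms(2), of "m - 2"] by simp
  from subgrp_add[OF nC dC.add[OF 1, of "m - 2"] subgrp_add[OF nC ddC[OF assms(1), of "m - 2"]
      subgrp_diff[OF nC b.uminus[OF 2, of "m - 2"] b.commute[OF assms(2), of "m - 2"]]]]
  show ?thesis by (simp add: algebra_simps)
qed

lemma Tot_dif_snd: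
  assumes "r \<in> PC (m - 1)" "\<omega> \<in> PD m" "\<omega>' \<in> PD (m - 2)"
  shows "e (dC r + b \<omega>') - dD (e r - dD \<omega>) \<in> ND (m - 2)"
proof -
  have 1: "dC r \<in> PC (m - 2)" "b \<omega>' \<in> PC (m - 2)"
    using dC.deg[OF assms(1), of "m - 2"] b.deg[OF assms(3), of "m - 2"] by simp_all
  have 2: "dD \<omega> \<in> PD (m - 1)" "e r \<in> PD (m - 1)"
    using dD.deg[OF assms(2), of "m - 1"] e.deg[OF assms(1), of "m - 1"] by simp_all
  from subgrp_add[OF nD e.add[OF 1, of "m - 2"] subgrp_add[OF nD eb[OF assms(3)]
    subgrp_diff[OF nD subgrp_add[OF nD e.commute[OF assms(1), of "m - 2"] ddD[OF assms(2), of "m - 2"]]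
      dD.diff[OF 2(2,1), of "m - 2"]]]]
  show ?thesis by (simp add: algebra_simps)
qed

lemma chain_complex_Tot: "chain_complex T"
  unfolding chain_complex_def
proof (intro conjI allI ballI)
  fix n
  show "subgrp (deg_part T n)"
    unfolding subgrp_def Ball_def Tot_deg using gC gD by (simp add: subgrp_zero subgrp_diff)
  show "subgrp (null_part T n)"
    unfolding subgrp_def Ball_def Tot_null using nC nD by (simp add: subgrp_zero subgrp_diff)
  fix u assume "u \<in> deg_part T n"
  then have u: "fst (u j) \<in> PC (n - 2 * int j)" "snd (u j) \<in> PD (n - 1 - 2 * int j)" for j
    by (auto simp: Tot_deg)
  have *: "fst (u (Suc j)) \<in> PC (n - 1 - 2 * int j - 1)"
     "snd (u (Suc j)) \<in> PD (n - 1 - 2 * int j - 2)" for j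
    using u[of "Suc j"] by (simp_all add: algebra_simps)
  show "differential T (differential T u) \<in> null_part T (n - 2)"
    unfolding Tot_null Tot_dif fst_conv snd_conv
  proof (intro allI conjI)
    fix j
    have "e (fst (u (Suc j))) \<in> PD (n - 2 - 2 * int j)" "dD (snd (u j)) \<in> PD (n - 2 - 2 * int j)"
      using e.deg[OF *(1)[of j], of "n - 2 - 2 * int j"] dD.deg[OF u(2)[of j], of "n - 2 - 2 * int j"] by simp_all
    note 1 = b.diff[OF this, of "n - 2 - 2 * int j"]
    have 2: "b (e (fst (u (Suc j)))) \<in> NC (n - 2 - 2 * int j)"
      using be[OF *(1)[of j]] by (simp add: algebra_simps)
    have "dD (snd (u j)) \<in> PD (n - 2 - 2 * int j)"
      using dD.deg[OF u(2)[of j], of "n - 2 - 2 * int j"] by simp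
    note 3 = b.uminus[OF this, of "n - 2 - 2 * int j"]
    have "snd (u j) \<in> PD (n - 2 * int j - 1)" using u(2)[of j] by (simp add: algebra_simps)
    note 4 = Tot_dif_fst[OF u(1) this]
    have 4: "dC (dC (fst (u j)) + b (snd (u j))) + b (- dD (snd (u j)))
        \<in> NC (n - 2 - 2 * int j)" using 4 by (simp add: algebra_simps)
    from subgrp_add[OF nC 4 subgrp_add[OF nC 2 subgrp_diff[OF nC 1[simplified] 3[simplified]]]]
    show "dC (dC (fst (u j)) + b (snd (u j))) + b (e (fst (u (Suc j))) - dD (snd (u j)))
         \<in> NC (n - 2 - 2 * int j)"
      by (simp add: algebra_simps)
    show "e (dC (fst (u (Suc j))) + b (snd (u (Suc j)))) -
          dD (e (fst (u (Suc j))) - dD (snd (u j)))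
          \<in> ND (n - 2 - 1 - 2 * int j)"
      using Tot_dif_snd[OF *(1) u(2) *(2)] by (simp add: algebra_simps)
  qed
next
  show "graded_map T T (- 1) (differential T)"
    unfolding graded_map_def
  proof (intro allI conjI ballI)
    fix n u assume "u \<in> deg_part T n"
    then have u: "fst (u j) \<in> PC (n - 2 * int j)" "snd (u j) \<in> PD (n - 1 - 2 * int j)" for j
      by (auto simp: Tot_deg)
    have u': "fst (u (Suc j)) \<in> PC (n - 2 - 2 * int j)" for j
      using u[of "Suc j"] by (simp add: algebra_simps)
    show "differential T u \<in> deg_part T (n + - 1)"
      unfolding Tot_deg Tot_dif fst_conv snd_conv
    proof (intro allI conjI)
      fix j
      show "dC (fst (u j)) + b (snd (u j)) \<in> PC (n + - 1 - 2 * int j)"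
        by (rule subgrp_add[OF gC dC.deg[OF u(1)] b.deg[OF u(2)]]) simp_all
      show "e (fst (u (Suc j))) - dD (snd (u j)) \<in> PD (n + - 1 - 1 - 2 * int j)"
        by (rule subgrp_diff[OF gD e.deg[OF u'] dD.deg[OF u(2)]]) simp_all
    qed
    fix v assume "v \<in> deg_part T n"
    then have v: "fst (v j) \<in> PC (n - 2 * int j)" "snd (v j) \<in> PD (n - 1 - 2 * int j)" for j
      by (auto simp: Tot_deg)
    have v': "fst (v (Suc j)) \<in> PC (n - 2 - 2 * int j)" for j
      using v[of "Suc j"] by (simp add: algebra_simps)
    show "differential T (u - v) - (differential T u - differential T v) \<in> null_part T (n + - 1)"
      unfolding Tot_null fun_diff_def Tot_dif fst_conv snd_conv fst_diff snd_diff
    proof (intro allI conjI)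
      fix j
      from subgrp_add[OF nC dC.diff[OF u(1) v(1), of "n - 1 - 2 * int j"] b.diff[OF u(2) v(2), of "n - 1 - 2 * int j"]]
      show "dC (fst (u j) - fst (v j)) + b (snd (u j) - snd (v j)) -
            (dC (fst (u j)) + b (snd (u j)) - (dC (fst (v j)) + b (snd (v j))))
            \<in> NC (n + - 1 - 2 * int j)" by (simp add: algebra_simps)
      from subgrp_diff[OF nD e.diff[OF u' v', of "n - 2 - 2 * int j"] dD.diff[OF u(2) v(2), of "n - 2 - 2 * int j"]]
      show "e (fst (u (Suc j)) - fst (v (Suc j))) - dD (snd (u j) - snd (v j)) -
            (e (fst (u (Suc j))) - dD (snd (u j)) - (e (fst (v (Suc j))) - dD (snd (v j))))
            \<in> ND (n + - 1 - 1 - 2 * int j)" by (simp add: algebra_simps)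
    qed
  next
    fix n u assume "u \<in> deg_part T n \<inter> null_part T n"
    then have u: "fst (u j) \<in> PC (n - 2 * int j)" "snd (u j) \<in> PD (n - 1 - 2 * int j)"
       "fst (u j) \<in> NC (n - 2 * int j)" "snd (u j) \<in> ND (n - 1 - 2 * int j)" for j
      by (auto simp: Tot_deg Tot_null)
    have u': "fst (u (Suc j)) \<in> PC (n - 2 - 2 * int j)" "fst (u (Suc j)) \<in> NC (n - 2 - 2 * int j)" for j
      using u[of "Suc j"] by (simp_all add: algebra_simps)
    show "differential T u \<in> null_part T (n + - 1)"
      unfolding Tot_null Tot_dif fst_conv snd_conv
    proof (intro allI conjI)
      fix j
      show "dC (fst (u j)) + b (snd (u j)) \<in> NC (n + - 1 - 2 * int j)"
        by (rule subgrp_add[OF nC dC.null[OF u(3,1)] b.null[OF u(4,2)]]) simp_all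
      show "e (fst (u (Suc j))) - dD (snd (u j)) \<in> ND (n + - 1 - 1 - 2 * int j)"
        by (rule subgrp_diff[OF nD e.null[OF u'(2,1)] dD.null[OF u(4,2)]]) simp_all
    qed
  qed
qed

lemma chain_complex_Tot2: "chain_complex (Tot2 C D b)"
  unfolding chain_complex_def
proof (intro conjI allI ballI)
  fix n
  show "subgrp (deg_part (Tot2 C D b) n)"
    using gC gD by (auto simp: Tot2_def subgrp_def zero_prod_def)
  show "subgrp (null_part (Tot2 C D b) n)"
    using nC nD by (auto simp: Tot2_def subgrp_def zero_prod_def)
  fix w assume "w \<in> deg_part (Tot2 C D b) n"
  then obtain r \<omega> where w: "w = (r, \<omega>)" "r \<in> PC n" "\<omega> \<in> PD (n - 1)"
    by (auto simp: Tot2_def)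
  have "dD \<omega> \<in> PD (n - 2)" using dD.deg[OF w(3), of "n - 2"] by simp
  note 1 = dD.uminus[OF this, of "n - 3"]
  have 2: "- dD (- dD \<omega>) \<in> ND (n - 3)"
    using subgrp_diff[OF nD ddD[OF w(3), of "n - 3"] 1] by simp
  show "differential (Tot2 C D b) (differential (Tot2 C D b) w) \<in> null_part (Tot2 C D b) (n - 2)"
    using Tot_dif_fst[OF w(2,3)] 2 by (simp add: Tot2_def w(1))
next
  have "- dD (y - z) - (dD z - dD y) \<in> ND (n - 2)"
    if "y \<in> PD (n - 1)" "z \<in> PD (n - 1)" for n y z
    using subgrp_uminus[OF nD dD.diff[OF that, of "n - 2"]] by (simp add: algebra_simps)
  moreover have "dC (r - s) + b (y - z) - (dC r + b y - (dC s + b z)) \<in> NC (n - 1)"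
    if "y \<in> PD (n - 1)" "z \<in> PD (n - 1)" "r \<in> PC n" "s \<in> PC n" for n y z r s
    using subgrp_add[OF nC dC.diff[OF that(3,4), of "n - 1"] b.diff[OF that(1,2), of "n - 1"]] by (simp add: algebra_simps)
  moreover have "dC r + b y \<in> PC (n - 1)" "- dD y \<in> PD (n - 2)"
    if "r \<in> PC n" "y \<in> PD (n - 1)" for n r y
    using subgrp_add[OF gC dC.deg[OF that(1), of "n - 1"] b.deg[OF that(2), of "n - 1"]]
      subgrp_uminus[OF gD dD.deg[OF that(2), of "n - 2"]] by simp_all
  moreover have "dC r + b y \<in> NC (n - 1)" "- dD y \<in> ND (n - 2)"
    if "r \<in> PC n" "y \<in> PD (n - 1)" "r \<in> NC n" "y \<in> ND (n - 1)" for n r y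
    using subgrp_add[OF nC dC.null[OF that(3,1), of "n - 1"] b.null[OF that(4,2), of "n - 1"]]
      subgrp_uminus[OF nD dD.null[OF that(4,2), of "n - 2"]] by simp_all
  ultimately show "graded_map (Tot2 C D b) (Tot2 C D b) (- 1) (differential (Tot2 C D b))"
    unfolding graded_map_def by (auto simp: Tot2_def)
qed

text \<open>
  The next lemmas are the two steps of the climb along the columns. The hypotheses \<open>exact_C\<close> and \<open>exact_D\<close>
  are exactness of the row at \<open>C\<close> and at \<open>D\<close>.
\<close>

lemma lift_differential:
  assumes r: "r \<in> PC m" and ed: "e (dC r) \<in> ND (m - 1)"
    and exact_C: "\<And>m x. \<lbrakk>x \<in> PC m; e x \<in> ND m\<rbrakk> \<Longrightarrow> \<exists>y \<in> PD m. x - b y \<in> NC m"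
  obtains \<omega> where "\<omega> \<in> PD (m - 1)" "dC r + b \<omega> \<in> NC (m - 1)"
proof -
  have "dC r \<in> PC (m - 1)" using dC.deg[OF r, of "m - 1"] by simp
  from exact_C[OF this ed] obtain y where y: "y \<in> PD (m - 1)" "dC r - b y \<in> NC (m - 1)"
    by blast
  from subgrp_add[OF nC y(2) b.uminus[OF y(1), of "m - 1"]]
  have "dC r + b (- y) \<in> NC (m - 1)" by simp
  then show thesis using that subgrp_uminus[OF gD y(1)] by blast
qed

text \<open>
  The element \<open>d \<omega>\<close> lies in the kernel of \<open>b\<close>, because \<open>b (d \<omega>) \<equiv> d (b \<omega>) \<equiv> - d (d r)\<close>; hence it
  comes from some \<open>s\<close>, and then \<open>e (d s) \<equiv> d (d \<omega>)\<close> vanishes, so that the climb can go on from \<open>s\<close>.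
\<close>

lemma lift_form:
  assumes r: "r \<in> PC m" and w: "\<omega> \<in> PD (m - 1)"
    and dr: "dC r + b \<omega> \<in> NC (m - 1)"
    and exact_D: "\<And>m y. \<lbrakk>y \<in> PD m; b y \<in> NC m\<rbrakk> \<Longrightarrow> \<exists>x \<in> PC m. y - e x \<in> ND m"
  obtains s where "s \<in> PC (m - 2)" "e s - dD \<omega> \<in> ND (m - 2)"
    "e (dC s) \<in> ND (m - 3)"
proof -
  have 1: "dC r \<in> PC (m - 1)" "b \<omega> \<in> PC (m - 1)" "dD \<omega> \<in> PD (m - 2)"
    using dC.deg[OF r, of "m - 1"] b.deg[OF w, of "m - 1"] dD.deg[OF w, of "m - 2"] by simp_all
  have "dC (dC r + b \<omega>) \<in> NC (m - 2)"
    using dC.null[OF dr subgrp_add[OF gC 1(1,2)], of "m - 2"] by simp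
  from subgrp_add[OF nC b.commute[OF w, of "m - 2"]
    subgrp_diff[OF nC subgrp_diff[OF nC this dC.add[OF 1(1,2), of "m - 2"]] ddC[OF r, of "m - 2"]]]
  have "b (dD \<omega>) \<in> NC (m - 2)" by simp
  from exact_D[OF 1(3) this] obtain s where s: "s \<in> PC (m - 2)"
    "dD \<omega> - e s \<in> ND (m - 2)" by blast
  have 2: "e s \<in> PD (m - 2)" using e.deg[OF s(1), of "m - 2"] by simp
  from subgrp_add[OF nD e.commute[OF s(1), of "m - 3"]
    subgrp_diff[OF nD ddD[OF w, of "m - 3"] dD.cong[OF s(2) 1(3) 2, of "m - 3"]]]
  have "e (dC s) \<in> ND (m - 3)" by simp
  with s subgrp_swap[OF nD s(2)] show thesis using that by blast
qed

text \<open>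
  Surjectivity of \<open>H(Tot) \<rightarrow> H(C/im b)\<close>. The entries of the lift are chosen one column after the other;
  nothing has to terminate, since \<open>Tot\<close> consists of arbitrary sequences.
\<close>

lemma cycle_lifting:
  assumes r: "r \<in> PC n" and ed: "e (dC r) \<in> ND (n - 1)"
    and exact_C: "\<And>m x. \<lbrakk>x \<in> PC m; e x \<in> ND m\<rbrakk> \<Longrightarrow> \<exists>y \<in> PD m. x - b y \<in> NC m"
    and exact_D: "\<And>m y. \<lbrakk>y \<in> PD m; b y \<in> NC m\<rbrakk> \<Longrightarrow> \<exists>x \<in> PC m. y - e x \<in> ND m"
  obtains u where "u \<in> cycles T n" "fst (u 0) = r"
proof -
  define P where "P j w \<longleftrightarrow> fst w \<in> PC (n - 2 * int j) \<and> snd w \<in> PD (n - 2 * int j - 1) \<and>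
    dC (fst w) + b (snd w) \<in> NC (n - 2 * int j - 1) \<and> (j = 0 \<longrightarrow> fst w = r)" for j w
  define Q where "Q j w w' \<longleftrightarrow> e (fst w') - dD (snd w) \<in> ND (n - 2 * int j - 2)"
    for j :: nat and w w' :: "'c \<times> 'd"
  have "\<exists>u. \<forall>j. P j (u j) \<and> Q j (u j) (u (Suc j))"
  proof (rule dependent_nat_choice)
    obtain \<omega> where "\<omega> \<in> PD (n - 1)" "dC r + b \<omega> \<in> NC (n - 1)"
      using lift_differential[OF r ed exact_C] .
    then have "P 0 (r, \<omega>)" using r by (simp add: P_def)
    then show "\<exists>w. P 0 w" by blast
    fix w j assume "P j w"
    then have w: "fst w \<in> PC (n - 2 * int j)" "snd w \<in> PD (n - 2 * int j - 1)"
      "dC (fst w) + b (snd w) \<in> NC (n - 2 * int j - 1)" by (auto simp: P_def)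
    obtain s where s: "s \<in> PC (n - 2 * int j - 2)"
      "e s - dD (snd w) \<in> ND (n - 2 * int j - 2)"
      "e (dC s) \<in> ND (n - 2 * int j - 3)"
      using lift_form[OF w exact_D] .
    have "e (dC s) \<in> ND (n - 2 * int j - 2 - 1)" using s(3) by (simp add: algebra_simps)
    then obtain \<omega> where "\<omega> \<in> PD (n - 2 * int j - 2 - 1)"
      "dC s + b \<omega> \<in> NC (n - 2 * int j - 2 - 1)"
      using lift_differential[OF s(1) _ exact_C] by metis
    then have "P (Suc j) (s, \<omega>) \<and> Q j w (s, \<omega>)"
      using s(1,2) by (simp add: P_def Q_def algebra_simps)
    then show "\<exists>w'. P (Suc j) w' \<and> Q j w w'" by blast
  qed
  then obtain u where u: "\<And>j. P j (u j)" "\<And>j. Q j (u j) (u (Suc j))" by blast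
  have "u \<in> cycles T n"
    unfolding cycles_def mem_Collect_eq Tot_deg Tot_null Tot_dif fst_conv snd_conv
    using u unfolding P_def Q_def by (simp add: algebra_simps)
  moreover have "fst (u 0) = r" using u(1)[of 0] by (simp add: P_def)
  ultimately show thesis using that by blast
qed

text \<open>
  If \<open>\<omega>\<close> is the boundary of \<open>(x, \<eta>)\<close> in the column of \<open>D\<close>, then in the next column of \<open>C\<close> the
  discrepancy \<open>r - d x\<close> is killed by \<open>e\<close>: \<open>e r \<equiv> d \<omega> \<equiv> d (e x - d \<eta>) \<equiv> e (d x)\<close>.
\<close>

lemma transfer_discrepancy:
  assumes r: "r \<in> PC (m - 2)" and w: "\<omega> \<in> PD (m - 1)" and h: "\<eta> \<in> PD m"
    and x: "x \<in> PC (m - 1)"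
    and er: "e r - dD \<omega> \<in> ND (m - 2)"
    and ex: "\<omega> + dD \<eta> - e x \<in> ND (m - 1)"
  shows "e (r - dC x) \<in> ND (m - 2)"
proof -
  have 1: "dD \<eta> \<in> PD (m - 1)" using dD.deg[OF h, of "m - 1"] by simp
  have 7: "e x \<in> PD (m - 1)" "dC x \<in> PC (m - 2)"
    using e.deg[OF x, of "m - 1"] dC.deg[OF x, of "m - 2"] by simp_all
  have 8: "e (r - dC x) - (e r - e (dC x)) \<in> ND (m - 2)"
    using e.diff[OF r 7(2), of "m - 2"] by simp
  have 9: "e (dC x) - dD (e x) \<in> ND (m - 2)"
    using e.commute[OF x, of "m - 2"] by simp
  have 10: "dD (\<omega> + dD \<eta>) - dD (e x) \<in> ND (m - 2)"
    using dD.cong[OF ex subgrp_add[OF gD w 1] 7(1), of "m - 2"] by simp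
  have 11: "dD (\<omega> + dD \<eta>) - (dD \<omega> + dD (dD \<eta>))
      \<in> ND (m - 2)"
    using dD.add[OF w 1, of "m - 2"] by simp
  have 12: "dD (dD \<eta>) \<in> ND (m - 2)"
    using ddD[OF h, of "m - 2"] by simp
  from subgrp_add[OF nD 8 subgrp_diff[OF nD er subgrp_diff[OF nD subgrp_add[OF nD 9 11] subgrp_diff[OF nD 10 12]]]]
  show ?thesis by (simp add: algebra_simps)
qed

text \<open>
  Injectivity of \<open>H(Tot) \<rightarrow> H(C/im b)\<close>: once the first entry of a cycle is a boundary modulo the image of
  \<open>b\<close>, exactness produces the entries of a bounding chain one after the other.
\<close>

lemma cycle_is_boundary:
  assumes u: "u \<in> cycles T n" and v: "v \<in> PC (n + 1)"
    and uv: "e (fst (u 0) - dC v) \<in> ND n"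
    and exact_C: "\<And>m x. \<lbrakk>x \<in> PC m; e x \<in> ND m\<rbrakk> \<Longrightarrow> \<exists>y \<in> PD m. x - b y \<in> NC m"
    and exact_D: "\<And>m y. \<lbrakk>y \<in> PD m; b y \<in> NC m\<rbrakk> \<Longrightarrow> \<exists>x \<in> PC m. y - e x \<in> ND m"
  shows "u \<in> boundaries T n"
proof -
  have du: "u \<in> deg_part T n" and cu: "differential T u \<in> null_part T (n - 1)"
    using u by (auto simp: cycles_def)
  have u_deg: "fst (u j) \<in> PC (n - 2 * int j)" "snd (u j) \<in> PD (n - 2 * int j - 1)" for j
    using du unfolding Tot_deg by (simp_all add: algebra_simps)
  have u_fst: "dC (fst (u j)) + b (snd (u j)) \<in> NC (n - 2 * int j - 1)" for j
    using cu unfolding Tot_null Tot_dif by (simp add: algebra_simps)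
  have u_snd: "e (fst (u (Suc j))) - dD (snd (u j)) \<in> ND (n - 2 * int j - 2)" for j
    using cu unfolding Tot_null Tot_dif by (simp add: algebra_simps)
  define P where "P j w \<longleftrightarrow> fst w \<in> PC (n + 1 - 2 * int j) \<and> snd w \<in> PD (n - 2 * int j) \<and>
    fst (u j) - (dC (fst w) + b (snd w)) \<in> NC (n - 2 * int j)" for j w
  define Q where "Q j w w' \<longleftrightarrow> snd (u j) - (e (fst w') - dD (snd w)) \<in> ND (n - 2 * int j - 1)"
    for j :: nat and w w' :: "'c \<times> 'd"
  have start: "\<exists>\<eta>. P j (x, \<eta>)" if x: "x \<in> PC (n + 1 - 2 * int j)"
    and ex: "e (fst (u j) - dC x) \<in> ND (n - 2 * int j)" for x j
  proof -
    have "fst (u j) - dC x \<in> PC (n - 2 * int j)"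
      using dC.deg[OF x, of "n - 2 * int j"] by (simp add: subgrp_diff[OF gC] u_deg)
    from exact_C[OF this ex] obtain \<eta> where "\<eta> \<in> PD (n - 2 * int j)"
      "fst (u j) - dC x - b \<eta> \<in> NC (n - 2 * int j)" by blast
    then have "P j (x, \<eta>)" using x by (simp add: P_def algebra_simps)
    then show ?thesis ..
  qed
  have "\<exists>w. \<forall>j. P j (w j) \<and> Q j (w j) (w (Suc j))"
  proof (rule dependent_nat_choice)
    show "\<exists>w. P 0 w" using start[of v 0] v uv by auto
    fix w j assume "P j w"
    let ?k = "n - 2 * int j"
    obtain x \<eta> where [simp]: "w = (x, \<eta>)" by (cases w)
    have x: "x \<in> PC (?k + 1)" and \<eta>: "\<eta> \<in> PD ?k"
      and r: "fst (u j) - (dC x + b \<eta>) \<in> NC ?k"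
      using \<open>P j w\<close> by (auto simp: P_def algebra_simps)
    let ?\<theta> = "snd (u j) + dD \<eta>"
    have 1: "dC x \<in> PC ?k" "b \<eta> \<in> PC ?k"
      "dD \<eta> \<in> PD (?k - 1)"
      using dC.deg[OF x, of ?k] b.deg[OF \<eta>, of ?k] dD.deg[OF \<eta>, of "?k - 1"] by simp_all
    \<comment> \<open>\<open>snd (u j) + d \<eta>\<close> is annihilated by \<open>b\<close>, because \<open>b\<close> sends it to \<open>- d (fst (u j) - b \<eta>) \<equiv> - d (d x)\<close>.\<close>
    have 2: "b ?\<theta> - (b (snd (u j)) + b (dD \<eta>)) \<in> NC (?k - 1)"
      using b.add[OF u_deg(2)[of j] 1(3), of "?k - 1"] by simp
    have 3: "b (dD \<eta>) - dC (b \<eta>) \<in> NC (?k - 1)"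
      using b.commute[OF \<eta>, of "?k - 1"] by simp
    have 4: "dC (fst (u j)) - dC (dC x + b \<eta>) \<in> NC (?k - 1)"
      using dC.cong[OF r u_deg(1) subgrp_add[OF gC 1(1,2)], of "?k - 1"] by simp
    have 5: "dC (dC x + b \<eta>) - (dC (dC x) + dC (b \<eta>))
        \<in> NC (?k - 1)"
      using dC.add[OF 1(1,2), of "?k - 1"] by simp
    have 6: "dC (dC x) \<in> NC (?k - 1)"
      using ddC[OF x, of "?k - 1"] by simp
    from subgrp_add[OF nC 2 subgrp_add[OF nC 3 subgrp_diff[OF nC u_fst[of j]
      subgrp_add[OF nC 4 subgrp_add[OF nC 5 6]]]]]
    have b\<theta>: "b ?\<theta> \<in> NC (?k - 1)" by (simp add: algebra_simps)
    have \<theta>: "?\<theta> \<in> PD (?k - 1)" by (rule subgrp_add[OF gD u_deg(2) 1(3)])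
    from exact_D[OF this b\<theta>] obtain x' where x': "x' \<in> PC (?k - 1)" "?\<theta> - e x' \<in> ND (?k - 1)"
      by blast
    have u': "fst (u (Suc j)) \<in> PC (?k - 2)" using u_deg(1)[of "Suc j"] by (simp add: algebra_simps)
    have "e (fst (u (Suc j)) - dC x') \<in> ND (?k - 2)"
      by (rule transfer_discrepancy[OF u' u_deg(2) \<eta> x'(1) u_snd x'(2)])
    then obtain \<eta>' where "P (Suc j) (x', \<eta>')"
      using start[of x' "Suc j"] x'(1) by (auto simp: algebra_simps)
    moreover have "Q j w (x', \<eta>')" using x'(2) by (simp add: Q_def algebra_simps)
    ultimately show "\<exists>w'. P (Suc j) w' \<and> Q j w w'" by blast
  qed
  then obtain w where w: "\<And>j. P j (w j)" "\<And>j. Q j (w j) (w (Suc j))" by blast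
  have "w \<in> deg_part T (n + 1)"
    unfolding Tot_deg using w(1) by (simp add: P_def algebra_simps)
  moreover have "u - differential T w \<in> null_part T n"
    unfolding Tot_null fun_diff_def Tot_dif fst_diff snd_diff fst_conv snd_conv
    using w unfolding P_def Q_def by (simp add: algebra_simps)
  ultimately show ?thesis using du by (auto simp: boundaries_def)
qed

end

lemma Tot_chain_map:
  fixes C :: "'c::ab_group_add cplx" and D :: "'d::ab_group_add cplx"
    and C' :: "'e::ab_group_add cplx" and D' :: "'f::ab_group_add cplx"
  assumes P: "periodic C D b e" and P': "periodic C' D' b' e'" and f: "chain_map C C' f" and g: "chain_map D D' g"
    and fb: "\<And>n y. y \<in> deg_part D n \<Longrightarrow> f (b y) - b' (g y) \<in> null_part C' n"
    and ge: "\<And>n x. x \<in> deg_part C n \<Longrightarrow> g (e x) - e' (f x) \<in> null_part D' n"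
  shows "chain_map (Tot C D b e) (Tot C' D' b' e') (\<lambda>u j. (f (fst (u j)), g (snd (u j))))"
    (is "chain_map ?T ?T' ?F")
proof -
  interpret P: periodic C D b e by (rule P)
  interpret P': periodic C' D' b' e' by (rule P')
  interpret f: chain_map_between C C' f by (simp add: chain_map_between_def f P.CC P'.CC)
  interpret g: chain_map_between D D' g by (simp add: chain_map_between_def g P.DD P'.DD)
  have 1: "f (differential C r + b \<omega>) - (differential C' (f r) + b' (g \<omega>)) \<in> null_part C' (m - 1)"
    if r: "r \<in> deg_part C m" and w: "\<omega> \<in> deg_part D (m - 1)" for r \<omega> m
  proof -
    have "differential C r \<in> deg_part C (m - 1)" "b \<omega> \<in> deg_part C (m - 1)"
      using P.dC.deg[OF r, of "m - 1"] P.b.deg[OF w, of "m - 1"] by simp_all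
    from f.add[OF this, of "m - 1"]
    have a: "f (differential C r + b \<omega>) - (f (differential C r) + f (b \<omega>)) \<in> null_part C' (m - 1)" by simp
    have c: "f (differential C r) - differential C' (f r) \<in> null_part C' (m - 1)" using f.commute[OF r, of "m - 1"] by simp
    from subgrp_add[OF P'.nC a subgrp_add[OF P'.nC c fb[OF w]]] show ?thesis by (simp add: algebra_simps)
  qed
  have 2: "g (e r - differential D \<omega>) - (e' (f r) - differential D' (g \<omega>)) \<in> null_part D' (m - 1)"
    if r: "r \<in> deg_part C (m - 1)" and w: "\<omega> \<in> deg_part D m" for r \<omega> m
  proof -
    have "e r \<in> deg_part D (m - 1)" "differential D \<omega> \<in> deg_part D (m - 1)"
      using P.e.deg[OF r, of "m - 1"] P.dD.deg[OF w, of "m - 1"] by simp_all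
    from g.diff[OF this, of "m - 1"]
    have a: "g (e r - differential D \<omega>) - (g (e r) - g (differential D \<omega>)) \<in> null_part D' (m - 1)" by simp
    have c: "g (differential D \<omega>) - differential D' (g \<omega>) \<in> null_part D' (m - 1)" using g.commute[OF w, of "m - 1"] by simp
    from subgrp_add[OF P'.nD a subgrp_diff[OF P'.nD ge[OF r] c]] show ?thesis by (simp add: algebra_simps)
  qed
  show ?thesis
    unfolding chain_map_def graded_map_def
  proof (intro conjI allI ballI)
    fix n u assume "u \<in> deg_part ?T n"
    then have u: "fst (u j) \<in> deg_part C (n - 2 * int j)" "snd (u j) \<in> deg_part D (n - 1 - 2 * int j)" for j
      unfolding P.Tot_deg by auto
    show "?F u \<in> deg_part ?T' (n + 0)"
      unfolding P'.Tot_deg using f.deg[OF u(1)] g.deg[OF u(2)] by simp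
    show "?F (differential ?T u) - differential ?T' (?F u) \<in> null_part ?T' (n - 1)"
      unfolding P'.Tot_null fun_diff_def P'.Tot_dif P.Tot_dif fst_diff snd_diff fst_conv snd_conv
    proof (intro allI conjI)
      fix j
      have eq: "n - 1 - 2 * int j = n - 2 * int j - 1" "n - 2 * int j - 1 - 1 = n - 2 * int (Suc j)" by simp_all
      show "f (differential C (fst (u j)) + b (snd (u j))) - (differential C' (f (fst (u j))) + b' (g (snd (u j))))
          \<in> null_part C' (n - 1 - 2 * int j)"
        unfolding eq(1) by (rule 1[OF u(1)]) (use u(2)[of j] in \<open>simp only: eq\<close>)
      have "fst (u (Suc j)) \<in> deg_part C (n - 2 * int j - 1 - 1)" using u(1)[of "Suc j"] by (simp only: eq)
      moreover have "snd (u j) \<in> deg_part D (n - 2 * int j - 1)" using u(2)[of j] by (simp only: eq)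
      ultimately have "g (e (fst (u (Suc j))) - differential D (snd (u j))) - (e' (f (fst (u (Suc j)))) - differential D' (g (snd (u j))))
          \<in> null_part D' (n - 2 * int j - 1 - 1)" by (rule 2)
      moreover have eq': "n - 1 - 1 - 2 * int j = n - 2 * int j - 1 - 1" by simp
      ultimately show "g (e (fst (u (Suc j))) - differential D (snd (u j))) - (e' (f (fst (u (Suc j)))) - differential D' (g (snd (u j))))
          \<in> null_part D' (n - 1 - 1 - 2 * int j)" unfolding eq' by blast
    qed
    fix v assume "v \<in> deg_part ?T n"
    then have v: "fst (v j) \<in> deg_part C (n - 2 * int j)" "snd (v j) \<in> deg_part D (n - 1 - 2 * int j)" for j
      unfolding P.Tot_deg by auto
    show "?F (u - v) - (?F u - ?F v) \<in> null_part ?T' (n + 0)"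
      unfolding P'.Tot_null fun_diff_def fst_diff snd_diff fst_conv snd_conv
      using f.diff[OF u(1) v(1)] g.diff[OF u(2) v(2)] by simp
  next
    fix n u assume "u \<in> deg_part ?T n \<inter> null_part ?T n"
    then have u: "fst (u j) \<in> deg_part C (n - 2 * int j)" "snd (u j) \<in> deg_part D (n - 1 - 2 * int j)"
        "fst (u j) \<in> null_part C (n - 2 * int j)" "snd (u j) \<in> null_part D (n - 1 - 2 * int j)" for j
      unfolding Int_iff P.Tot_deg P.Tot_null by auto
    show "?F u \<in> null_part ?T' (n + 0)"
      unfolding P'.Tot_null fst_conv snd_conv using f.null[OF u(3,1)] g.null[OF u(4,2)] by simp
  qed
qed

section \<open>Splitting a periodic bicomplex with injective horizontal maps\<close>

text \<open>
  The quotient \<open>D/e C\<close> and the complex \<open>C \<oplus> (D/e C)[1] \<oplus> (D/e C)[3] \<oplus> \<dots>\<close>. With \<open>C = R\<^sub>V/k\<close> and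
  \<open>D = \<Omega>\<^sup>1\<^sub>c\<^sub>o\<^sub>m(R\<^sub>V)\<close> the latter is \<open>Split\<close> (\<open>Split_eq\<close> below).
\<close>

definition coker_cplx :: "'c::ab_group_add cplx \<Rightarrow> 'd::ab_group_add cplx \<Rightarrow> ('c \<Rightarrow> 'd) \<Rightarrow> 'd cplx" where
  "coker_cplx C D e = \<lparr>deg_part = deg_part D,
     null_part = (\<lambda>m. {\<omega>. \<exists>\<rho> \<in> deg_part C m. \<omega> - e \<rho> \<in> null_part D m}), differential = differential D\<rparr>"

definition split_cplx :: "'c::ab_group_add cplx \<Rightarrow> 'd::ab_group_add cplx \<Rightarrow> ('c \<Rightarrow> 'd) \<Rightarrow> ('c \<times> (nat \<Rightarrow> 'd)) cplx" where
  "split_cplx C D e = \<lparr>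
     deg_part = (\<lambda>n. deg_part C n \<times> {\<omega>. \<forall>j. \<omega> j \<in> deg_part D (n - 1 - 2 * int j)}),
     null_part = (\<lambda>n. null_part C n \<times> {\<omega>. \<forall>j. \<omega> j \<in> null_part (coker_cplx C D e) (n - 1 - 2 * int j)}),
     differential = (\<lambda>(r, \<omega>). (differential C r, \<lambda>j. - differential D (\<omega> j)))\<rparr>"

lemma to_split_diff: "to_split (u - v) = to_split u - to_split v"
  by (simp add: to_split_def fun_diff_def minus_prod_def)

locale split_periodic = periodic C D "\<lambda>_. 0" e
  for C :: "'c::ab_group_add cplx" and D :: "'d::ab_group_add cplx" and e +
  assumes e_inj: "\<And>m x. \<lbrakk>x \<in> PC m; e x \<in> ND m\<rbrakk> \<Longrightarrow> x \<in> NC m"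
begin

abbreviation Q where "Q \<equiv> coker_cplx C D e"
abbreviation S where "S \<equiv> split_cplx C D e"

lemma Q_simps: "deg_part Q = PD" "differential Q = dD"
  by (simp_all add: coker_cplx_def)

lemma Q_null: "\<omega> \<in> null_part Q m \<longleftrightarrow> (\<exists>\<rho> \<in> PC m. \<omega> - e \<rho> \<in> ND m)"
  by (simp add: coker_cplx_def)

lemma Q_null_D: "\<omega> \<in> ND m \<Longrightarrow> \<omega> \<in> null_part Q m"
  using subgrp_diff[OF nD _ e.zero, of \<omega> m] subgrp_zero[OF gC] by (auto simp: Q_null)

lemma chain_complex_Q: "chain_complex Q"
  unfolding chain_complex_def Q_simps
proof (intro conjI allI ballI)
  fix n
  show "subgrp (PD n)" by (rule gD)
  show "subgrp (null_part Q n)"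
    unfolding subgrp_def
  proof (intro conjI ballI)
    show "0 \<in> null_part Q n" using Q_null_D subgrp_zero[OF nD] by blast
    fix x y assume "x \<in> null_part Q n" "y \<in> null_part Q n"
    then obtain \<rho> \<sigma> where h: "\<rho> \<in> PC n" "\<sigma> \<in> PC n"
      "x - e \<rho> \<in> ND n" "y - e \<sigma> \<in> ND n" by (auto simp: Q_null)
    have "e (\<rho> - \<sigma>) - (e \<rho> - e \<sigma>) \<in> ND n" using e.diff[OF h(1,2), of n] by simp
    from subgrp_diff[OF nD subgrp_diff[OF nD h(3,4)] this] have "x - y - e (\<rho> - \<sigma>) \<in> ND n"
      by (simp add: algebra_simps)
    then show "x - y \<in> null_part Q n" using subgrp_diff[OF gC h(1,2)] by (auto simp: Q_null)
  qed
  fix x assume "x \<in> PD n"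
  then show "dD (dD x) \<in> null_part Q (n - 2)"
    using ddD[of x n "n - 2"] by (simp add: Q_null_D)
next
  show "graded_map Q Q (- 1) (dD)"
    unfolding graded_map_def Q_simps
  proof (intro allI conjI ballI)
    fix n x assume x: "x \<in> PD n"
    show "dD x \<in> PD (n + - 1)" using dD.deg[OF x, of "n - 1"] by simp
    fix y assume y: "y \<in> PD n"
    show "dD (x - y) - (dD x - dD y) \<in> null_part Q (n + - 1)"
      using dD.diff[OF x y, of "n - 1"] by (simp add: Q_null_D)
  next
    fix n x assume "x \<in> PD n \<inter> null_part Q n"
    then obtain \<rho> where h: "x \<in> PD n" "\<rho> \<in> PC n" "x - e \<rho> \<in> ND n"
      by (auto simp: Q_null)
    have 1: "e \<rho> \<in> PD n" "dC \<rho> \<in> PC (n - 1)"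
      using e.deg[OF h(2), of n] dC.deg[OF h(2), of "n - 1"] by simp_all
    from subgrp_diff[OF nD dD.cong[OF h(3,1) 1(1), of "n - 1"] e.commute[OF h(2), of "n - 1"]]
    have "dD x - e (dC \<rho>) \<in> ND (n - 1)" by (simp add: algebra_simps)
    then show "dD x \<in> null_part Q (n + - 1)" using 1(2) by (auto simp: Q_null)
  qed
qed

sublocale dQ: graded_map_between Q Q "- 1" "dD"
  using chain_complex_differential[OF chain_complex_Q] by (simp add: Q_simps)

lemmas nQ = chain_complexD(2)[OF chain_complex_Q]

lemma S_deg: "(r, \<omega>) \<in> deg_part S n \<longleftrightarrow> r \<in> PC n \<and> (\<forall>j. \<omega> j \<in> PD (n - 1 - 2 * int j))"
  and S_null: "(r, \<omega>) \<in> null_part S n \<longleftrightarrow> r \<in> NC n \<and> (\<forall>j. \<omega> j \<in> null_part Q (n - 1 - 2 * int j))"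
  and S_dif: "differential S (r, \<omega>) = (dC r, \<lambda>j. - dD (\<omega> j))"
  by (auto simp: split_cplx_def)

lemma chain_complex_S: "chain_complex S"
  unfolding chain_complex_def
proof (intro conjI allI ballI)
  fix n
  show "subgrp (deg_part S n)"
    unfolding subgrp_def using gC gD
    by (auto simp: S_deg zero_prod_def subgrp_zero subgrp_diff)
  show "subgrp (null_part S n)"
    unfolding subgrp_def using nC nQ
    by (auto simp: S_null zero_prod_def subgrp_zero subgrp_diff)
  fix x assume "x \<in> deg_part S n"
  then obtain r \<omega> where x: "x = (r, \<omega>)" and r: "r \<in> PC n" and w: "\<And>j. \<omega> j \<in> PD (n - 1 - 2 * int j)"
    by (cases x) (auto simp: S_deg)
  have "- dD (- dD (\<omega> j)) \<in> null_part Q (n - 2 - 1 - 2 * int j)" for j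
  proof -
    have 1: "dD (\<omega> j) \<in> PD (n - 2 - 2 * int j)"
      using dD.deg[OF w[of j], of "n - 2 - 2 * int j"] by simp
    have 2: "dD (dD (\<omega> j)) \<in> ND (n - 3 - 2 * int j)"
      using ddD[OF w[of j], of "n - 3 - 2 * int j"] by simp
    have 3: "dD (- dD (\<omega> j)) + dD (dD (\<omega> j)) \<in> ND (n - 3 - 2 * int j)"
      using dD.uminus[OF 1, of "n - 3 - 2 * int j"] by simp
    from subgrp_diff[OF nD 2 3] have "- dD (- dD (\<omega> j)) \<in> ND (n - 3 - 2 * int j)"
      by simp
    then show ?thesis by (simp add: Q_null_D)
  qed
  then show "differential S (differential S x) \<in> null_part S (n - 2)"
    using ddC[OF r, of "n - 2"] by (simp add: x S_dif S_null)
next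
  show "graded_map S S (- 1) (differential S)"
    unfolding graded_map_def
  proof (intro allI conjI ballI)
    fix n x assume "x \<in> deg_part S n"
    then obtain r \<omega> where x: "x = (r, \<omega>)" and r: "r \<in> PC n" and w: "\<And>j. \<omega> j \<in> PD (n - 1 - 2 * int j)"
      by (cases x) (auto simp: S_deg)
    have dw: "dD (\<omega> j) \<in> PD (n - 2 - 2 * int j)" for j
      using dD.deg[OF w[of j], of "n - 2 - 2 * int j"] by simp
    show "differential S x \<in> deg_part S (n + - 1)"
      using subgrp_uminus[OF gD dw] dC.deg[OF r, of "n - 1"] by (simp add: x S_dif S_deg algebra_simps)
    fix y assume "y \<in> deg_part S n"
    then obtain s \<theta> where y: "y = (s, \<theta>)" and s: "s \<in> PC n" and t: "\<And>j. \<theta> j \<in> PD (n - 1 - 2 * int j)"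
      by (cases y) (auto simp: S_deg)
    have "- dD (\<omega> j - \<theta> j) - (- dD (\<omega> j) - - dD (\<theta> j)) \<in> null_part Q (n - 2 - 2 * int j)" for j
      using Q_null_D[OF subgrp_uminus[OF nD dD.diff[OF w[of j] t[of j], of "n - 2 - 2 * int j"]]] by (simp add: algebra_simps)
    then show "differential S (x - y) - (differential S x - differential S y) \<in> null_part S (n + - 1)"
      using dC.diff[OF r s, of "n - 1"] by (simp add: x y S_dif S_null algebra_simps)
  next
    fix n x assume "x \<in> deg_part S n \<inter> null_part S n"
    then obtain r \<omega> where x: "x = (r, \<omega>)" and r: "r \<in> PC n" "r \<in> NC n"
      and w: "\<And>j. \<omega> j \<in> PD (n - 1 - 2 * int j)" "\<And>j. \<omega> j \<in> null_part Q (n - 1 - 2 * int j)"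
      by (cases x) (auto simp: S_deg S_null)
    have "dD (\<omega> j) \<in> null_part Q (n - 2 - 2 * int j)" for j
      using dQ.null[OF w(2)[of j], of "n - 2 - 2 * int j"] w(1) by (simp add: Q_simps)
    from subgrp_uminus[OF nQ this] show "differential S x \<in> null_part S (n + - 1)"
      using dC.null[OF r(2,1), of "n - 1"] by (simp add: x S_dif S_null algebra_simps)
  qed
qed

lemma to_split_chain_map: "chain_map T S to_split"
  unfolding chain_map_def graded_map_def
proof (intro conjI allI ballI)
  fix n u assume "u \<in> deg_part T n"
  then have u: "fst (u j) \<in> PC (n - 2 * int j)" "snd (u j) \<in> PD (n - 1 - 2 * int j)" for j
    unfolding Tot_deg by auto
  have u': "fst (u (Suc j)) \<in> PC (n - 2 - 2 * int j)" for j
    using u(1)[of "Suc j"] by (simp add: algebra_simps)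
  show "to_split u \<in> deg_part S (n + 0)"
    using u u(1)[of 0] by (simp add: to_split_def S_deg)
  show "to_split (u - v) - (to_split u - to_split v) \<in> null_part S (n + 0)" for v
    using subgrp_zero[OF chain_complexD(2)[OF chain_complex_S]] by (simp add: to_split_diff)
  have "e (fst (u (Suc j))) \<in> null_part Q (n - 2 - 2 * int j)" for j
    using u'[of j] subgrp_zero[OF nD] by (auto simp: Q_null intro!: bexI[of _ "fst (u (Suc j))"])
  then show "to_split (differential T u) - differential S (to_split u) \<in> null_part S (n - 1)"
    using subgrp_zero[OF nC] by (simp add: to_split_def S_dif S_null Tot_dif algebra_simps)
next
  fix n u assume "u \<in> deg_part T n \<inter> null_part T n"
  then have u: "fst (u j) \<in> NC (n - 2 * int j)" "snd (u j) \<in> ND (n - 1 - 2 * int j)" for j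
    unfolding Int_iff Tot_null by auto
  show "to_split u \<in> null_part S (n + 0)"
    using u u(1)[of 0] by (simp add: to_split_def S_null Q_null_D)
qed

sublocale to_split: chain_map_between T S to_split
  using to_split_chain_map chain_complex_Tot chain_complex_S by (simp add: chain_map_between_def)

lemma T_cycle_snd:
  assumes "u \<in> cycles T n"
  shows "fst (u j) \<in> PC (n - 2 * int j)" "snd (u j) \<in> PD (n - 2 * int j - 1)"
    "e (fst (u (Suc j))) - dD (snd (u j)) \<in> ND (n - 2 * int j - 2)"
    "dC (fst (u j)) \<in> NC (n - 2 * int j - 1)"
  using assms unfolding cycles_def mem_Collect_eq Tot_deg Tot_null Tot_dif by (simp_all add: algebra_simps)

lemma T_cycleI:
  assumes "\<And>j. fst (u j) \<in> PC (n - 2 * int j)" "\<And>j. snd (u j) \<in> PD (n - 2 * int j - 1)"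
    "\<And>j. e (fst (u (Suc j))) - dD (snd (u j)) \<in> ND (n - 2 * int j - 2)"
    "\<And>j. dC (fst (u j)) \<in> NC (n - 2 * int j - 1)"
  shows "u \<in> cycles T n"
  using assms unfolding cycles_def mem_Collect_eq Tot_deg Tot_null Tot_dif by (simp add: algebra_simps)

lemma S_boundaryE:
  assumes "(r, \<omega>) \<in> boundaries S n"
  obtains w \<eta> \<rho> where "w \<in> PC (n + 1)" "\<And>j. \<eta> j \<in> PD (n - 2 * int j)"
    "r - dC w \<in> NC n" "\<And>j. \<rho> j \<in> PC (n - 2 * int j - 1)"
    "\<And>j. \<omega> j + dD (\<eta> j) - e (\<rho> j) \<in> ND (n - 2 * int j - 1)"
proof -
  obtain x where "x \<in> deg_part S (n + 1)" "(r, \<omega>) - differential S x \<in> null_part S n"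
    using assms unfolding boundaries_def mem_Collect_eq by blast
  moreover obtain w \<eta> where "x = (w, \<eta>)" by (cases x)
  ultimately have h: "(w, \<eta>) \<in> deg_part S (n + 1)" "(r, \<omega>) - differential S (w, \<eta>) \<in> null_part S n"
    by simp_all
  have "\<exists>\<rho> \<in> PC (n - 2 * int j - 1). \<omega> j + dD (\<eta> j) - e \<rho> \<in> ND (n - 2 * int j - 1)" for j
    using h(2) by (simp add: S_null S_dif Q_null algebra_simps)
  then obtain \<rho> where "\<And>j. \<rho> j \<in> PC (n - 2 * int j - 1)"
    "\<And>j. \<omega> j + dD (\<eta> j) - e (\<rho> j) \<in> ND (n - 2 * int j - 1)" by metis
  with h show thesis using that[of w \<eta> \<rho>] by (simp add: S_null S_dif S_deg)
qed

text \<open>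
  A bounding chain in the split complex leaves the entries of the cycle in the later columns of \<open>C\<close>
  unaccounted for. Their discrepancy is killed by \<open>e\<close>, by \<open>transfer_discrepancy\<close>, hence null.
\<close>

lemma boundary_of_split_boundary:
  assumes u: "u \<in> cycles T n" and su: "to_split u \<in> boundaries S n"
  shows "u \<in> boundaries T n"
proof -
  note uc = T_cycle_snd[OF u]
  obtain w \<eta> \<rho> where h: "w \<in> PC (n + 1)" "\<And>j. \<eta> j \<in> PD (n - 2 * int j)"
    "fst (u 0) - dC w \<in> NC n" "\<And>j. \<rho> j \<in> PC (n - 2 * int j - 1)"
    "\<And>j. snd (u j) + dD (\<eta> j) - e (\<rho> j) \<in> ND (n - 2 * int j - 1)"
    by (rule S_boundaryE[OF su[unfolded to_split_def]]) blast
  define v where "v j = (case j of 0 \<Rightarrow> w | Suc i \<Rightarrow> \<rho> i, \<eta> j)" for j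
  have v_Suc: "v (Suc j) = (\<rho> j, \<eta> (Suc j))" and v0: "v 0 = (w, \<eta> 0)" for j by (simp_all add: v_def)
  have A: "v \<in> deg_part T (n + 1)"
    unfolding Tot_deg
  proof (intro allI conjI)
    fix j
    show "fst (v j) \<in> PC (n + 1 - 2 * int j)"
      using h(1) h(4)[of "j - 1"] by (cases j) (simp_all add: v_Suc v0 algebra_simps)
    show "snd (v j) \<in> PD (n + 1 - 1 - 2 * int j)" using h(2) by (simp add: v_def)
  qed
  have B: "u - differential T v \<in> null_part T n"
    unfolding Tot_null fun_diff_def Tot_dif fst_diff snd_diff fst_conv snd_conv
  proof (intro allI conjI)
    fix j
    show "snd (u j) - (e (fst (v (Suc j))) - dD (snd (v j))) \<in> ND (n - 1 - 2 * int j)"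
      using h(5)[of j] by (simp add: v_def algebra_simps)
    show "fst (u j) - (dC (fst (v j)) + 0) \<in> NC (n - 2 * int j)"
    proof (cases j)
      case 0 then show ?thesis using h(3) by (simp add: v0)
    next
      case (Suc i)
      have 1: "fst (u (Suc i)) \<in> PC (n - 2 * int i - 2)" using uc(1)[of "Suc i"] by (simp add: algebra_simps)
      have 2: "dC (\<rho> i) \<in> PC (n - 2 * int i - 2)"
        using dC.deg[OF h(4)[of i], of "n - 2 * int i - 2"] by simp
      from transfer_discrepancy[OF 1 uc(2) h(2,4) uc(3) h(5)]
      have "fst (u (Suc i)) - dC (\<rho> i) \<in> NC (n - 2 * int i - 2)"
        by (rule e_inj[OF subgrp_diff[OF gC 1 2]])
      then show ?thesis by (simp add: Suc v_Suc algebra_simps)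
    qed
  qed
  have E: "u \<in> deg_part T n" using u by (simp add: cycles_def)
  show ?thesis by (rule boundariesI[OF A B E])
qed

text \<open>
  In a cycle of the split complex, \<open>d (\<omega> j)\<close> lies in the image of \<open>e\<close>. A preimage is the missing entry of
  the lift; it is a cycle because \<open>e\<close> is injective.
\<close>

lemma split_cycle_lift:
  assumes "(r, \<omega>) \<in> cycles S n"
  obtains u where "u \<in> cycles T n" "to_split u = (r, \<omega>)"
proof -
  have eq: "n - 1 - 2 * int j = n - 2 * int j - 1" "n - 1 - 1 - 2 * int j = n - 2 * int j - 2" for j by simp_all
  have r: "r \<in> PC n" "dC r \<in> NC (n - 1)"
    and w: "\<And>j. \<omega> j \<in> PD (n - 2 * int j - 1)"
    and dw: "\<And>j. - dD (\<omega> j) \<in> null_part Q (n - 2 * int j - 2)"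
    using assms unfolding cycles_def mem_Collect_eq S_deg S_null S_dif eq by blast+
  have "\<exists>\<rho> \<in> PC (n - 2 * int j - 2). dD (\<omega> j) - e \<rho> \<in> ND (n - 2 * int j - 2)" for j
    using subgrp_uminus[OF nQ dw[of j]] by (simp add: Q_null)
  then obtain \<rho> where \<rho>: "\<And>j. \<rho> j \<in> PC (n - 2 * int j - 2)"
    "\<And>j. dD (\<omega> j) - e (\<rho> j) \<in> ND (n - 2 * int j - 2)" by metis
  define u where "u j = (case j of 0 \<Rightarrow> r | Suc i \<Rightarrow> \<rho> i, \<omega> j)" for j
  have u_Suc: "u (Suc j) = (\<rho> j, \<omega> (Suc j))" and u0: "u 0 = (r, \<omega> 0)" for j by (simp_all add: u_def)
  have "u \<in> cycles T n"
  proof (rule T_cycleI)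
    fix j
    show "fst (u j) \<in> PC (n - 2 * int j)"
      using r(1) \<rho>(1)[of "j - 1"] by (cases j) (simp_all add: u_Suc u0 algebra_simps)
    show "snd (u j) \<in> PD (n - 2 * int j - 1)" using w by (simp add: u_def)
    show "e (fst (u (Suc j))) - dD (snd (u j)) \<in> ND (n - 2 * int j - 2)"
      using subgrp_swap[OF nD \<rho>(2)] by (simp add: u_def)
    show "dC (fst (u j)) \<in> NC (n - 2 * int j - 1)"
    proof (cases j)
      case 0 then show ?thesis using r by (simp add: u0)
    next
      case (Suc i)
      let ?m = "n - 2 * int i - 2"
      have 1: "e (\<rho> i) \<in> PD ?m" "dC (\<rho> i) \<in> PC (?m - 1)"
        "dD (\<omega> i) \<in> PD ?m"
        using e.deg[OF \<rho>(1)[of i], of ?m] dC.deg[OF \<rho>(1)[of i], of "?m - 1"] dD.deg[OF w[of i], of ?m] by simp_all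
      have 2: "dD (dD (\<omega> i)) \<in> ND (?m - 1)"
        using ddD[OF w[of i], of "?m - 1"] by simp
      from subgrp_add[OF nD e.commute[OF \<rho>(1)[of i], of "?m - 1"]
          subgrp_diff[OF nD 2 dD.cong[OF \<rho>(2)[of i] 1(3,1), of "?m - 1"]]]
      have "e (dC (\<rho> i)) \<in> ND (?m - 1)" by simp
      from e_inj[OF 1(2) this] show ?thesis by (simp add: Suc u_Suc algebra_simps)
    qed
  qed
  moreover have "to_split u = (r, \<omega>)" by (simp add: to_split_def u_def)
  ultimately show thesis using that by blast
qed

lemma split_iso_bij: "bij_betw (induced_map S n to_split) (homology T n) (homology S n)"
  unfolding bij_betw_def
proof
  show "inj_on (induced_map S n to_split) (homology T n)"
  proof (rule inj_onI)
    fix c c' assume "c \<in> homology T n" "c' \<in> homology T n"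
      and eq: "induced_map S n to_split c = induced_map S n to_split c'"
    then obtain u v where u: "u \<in> cycles T n" "c = u +o boundaries T n"
      and v: "v \<in> cycles T n" "c' = v +o boundaries T n" by (auto simp: homology_def)
    have "to_split u \<in> to_split u +o boundaries S n"
      using subgrp_zero[OF boundaries_subgrp[OF chain_complex_S]] by (simp add: in_coset_iff)
    then have "to_split u \<in> to_split v +o boundaries S n"
      using eq by (simp add: u v to_split.induced_map_class)
    then have "to_split (u - v) \<in> boundaries S n" by (simp add: in_coset_iff to_split_diff)
    then have "u - v \<in> boundaries T n"
      by (rule boundary_of_split_boundary[OF subgrp_diff[OF cycles_subgrp[OF chain_complex_Tot] u(1) v(1)]])
    then show "c = c'" unfolding u v by (rule homology_class_eq[OF chain_complex_Tot])
  qed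
  show "induced_map S n to_split ` homology T n = homology S n"
  proof
    show "induced_map S n to_split ` homology T n \<subseteq> homology S n"
      using to_split.induced_map_homology by blast
    show "homology S n \<subseteq> induced_map S n to_split ` homology T n"
    proof
      fix c assume "c \<in> homology S n"
      then obtain x where x: "x \<in> cycles S n" "c = x +o boundaries S n" by (auto simp: homology_def)
      then obtain u where u: "u \<in> cycles T n" "to_split u = x"
        using split_cycle_lift[of "fst x" "snd x" n] by auto
      then have "c = induced_map S n to_split (u +o boundaries T n)"
        by (simp add: x to_split.induced_map_class)
      then show "c \<in> induced_map S n to_split ` homology T n" using u(1) by (auto simp: homology_def)
    qed
  qed
qed

lemma split_iso_inv:
  assumes "u \<in> cycles T n"
  shows "inv_into (homology T n) (induced_map S n to_split) (to_split u +o boundaries S n) = u +o boundaries T n"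
proof -
  have "u +o boundaries T n \<in> homology T n" using assms by (auto simp: homology_def)
  from inv_into_f_f[OF bij_betw_imp_inj_on[OF split_iso_bij] this]
  show ?thesis unfolding to_split.induced_map_class[OF assms] .
qed

lemma shift2_cycles:
  assumes "u \<in> cycles T n" shows "shift2 u \<in> cycles T (n - 2)"
proof -
  note uc = T_cycle_snd[OF assms]
  show ?thesis
  proof (rule T_cycleI)
    fix j
    have eq: "n - 2 - 2 * int j = n - 2 * int (Suc j)" by simp
    show "fst (shift2 u j) \<in> PC (n - 2 - 2 * int j)" "snd (shift2 u j) \<in> PD (n - 2 - 2 * int j - 1)"
      "e (fst (shift2 u (Suc j))) - dD (snd (shift2 u j)) \<in> ND (n - 2 - 2 * int j - 2)"
      "dC (fst (shift2 u j)) \<in> NC (n - 2 - 2 * int j - 1)"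
      unfolding shift2_def eq by (rule uc)+
  qed
qed

text \<open>
  The map \<open>S\<^sub>V\<close>, which is given on representatives in the split complex, corresponds to \<open>shift2\<close>. That
  another representative gives a homologous value is again \<open>transfer_discrepancy\<close>.
\<close>

lemma split_periodicity:
  assumes v: "v \<in> cycles T n"
  shows "induced S (n - 2)
      (\<lambda>(r, \<omega>) (r', \<omega>'). r' \<in> PC (n - 2) \<and> e r' - dD (\<omega> 0) \<in> ND (n - 2) \<and>
         (\<forall>j. \<omega>' j = \<omega> (Suc j))) (to_split v +o boundaries S n) = to_split (shift2 v) +o boundaries S (n - 2)"
    (is "induced S _ ?\<rho> _ = _")
proof (rule induced_class[OF chain_complex_S chain_complex_S])
  note vc = T_cycle_snd[OF v]
  have v1: "fst (v 1) \<in> PC (n - 2)" "e (fst (v 1)) - dD (snd (v 0)) \<in> ND (n - 2)"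
    using vc(1)[of 1] vc(3)[of 0] by simp_all
  then show "?\<rho> (to_split v) (to_split (shift2 v))" by (simp add: to_split_def shift2_def)
  fix x y assume x: "x - to_split v \<in> boundaries S n" and xy: "?\<rho> x y"
  obtain r \<omega> r' \<omega>' where [simp]: "x = (r, \<omega>)" "y = (r', \<omega>')" by (cases x, cases y) auto
  have r': "r' \<in> PC (n - 2)" "e r' - dD (\<omega> 0) \<in> ND (n - 2)" "\<And>j. \<omega>' j = \<omega> (Suc j)"
    using xy by auto
  have "(r - fst (v 0), \<lambda>j. \<omega> j - snd (v j)) \<in> boundaries S n"
    using x by (simp add: to_split_def fun_diff_def)
  then obtain w \<eta> \<rho> where h: "w \<in> PC (n + 1)" "\<And>j. \<eta> j \<in> PD (n - 2 * int j)"
    "r - fst (v 0) - dC w \<in> NC n" "\<And>j. \<rho> j \<in> PC (n - 2 * int j - 1)"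
    "\<And>j. \<omega> j - snd (v j) + dD (\<eta> j) - e (\<rho> j) \<in> ND (n - 2 * int j - 1)"
    by (rule S_boundaryE) blast
  have x_deg: "(r - fst (v 0), \<lambda>j. \<omega> j - snd (v j)) \<in> deg_part S n"
    using \<open>(_, \<lambda>j. \<omega> j - snd (v j)) \<in> boundaries S n\<close> by (simp add: boundaries_def)
  have w_deg: "\<omega> j - snd (v j) \<in> PD (n - 2 * int j - 1)" for j
    using x_deg by (simp add: S_deg algebra_simps)
  have w: "\<omega> j \<in> PD (n - 2 * int j - 1)" for j
    using subgrp_add[OF gD w_deg vc(2)] by simp
  have d: "r' - fst (v 1) \<in> PC (n - 2)" by (rule subgrp_diff[OF gC r'(1) v1(1)])
  have 1: "e (r' - fst (v 1)) - (e r' - e (fst (v 1))) \<in> ND (n - 2)"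
    using e.diff[OF r'(1) v1(1), of "n - 2"] by simp
  have 2: "dD (\<omega> 0 - snd (v 0)) - (dD (\<omega> 0) - dD (snd (v 0))) \<in> ND (n - 2)"
    using dD.diff[OF w[of 0] vc(2)[of 0], of "n - 2"] by simp
  from subgrp_diff[OF nD subgrp_add[OF nD 1 subgrp_diff[OF nD r'(2) v1(2)]] 2]
  have 3: "e (r' - fst (v 1)) - dD (\<omega> 0 - snd (v 0)) \<in> ND (n - 2)"
    by (simp add: algebra_simps)
  have d\<rho>: "dC (\<rho> 0) \<in> PC (n - 2)" using dC.deg[OF h(4)[of 0], of "n - 2"] by simp
  have "r' - fst (v 1) - dC (\<rho> 0) \<in> NC (n - 2)"
    using transfer_discrepancy[of "r' - fst (v 1)" n "\<omega> 0 - snd (v 0)" "\<eta> 0" "\<rho> 0"] d w_deg[of 0] h(2)[of 0] h(4)[of 0] 3 h(5)[of 0]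
    by (intro e_inj[OF subgrp_diff[OF gC d d\<rho>]]) simp
  moreover have "\<omega> (Suc j) - snd (v (Suc j)) + dD (\<eta> (Suc j)) \<in> null_part Q (n - 2 - 1 - 2 * int j)" for j
  proof -
    have eq: "n - 2 * int (Suc j) - 1 = n - 2 - 1 - 2 * int j" by simp
    show ?thesis unfolding Q_null using h(4,5)[of "Suc j"] unfolding eq by blast
  qed
  ultimately have B: "y - to_split (shift2 v) - differential S (\<rho> 0, \<lambda>j. \<eta> (Suc j)) \<in> null_part S (n - 2)"
    by (simp add: to_split_def shift2_def S_dif S_null r'(3))
  have A: "(\<rho> 0, \<lambda>j. \<eta> (Suc j)) \<in> deg_part S (n - 2 + 1)"
    using h(2)[of "Suc _"] h(4)[of 0] by (simp add: S_deg algebra_simps)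
  have "y - to_split (shift2 v) \<in> deg_part S (n - 2)"
    using d w_deg[of "Suc _"] by (simp add: to_split_def shift2_def S_deg r'(3) algebra_simps)
  with A B show "y - to_split (shift2 v) \<in> boundaries S (n - 2)"
    by (rule boundariesI)
qed

end

section \<open>The periodicity sequence of an exact periodic bicomplex\<close>

text \<open>
  Here the rows are exact, and \<open>Q\<close> is the cokernel of \<open>b\<close>; its null part is described as the kernel of
  \<open>e\<close>, which by exactness is the image of \<open>b\<close>.
\<close>

locale exact_periodic = periodic +
  fixes Q
  assumes chain_complex_Q: "chain_complex Q"
    and Q_deg: "deg_part Q = PC" and Q_dif: "differential Q = dC"
    and Q_null: "\<And>m x. x \<in> PC m \<Longrightarrow> x \<in> null_part Q m \<longleftrightarrow> e x \<in> ND m"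
    and exact_C: "\<And>m x. \<lbrakk>x \<in> PC m; e x \<in> ND m\<rbrakk> \<Longrightarrow> \<exists>y \<in> PD m. x - b y \<in> NC m"
    and exact_D: "\<And>m y. \<lbrakk>y \<in> PD m; b y \<in> NC m\<rbrakk> \<Longrightarrow> \<exists>x \<in> PC m. y - e x \<in> ND m"
begin

lemmas nQ = chain_complexD(2)[OF chain_complex_Q]

abbreviation lifts :: "int \<Rightarrow> 'a \<Rightarrow> (nat \<Rightarrow> 'a \<times> 'b) \<Rightarrow> bool" where
  "lifts n r u \<equiv> u \<in> cycles T n \<and> fst (u 0) - r \<in> null_part Q n"

lemma lift_exists:
  assumes "r \<in> cycles Q n" obtains u where "lifts n r u"
proof -
  have r: "r \<in> PC n" "dC r \<in> null_part Q (n - 1)"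
    using assms by (auto simp: cycles_def Q_deg Q_dif)
  have "dC r \<in> PC (n - 1)" using dC.deg[OF r(1), of "n - 1"] by simp
  then have "e (dC r) \<in> ND (n - 1)" using r(2) Q_null by blast
  then obtain u where "u \<in> cycles T n" "fst (u 0) = r"
    by (rule cycle_lifting[OF r(1) _ exact_C exact_D])
  then show thesis using that[of u] subgrp_zero[OF nQ, of n] by simp
qed

lemma T_cycleD:
  assumes "u \<in> cycles T n"
  shows "fst (u j) \<in> PC (n - 2 * int j)" "snd (u j) \<in> PD (n - 2 * int j - 1)"
    "e (fst (u (Suc j))) - dD (snd (u j)) \<in> ND (n - 2 * int j - 2)"
    "dC (fst (u j)) + b (snd (u j)) \<in> NC (n - 2 * int j - 1)"
  using assms unfolding cycles_def mem_Collect_eq Tot_deg Tot_null Tot_dif by (simp_all add: algebra_simps)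

lemma lift_unique:
  assumes u: "lifts n r u" and u': "lifts n r' u'" and r: "r - r' \<in> boundaries Q n"
  shows "u - u' \<in> boundaries T n"
proof -
  obtain w where w: "w \<in> PC (n + 1)" "r - r' - dC w \<in> null_part Q n"
    using r by (auto simp: boundaries_def Q_deg Q_dif)
  have c: "u - u' \<in> cycles T n" using u u' by (simp add: subgrp_diff[OF cycles_subgrp[OF chain_complex_Tot]])
  have "dC w \<in> PC n" using dC.deg[OF w(1), of n] by simp
  moreover have "fst ((u - u') 0) \<in> PC n" using T_cycleD(1)[OF c, of 0] by simp
  ultimately have 1: "fst ((u - u') 0) - dC w \<in> PC n" by (rule subgrp_diff[OF gC, rotated])
  from subgrp_add[OF nQ w(2) subgrp_diff[OF nQ conjunct2[OF u] conjunct2[OF u']]]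
  have "fst ((u - u') 0) - dC w \<in> null_part Q n" by (simp add: algebra_simps)
  then have "e (fst ((u - u') 0) - dC w) \<in> ND n" using Q_null[OF 1] by simp
  then show ?thesis by (rule cycle_is_boundary[OF c w(1) _ exact_C exact_D])
qed

lemma shift2_cycles:
  assumes "u \<in> cycles T n" shows "shift2 u \<in> cycles T (n - 2)"
  unfolding cycles_def mem_Collect_eq Tot_deg Tot_null Tot_dif
proof (intro conjI allI)
  fix j
  note uc = T_cycleD[OF assms]
  have eq: "n - 2 - 2 * int j = n - 2 * int (Suc j)" "n - 2 - 1 - 2 * int j = n - 2 * int (Suc j) - 1"
    "n - 2 - 1 - 1 - 2 * int j = n - 2 * int (Suc j) - 2" by simp_all
  show "fst (shift2 u j) \<in> PC (n - 2 - 2 * int j)" "snd (shift2 u j) \<in> PD (n - 2 - 1 - 2 * int j)"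
    "fst (dC (fst (shift2 u j)) + b (snd (shift2 u j)),
        e (fst (shift2 u (Suc j))) - dD (snd (shift2 u j))) \<in> NC (n - 2 - 1 - 2 * int j)"
    "snd (dC (fst (shift2 u j)) + b (snd (shift2 u j)),
        e (fst (shift2 u (Suc j))) - dD (snd (shift2 u j))) \<in> ND (n - 2 - 1 - 1 - 2 * int j)"
    unfolding shift2_def eq fst_conv snd_conv by (rule uc)+
qed

lemma shift2_boundaries:
  assumes "u \<in> boundaries T n" shows "shift2 u \<in> boundaries T (n - 2)"
proof -
  obtain v where u: "u \<in> deg_part T n" and v: "v \<in> deg_part T (n + 1)" "u - differential T v \<in> null_part T n"
    using assms by (auto simp: boundaries_def)
  have v': "fst (v j) \<in> PC (n + 1 - 2 * int j)" "snd (v j) \<in> PD (n + 1 - 1 - 2 * int j)" for j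
    using v(1) unfolding Tot_deg by auto
  have u': "fst (u j) \<in> PC (n - 2 * int j)" "snd (u j) \<in> PD (n - 1 - 2 * int j)" for j
    using u unfolding Tot_deg by auto
  have uv: "fst (u j) - (dC (fst (v j)) + b (snd (v j))) \<in> NC (n - 2 * int j)"
    "snd (u j) - (e (fst (v (Suc j))) - dD (snd (v j))) \<in> ND (n - 1 - 2 * int j)" for j
    using v(2) unfolding Tot_null fun_diff_def Tot_dif by simp_all
  have A: "shift2 v \<in> deg_part T (n - 2 + 1)" "shift2 u \<in> deg_part T (n - 2)"
    unfolding Tot_deg using v'[of "Suc _"] u'[of "Suc _"] by (simp_all add: shift2_def algebra_simps)
  have "shift2 u - differential T (shift2 v) \<in> null_part T (n - 2)"
    unfolding Tot_null fun_diff_def Tot_dif using uv[of "Suc _"] by (simp add: shift2_def algebra_simps)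
  from A(1) this A(2) show ?thesis by (rule boundariesI)
qed

lemma fst_null_Q: "\<lbrakk>x \<in> PC m; x \<in> NC m\<rbrakk> \<Longrightarrow> x \<in> null_part Q m"
  using Q_null e.null[of x m m] by simp

lemma b_null_Q: "y \<in> PD m \<Longrightarrow> b y \<in> null_part Q m"
  using Q_null[of "b y" m] b.deg[of y m m] eb by simp

lemma fst_cycle:
  assumes u: "u \<in> cycles T n" shows "fst (u 0) \<in> cycles Q n"
proof -
  note uc = T_cycleD[OF u, of 0, simplified]
  have 1: "dC (fst (u 0)) + b (snd (u 0)) \<in> PC (n - 1)"
    using subgrp_add[OF gC dC.deg[OF uc(1), of "n - 1"] b.deg[OF uc(2), of "n - 1"]] by simp
  from subgrp_diff[OF nQ fst_null_Q[OF 1 uc(4)] b_null_Q[OF uc(2)]]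
  show ?thesis using uc(1) by (simp add: cycles_def Q_deg Q_dif)
qed

lemma fst_boundary:
  assumes u: "u \<in> boundaries T n" shows "fst (u 0) \<in> boundaries Q n"
proof -
  obtain v where u: "u \<in> deg_part T n" and v: "v \<in> deg_part T (n + 1)" "u - differential T v \<in> null_part T n"
    using assms by (auto simp: boundaries_def)
  have v': "fst (v 0) \<in> PC (n + 1)" "snd (v 0) \<in> PD n"
    using v(1) unfolding Tot_deg by (auto dest: spec[of _ 0])
  have u': "fst (u 0) \<in> PC n"
    using u unfolding Tot_deg by (auto dest: spec[of _ 0])
  have uv: "fst (u 0) - (dC (fst (v 0)) + b (snd (v 0))) \<in> NC n"
    using v(2) unfolding Tot_null fun_diff_def Tot_dif by (auto dest: spec[of _ 0])
  have "fst (u 0) - (dC (fst (v 0)) + b (snd (v 0))) \<in> PC n"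
    using subgrp_diff[OF gC u' subgrp_add[OF gC dC.deg[OF v'(1), of n] b.deg[OF v'(2), of n]]] by simp
  from subgrp_add[OF nQ fst_null_Q[OF this uv] b_null_Q[OF v'(2)]]
  have "fst (u 0) - dC (fst (v 0)) \<in> null_part Q n" by (simp add: algebra_simps)
  then show ?thesis using u' v'(1) by (auto simp: boundaries_def Q_deg Q_dif)
qed

lemma induced_lift_class:
  assumes D': "chain_complex D'" and u: "lifts n r u" and r: "r \<in> cycles Q n"
    and f: "\<And>u u'. u - u' \<in> boundaries T n \<Longrightarrow> u \<in> cycles T n \<Longrightarrow> u' \<in> cycles T n \<Longrightarrow> f u - f u' \<in> boundaries D' m"
  shows "induced D' m (\<lambda>r y. \<exists>u. lifts n r u \<and> y = f u) (r +o boundaries Q n) = f u +o boundaries D' m"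
proof (rule induced_class[OF chain_complex_Q D'])
  show "\<exists>v. lifts n r v \<and> f u = f v" using u by blast
  fix r' y assume "r' - r \<in> boundaries Q n" "\<exists>v. lifts n r' v \<and> y = f v"
  then show "y - f u \<in> boundaries D' m" using f lift_unique u by metis
qed

lemma periodicity_class:
  assumes u: "lifts n r u" and r: "r \<in> cycles Q n"
  shows "induced Q (n - 2) (\<lambda>r y. \<exists>u. lifts n r u \<and> y = fst (shift2 u 0)) (r +o boundaries Q n)
    = fst (shift2 u 0) +o boundaries Q (n - 2)"
proof (rule induced_lift_class[OF chain_complex_Q u r])
  fix u u' assume "u - u' \<in> boundaries T n"
  from fst_boundary[OF shift2_boundaries[OF this]]
  show "fst (shift2 u 0) - fst (shift2 u' 0) \<in> boundaries Q (n - 2)" by (simp add: shift2_def)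
qed

abbreviation T2 where "T2 \<equiv> Tot2 C D b"

lemma connecting_cycle:
  assumes r: "r \<in> cycles Q n" shows "(0, e r) \<in> cycles T2 (n + 1)"
proof -
  have r: "r \<in> PC n" "dC r \<in> null_part Q (n - 1)"
    using assms by (auto simp: cycles_def Q_deg Q_dif)
  have "dC r \<in> PC (n - 1)" using dC.deg[OF r(1), of "n - 1"] by simp
  then have 1: "e (dC r) \<in> ND (n - 1)" using r(2) Q_null by blast
  from subgrp_diff[OF nD e.commute[OF r(1), of "n - 1"] 1]
  have "- dD (e r) \<in> ND (n - 1)" by simp
  moreover have "b (e r) \<in> NC n" by (rule be[OF r(1)])
  moreover have "dC 0 \<in> NC n" by (rule dC.zero)
  moreover have "e r \<in> PD n" using e.deg[OF r(1), of n] by simp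
  ultimately show ?thesis
    using subgrp_zero[OF gC] subgrp_add[OF nC] by (simp add: cycles_def Tot2_def)
qed

text \<open>
  The connecting homomorphism in terms of a lift \<open>u\<close> of \<open>r\<close>: the preimage \<open>v\<close> may be taken to be \<open>u\<close>
  moved two columns to the right with zeros in front, and its boundary is then \<open>(0, e (fst (u 0)))\<close> and
  null elsewhere.
\<close>

lemma connecting_class:
  assumes r: "r \<in> cycles Q n"
  shows "induced T2 (n + 1) (\<lambda>r w. \<exists>u v. lifts n r u \<and>
        v \<in> deg_part T (n + 2) \<and> shift2 v - u \<in> null_part T n \<and> w \<in> deg_part T2 (n + 1) \<and>
        differential T v - incl2 w \<in> null_part T (n + 1)) (r +o boundaries Q n)
    = (0, e r) +o boundaries T2 (n + 1)" (is "induced _ _ ?\<rho> _ = _")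
proof (rule induced_class[OF chain_complex_Q chain_complex_Tot2])
  have rd: "r \<in> PC n" using r by (simp add: cycles_def Q_deg)
  obtain u where u: "lifts n r u" using lift_exists[OF r] .
  note uc = T_cycleD[OF conjunct1[OF u]]
  have "cycles T2 (n + 1) \<subseteq> deg_part T2 (n + 1)" by (auto simp: cycles_def)
  then have er: "(0, e r) \<in> deg_part T2 (n + 1)" using connecting_cycle[OF r] by blast
  define v where "v j = (case j of 0 \<Rightarrow> (0, 0) | Suc i \<Rightarrow> u i)" for j
  have v0: "v 0 = (0, 0)" and v_Suc: "v (Suc j) = u j" for j by (simp_all add: v_def)
  have sv: "shift2 v = u" by (rule ext) (simp add: shift2_def v_Suc)
  have vd: "v \<in> deg_part T (n + 2)"
    unfolding Tot_deg
  proof (intro allI conjI)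
    fix j
    show "fst (v j) \<in> PC (n + 2 - 2 * int j)" "snd (v j) \<in> PD (n + 2 - 1 - 2 * int j)"
      using uc(1,2)[of "j - 1"] subgrp_zero[OF gC] subgrp_zero[OF gD]
      by (cases j; simp add: v0 v_Suc algebra_simps)+
  qed
  have u0: "fst (u 0) \<in> PC n" using uc(1)[of 0] by simp
  have eu: "e (fst (u 0)) - e r \<in> ND n"
    using Q_null[OF subgrp_diff[OF gC u0 rd]] u subgrp_diff[OF nD _ e.diff[OF u0 rd, of n]]
    by (simp add: algebra_simps) (metis add.commute add_diff_cancel_left' diff_diff_eq2)
  have dv: "differential T v - incl2 (0, e r) \<in> null_part T (n + 1)"
    unfolding Tot_null fun_diff_def Tot_dif fst_diff snd_diff fst_conv snd_conv
  proof (intro allI conjI)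
    fix j
    show "dC (fst (v j)) + b (snd (v j)) - fst (incl2 (0, e r) j) \<in> NC (n + 1 - 2 * int j)"
      using subgrp_add[OF nC dC.zero b.zero] uc(4)[of "j - 1"]
      by (cases j) (simp_all add: v0 v_Suc incl2_def algebra_simps)
    show "e (fst (v (Suc j))) - dD (snd (v j)) - snd (incl2 (0, e r) j) \<in> ND (n + 1 - 1 - 2 * int j)"
      using subgrp_diff[OF nD eu dD.zero] uc(3)[of "j - 1"]
      by (cases j) (simp_all add: v0 v_Suc incl2_def algebra_simps)
  qed
  have "shift2 v - u \<in> null_part T n"
    using subgrp_zero[OF chain_complexD(2)[OF chain_complex_Tot]] by (simp add: sv)
  then show "?\<rho> r (0, e r)" using u vd er dv by blast
  fix r' w assume r': "r' - r \<in> boundaries Q n" and "?\<rho> r' w"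
  then obtain u v where u: "lifts n r' u"
    and v: "v \<in> deg_part T (n + 2)" "shift2 v - u \<in> null_part T n"
    and w: "w \<in> deg_part T2 (n + 1)" "differential T v - incl2 w \<in> null_part T (n + 1)" by blast
  obtain p \<omega> where [simp]: "w = (p, \<omega>)" by (cases w)
  have wd: "p \<in> PC (n + 1)" "\<omega> \<in> PD n" using w(1) by (auto simp: Tot2_def)
  have v_deg: "fst (v 0) \<in> PC (n + 2)" "snd (v 0) \<in> PD (n + 1)" "fst (v 1) \<in> PC n"
    using spec[OF v(1)[unfolded Tot_deg], of 0] spec[OF v(1)[unfolded Tot_deg], of 1] by (simp_all add: add.commute)
  have w0: "dC (fst (v 0)) + b (snd (v 0)) - p \<in> NC (n + 1)"
    "e (fst (v 1)) - dD (snd (v 0)) - \<omega> \<in> ND n"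
    using spec[OF w(2)[unfolded Tot_null fun_diff_def Tot_dif fst_diff snd_diff fst_conv snd_conv], of 0]
    by (simp_all add: incl2_def)
  obtain x where x: "x \<in> PC (n + 1)" "r' - r - dC x \<in> null_part Q n"
    using r' by (auto simp: boundaries_def Q_deg Q_dif)
  have u0: "fst (u 0) \<in> PC n" using T_cycleD(1)[OF conjunct1[OF u], of 0] by simp
  have dx: "dC x \<in> PC n" using dC.deg[OF x(1), of n] by simp
  have vu: "fst (v 1) - fst (u 0) \<in> null_part Q n"
    using v(2) by (intro fst_null_Q[OF subgrp_diff[OF gC v_deg(3) u0]])
      (auto simp: Tot_null shift2_def dest: spec[of _ 0])
  have 1: "fst (v 1) - r \<in> PC n" by (rule subgrp_diff[OF gC v_deg(3) rd])
  from subgrp_add[OF nQ vu subgrp_add[OF nQ conjunct2[OF u] x(2)]]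
  have "fst (v 1) - r - dC x \<in> null_part Q n" by (simp add: algebra_simps)
  then have 2: "e (fst (v 1) - r - dC x) \<in> ND n"
    using Q_null[OF subgrp_diff[OF gC 1 dx]] by simp
  have 3: "e (fst (v 1) - r - dC x) - (e (fst (v 1) - r) - e (dC x)) \<in> ND n"
    using e.diff[OF 1 dx, of n] by simp
  have 4: "e (fst (v 1) - r) - (e (fst (v 1)) - e r) \<in> ND n"
    using e.diff[OF v_deg(3) rd, of n] by simp
  have 5: "e (dC x) - dD (e x) \<in> ND n"
    using e.commute[OF x(1), of n] by simp
  have ex: "e x \<in> PD (n + 1)" using e.deg[OF x(1), of "n + 1"] by simp
  \<comment> \<open>The witness of homology is the first column of the preimage \<open>v\<close>, corrected by \<open>e x\<close>.\<close>
  have 6: "dD (snd (v 0) - e x) - (dD (snd (v 0)) - dD (e x)) \<in> ND n"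
    using dD.diff[OF v_deg(2) ex, of n] by simp
  have 7: "b (snd (v 0) - e x) - (b (snd (v 0)) - b (e x)) \<in> NC (n + 1)"
    using b.diff[OF v_deg(2) ex, of "n + 1"] by simp
  from subgrp_diff[OF nC be[OF x(1)] subgrp_add[OF nC 7 w0(1)]]
  have fst: "p - (dC (fst (v 0)) + b (snd (v 0) - e x)) \<in> NC (n + 1)"
    by (simp add: algebra_simps)
  from subgrp_add[OF nD 6 subgrp_add[OF nD subgrp_diff[OF nD 2 w0(2)] subgrp_diff[OF nD 5 subgrp_add[OF nD 3 4]]]]
  have snd: "\<omega> - e r + dD (snd (v 0) - e x) \<in> ND n"
    by (simp add: algebra_simps)
  have B: "w - (0, e r) - differential T2 (fst (v 0), snd (v 0) - e x) \<in> null_part T2 (n + 1)"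
    using fst snd by (simp add: Tot2_def)
  have A: "(fst (v 0), snd (v 0) - e x) \<in> deg_part T2 (n + 1 + 1)"
    using v_deg ex by (simp add: Tot2_def subgrp_diff[OF gD] add.commute)
  have "w - (0, e r) \<in> deg_part T2 (n + 1)"
    by (rule subgrp_diff[OF chain_complexD(1)[OF chain_complex_Tot2] w(1) er])
  with A B show "w - (0, e r) \<in> boundaries T2 (n + 1)" by (rule boundariesI)
qed

end

section \<open>Linear algebra modulo a subspace\<close>

interpretation ps: vector_space "pscale :: 'k::field \<Rightarrow> ('b \<Rightarrow>\<^sub>0 'k) \<Rightarrow> _"
  by (rule vector_space_pscale)

lemma linearI:
  assumes "vector_space s" "vector_space s'"
    and "\<And>x y. f (x + y) = f x + f y" "\<And>c x. f (s c x) = s' c (f x)"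
  shows "Vector_Spaces.linear s s' f"
  using assms by (simp add: Vector_Spaces.linear_iff)

text \<open>
  A subspace of a vector space has a complement, so it is the kernel of a linear endomorphism.
\<close>

lemma quotient_projection:
  assumes "vector_space s" "module.subspace s N"
  obtains \<pi> where "Vector_Spaces.linear s s \<pi>" "\<And>x. \<pi> x = 0 \<longleftrightarrow> x \<in> N"
proof -
  interpret vector_space s by fact
  interpret vector_space_pair s s ..
  have "Vector_Spaces.linear s s id" by (simp add: linear_id)
  from linear_exists_left_inverse_on[OF this assms(2)]
  obtain g where g: "g ` UNIV \<subseteq> N" "\<And>v. v \<in> N \<Longrightarrow> g v = v" "Vector_Spaces.linear s s g"
    by auto
  interpret g: Vector_Spaces.linear s s g by (rule g(3))
  have "Vector_Spaces.linear s s (\<lambda>x. x - g x)"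
    by (rule linearI[OF assms(1,1)]) (simp_all add: g.add g.scale scale_right_diff_distrib)
  moreover have "x - g x = 0 \<longleftrightarrow> x \<in> N" for x
    using g(1) g(2)[of x] by (metis eq_iff_diff_eq_0 image_subset_iff UNIV_I)
  ultimately show thesis by (rule that)
qed

lemma span_linear_mem:
  assumes "Vector_Spaces.linear s s' F" "module.subspace s' N" "t \<in> module.span s S"
    and "\<And>x. x \<in> S \<Longrightarrow> F x \<in> N"
  shows "F t \<in> N"
proof -
  interpret Vector_Spaces.linear s s' F by fact
  show ?thesis using assms(3)
  proof (induction rule: vs1.span_induct_alt)
    case base show ?case using vs2.subspace_0[OF assms(2)] by (simp add: zero)
  next
    case (step c x y)
    then show ?case using assms(4) vs2.subspace_add[OF assms(2)] vs2.subspace_scale[OF assms(2)]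
      by (simp add: add scale)
  qed
qed

lemma span_linear_eq:
  assumes "Vector_Spaces.linear s s' F" "Vector_Spaces.linear s s' G" "t \<in> module.span s S"
    and "\<And>x. x \<in> S \<Longrightarrow> F x = G x"
  shows "F t = G t"
proof -
  interpret F: Vector_Spaces.linear s s' F by fact
  interpret vector_space_pair s s' ..
  show ?thesis using linear_eq_on_span[OF assms(1,2)] assms(3,4) by blast
qed

lemma subspace_subgrp:
  assumes "vector_space s" "module.subspace s N" shows "subgrp N"
proof -
  interpret vector_space s by fact
  show ?thesis using assms(2) by (simp add: subgrp_def subspace_0 subspace_diff)
qed

lemma linear_chain_complex:
  assumes s: "vector_space s" and lin: "Vector_Spaces.linear s s (differential C)"
    and "\<And>n. module.subspace s (deg_part C n)" "\<And>n. module.subspace s (null_part C n)"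
    and "\<And>n x. x \<in> deg_part C n \<Longrightarrow> differential C x \<in> deg_part C (n - 1)"
    and "\<And>n x. x \<in> null_part C n \<Longrightarrow> differential C x \<in> null_part C (n - 1)"
    and "\<And>n x. x \<in> deg_part C n \<Longrightarrow> differential C (differential C x) \<in> null_part C (n - 2)"
  shows "chain_complex C"
proof -
  interpret Vector_Spaces.linear s s "differential C" by fact
  show ?thesis
    unfolding chain_complex_def graded_map_def
    using assms vs1.subspace_0 by (auto intro: subspace_subgrp simp: diff)
qed

lemma lin_ext_uminus:
  assumes "vector_space s" shows "lin_ext s f (- t) = - lin_ext s f (t :: 'b \<Rightarrow>\<^sub>0 'k::field)"
  using Vector_Spaces.linear.axioms module_hom.neg lin_ext_linear[OF assms, of f]
  by (metis Vector_Spaces.linear_iff_module_hom)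

lemma lin_ext_diff:
  assumes "vector_space s" shows "lin_ext s f (t - u) = lin_ext s f t - lin_ext s f (u :: 'b \<Rightarrow>\<^sub>0 'k::field)"
  using lin_ext_add[OF assms, of f t "- u"] by (simp add: lin_ext_uminus[OF assms])

lemma lin_ext_tens:
  assumes "vector_space s" shows "lin_ext s (\<lambda>(a, b). F a b) (tens a b) = (F a b)"
proof -
  interpret vector_space s by fact
  show ?thesis by (simp add: tens_def lin_ext_single[OF assms])
qed

lemma span_single: "t \<in> ps.span (range (\<lambda>b. Poly_Mapping.single b 1))"
proof (induction t rule: pm_induct)
  case zero then show ?case by (rule ps.span_zero)
next
  case (add t b c)
  have "pscale c (Poly_Mapping.single b 1) \<in> ps.span (range (\<lambda>b. Poly_Mapping.single b 1))"
    by (intro ps.span_scale ps.span_base) simp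
  with add show ?case by (auto simp: pscale_single intro: ps.span_add)
qed

lemma span_tens: "(t :: ('k::field, 'u) tensors) \<in> ps.span {tens a b | a b. True}"
proof -
  have "range (\<lambda>b. Poly_Mapping.single b (1 :: 'k)) = {tens a b | (a :: 'u) b. True}"
    by (auto simp: tens_def)
  then show ?thesis using span_single[of t] by simp
qed

lemma subspace_tensor_null: "ps.subspace (tensor_null s)"
  by (simp add: tensor_null_def ps.subspace_span)

lemma tens_add_left: "tens (u + u') v - (tens u v + tens u' v) \<in> tensor_null s"
  and tens_add_right: "tens u (v + v') - (tens u v + tens u v') \<in> tensor_null s"
  and tens_scale_left: "tens (s c u) v - pscale c (tens u v) \<in> tensor_null s"
  and tens_scale_right: "tens u (s c v) - pscale c (tens u v) \<in> tensor_null s"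
  unfolding tensor_null_def by (intro ps.span_base; blast)+

text \<open>
  The universal property of the tensor product, for maps that are bilinear modulo a subspace \<open>I\<close>.
\<close>

lemma bilinear_tensor_null:
  assumes s': "vector_space s'" and I: "module.subspace s' I"
    and "\<And>u u' v. F (u + u') v - (F u v + F u' v) \<in> I"
    and "\<And>u v v'. F u (v + v') - (F u v + F u v') \<in> I"
    and "\<And>c u v. F (s c u) v - s' c (F u v) \<in> I"
    and "\<And>c u v. F u (s c v) - s' c (F u v) \<in> I"
    and t: "t \<in> tensor_null s"
  shows "lin_ext s' (\<lambda>(a, b). F a b) t \<in> I"
  by (rule span_linear_mem[OF lin_ext_linear[OF s'] I t[unfolded tensor_null_def]])
    (use assms in \<open>auto simp: lin_ext_diff[OF s'] lin_ext_add[OF s'] lin_ext_scale[OF s'] lin_ext_tens[OF s']\<close>)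

text \<open>
  After a linear map \<open>\<pi>\<close> that kills \<open>tensor_null s\<close>, the symbols \<open>tens u v\<close> become honestly bilinear, so that
  the simplifier can compute with them.
\<close>

locale tensor_projection = vector_space s for s :: "'k::field \<Rightarrow> 'u::ab_group_add \<Rightarrow> 'u" +
  fixes \<pi> :: "('k, 'u) tensors \<Rightarrow> ('k, 'u) tensors"
  assumes linear_\<pi>: "Vector_Spaces.linear pscale pscale \<pi>"
    and \<pi>_tensor_null: "t \<in> tensor_null s \<Longrightarrow> \<pi> t = 0"
begin

sublocale \<pi>: Vector_Spaces.linear pscale pscale \<pi> by (rule linear_\<pi>)

lemma tens_add: "\<pi> (tens (u + u') v) = \<pi> (tens u v) + \<pi> (tens u' v)"
  "\<pi> (tens u (v + v')) = \<pi> (tens u v) + \<pi> (tens u v')"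
  using \<pi>_tensor_null[OF tens_add_left] \<pi>_tensor_null[OF tens_add_right] by (simp_all add: \<pi>.diff \<pi>.add)

lemma tens_scale: "\<pi> (tens (s c u) v) = pscale c (\<pi> (tens u v))"
  "\<pi> (tens u (s c v)) = pscale c (\<pi> (tens u v))"
  using \<pi>_tensor_null[OF tens_scale_left] \<pi>_tensor_null[OF tens_scale_right] by (simp_all add: \<pi>.diff \<pi>.scale)

lemma tens_zero: "\<pi> (tens 0 v) = 0" "\<pi> (tens u 0) = 0"
  using tens_add[of 0 0] tens_add(2)[of _ 0 0] by simp_all

lemma tens_uminus: "\<pi> (tens (- u) v) = - \<pi> (tens u v)" "\<pi> (tens u (- v)) = - \<pi> (tens u v)"
  using tens_add(1)[of u "- u" v] tens_add(2)[of u v "- v"]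
  by (simp_all add: tens_zero eq_neg_iff_add_eq_0 add.commute)

lemma tens_diff: "\<pi> (tens (u - u') v) = \<pi> (tens u v) - \<pi> (tens u' v)"
  "\<pi> (tens u (v - v')) = \<pi> (tens u v) - \<pi> (tens u v')"
  using tens_add(1)[of u "- u'" v] tens_add(2)[of u v "- v'"] by (simp_all add: tens_uminus)

lemma tens_sum: "\<pi> (tens (\<Sum>i\<in>S. f i) v) = (\<Sum>i\<in>S. \<pi> (tens (f i) v))"
  "\<pi> (tens u (\<Sum>i\<in>S. f i)) = (\<Sum>i\<in>S. \<pi> (tens u (f i)))"
  by (induction S rule: infinite_finite_induct; simp add: tens_zero tens_add)+

lemmas tens_simps = tens_add tens_scale tens_zero tens_uminus tens_diff tens_sum
  \<pi>.add \<pi>.diff \<pi>.neg \<pi>.scale \<pi>.zero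

lemma \<pi>_lin_ext: "\<pi> (lin_ext pscale F t) = lin_ext pscale (\<lambda>b. \<pi> (F b)) t"
  by (rule span_linear_eq[OF _ _ span_single])
    (auto intro!: linearI ps.vector_space_axioms simp: lin_ext_add[OF vector_space_pscale] lin_ext_scale[OF vector_space_pscale]
      lin_ext_single[OF vector_space_pscale] \<pi>.add \<pi>.scale)

end

text \<open>
  A linear map with kernel \<open>N\<close>, used in place of the projection onto the quotient by \<open>N\<close>.
\<close>

definition mod_out :: "('b \<Rightarrow>\<^sub>0 'k::field) set \<Rightarrow> ('b \<Rightarrow>\<^sub>0 'k) \<Rightarrow> ('b \<Rightarrow>\<^sub>0 'k)" where
  "mod_out N = (SOME \<pi>. Vector_Spaces.linear pscale pscale \<pi> \<and> (\<forall>t. \<pi> t = 0 \<longleftrightarrow> t \<in> N))"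

lemma mod_out:
  fixes N :: "('b \<Rightarrow>\<^sub>0 'k::field) set"
  assumes "ps.subspace N"
  shows "Vector_Spaces.linear pscale pscale (mod_out N)" "mod_out N t = 0 \<longleftrightarrow> t \<in> N"
proof -
  obtain \<pi> :: "('b \<Rightarrow>\<^sub>0 'k) \<Rightarrow> ('b \<Rightarrow>\<^sub>0 'k)"
    where "Vector_Spaces.linear pscale pscale \<pi>" "\<And>t. \<pi> t = 0 \<longleftrightarrow> t \<in> N"
    by (rule quotient_projection[OF vector_space_pscale assms]) blast
  then have "Vector_Spaces.linear pscale pscale \<pi> \<and> (\<forall>t. \<pi> t = 0 \<longleftrightarrow> t \<in> N)" by blast
  from someI[of "\<lambda>\<pi>. Vector_Spaces.linear pscale pscale \<pi> \<and> (\<forall>t. \<pi> t = 0 \<longleftrightarrow> t \<in> N)", OF this]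
  show "Vector_Spaces.linear pscale pscale (mod_out N)" "mod_out N t = 0 \<longleftrightarrow> t \<in> N"
    unfolding mod_out_def by blast+
qed

lemma tensor_projection_mod_out:
  fixes N :: "('k::field, 'u::ab_group_add) tensors set"
  assumes "vector_space s" "ps.subspace N" "tensor_null s \<subseteq> N"
  shows "tensor_projection s (mod_out N)"
  unfolding tensor_projection_def tensor_projection_axioms_def
  using assms(1) mod_out[OF assms(2)] subsetD[OF assms(3)] by blast

lemma linear_chain_mapI:
  assumes lin: "Vector_Spaces.linear s s' f" and N: "\<And>n. module.subspace s' (null_part D n)"
    and "\<And>n x. x \<in> deg_part C n \<Longrightarrow> f x \<in> deg_part D n"
    and "\<And>n x. x \<in> null_part C n \<Longrightarrow> x \<in> deg_part C n \<Longrightarrow> f x \<in> null_part D n"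
    and "\<And>n x. x \<in> deg_part C n \<Longrightarrow> f (differential C x) - differential D (f x) \<in> null_part D (n - 1)"
  shows "chain_map C D f"
proof -
  interpret Vector_Spaces.linear s s' f by fact
  show ?thesis
    unfolding chain_map_def graded_map_def using assms(3-5) vs2.subspace_0[OF N] by (auto simp: diff)
qed

section \<open>Graded algebras\<close>

lemma ksign_even [simp]: "even n \<Longrightarrow> ksign n = 1" and ksign_odd [simp]: "odd n \<Longrightarrow> ksign n = - 1"
  by (simp_all add: ksign_def)

lemma ksign_square [simp]: "ksign n * (ksign n * x) = (x :: 'a::ring_1)"
  by (cases "even n") simp_all

lemma ksign_pscale: "pscale (ksign n) x = ksign n * (x :: ('a::monoid_add) \<Rightarrow>\<^sub>0 'k::field)"
  by (cases "even n") simp_all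

locale dga =
  fixes R :: "('k::field, 'r::ring_1) dg_alg"
  assumes dg: "dg_algebra R"
begin

lemma vs: "vector_space (scal R)"
  using dg by (simp add: dg_algebra_def k_algebra_def)

sublocale V: vector_space "scal R" by (rule vs)

lemma scal_mult [simp]: "scal R c x * y = scal R c (x * y)" "x * scal R c y = scal R c (x * y)"
  using dg unfolding dg_algebra_def k_algebra_def by metis+

lemma piece_subspace: "V.subspace (piece R n)"
  and one_piece: "1 \<in> piece R 0"
  and mult_piece: "\<lbrakk>x \<in> piece R m; y \<in> piece R n\<rbrakk> \<Longrightarrow> x * y \<in> piece R (m + n)"
  and dif_linear: "Vector_Spaces.linear (scal R) (scal R) (dif R)"
  and dif_piece: "x \<in> piece R n \<Longrightarrow> dif R x \<in> piece R (n - 1)"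
  and dif_dif: "dif R (dif R x) = 0"
  and leibniz: "x \<in> piece R n \<Longrightarrow> dif R (x * y) = dif R x * y + ksign n * (x * dif R y)"
  and unique_decomposition: "\<exists>!f. is_decomposition R x f"
  using dg unfolding dg_algebra_def by blast+

sublocale d: Vector_Spaces.linear "scal R" "scal R" "dif R" by (rule dif_linear)

lemmas piece_zero = V.subspace_0[OF piece_subspace]
lemmas piece_add = V.subspace_add[OF piece_subspace]
lemmas piece_diff = V.subspace_diff[OF piece_subspace]
lemmas piece_scale = V.subspace_scale[OF piece_subspace]
lemmas piece_neg = V.subspace_neg[OF piece_subspace]

lemma ksign_scal: "scal R (ksign n) x = ksign n * x"
  by (cases "even n") simp_all

lemma piece_ksign: "x \<in> piece R n \<Longrightarrow> ksign m * x \<in> piece R n"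
  by (cases "even m") (simp_all add: piece_neg)

lemma dif_one: "dif R 1 = 0"
  using leibniz[OF one_piece, of 1] by simp

lemma component_decomposition: "is_decomposition R x (component R x)"
  unfolding component_def by (rule theI'[OF unique_decomposition])

lemma component_unique: "is_decomposition R x f \<Longrightarrow> component R x = f"
  using component_decomposition unique_decomposition by blast

lemma component_finite: "finite {n. component R x n \<noteq> 0}"
  and component_piece: "component R x n \<in> piece R n"
  and component_sum: "(\<Sum>n | component R x n \<noteq> 0. component R x n) = x"
  using component_decomposition[of x] unfolding is_decomposition_def by simp_all

lemma component_sum':
  assumes "finite S" "{n. component R x n \<noteq> 0} \<subseteq> S" shows "(\<Sum>n\<in>S. component R x n) = x"
proof -
  have "(\<Sum>n\<in>S. component R x n) = (\<Sum>n | component R x n \<noteq> 0. component R x n)"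
    by (rule sum.mono_neutral_right[OF assms]) simp
  then show ?thesis unfolding component_sum .
qed

lemma component_homogeneous:
  assumes "x \<in> piece R n" shows "component R x = (\<lambda>m. if m = n then x else 0)"
proof (rule component_unique)
  have "{m. (if m = n then x else 0) \<noteq> 0} = (if x = 0 then {} else {n})" by auto
  then show "is_decomposition R x (\<lambda>m. if m = n then x else 0)"
    unfolding is_decomposition_def using assms piece_zero by auto
qed

lemma component_add: "component R (x + y) n = component R x n + component R y n"
proof -
  let ?f = "\<lambda>n. component R x n + component R y n"
  let ?S = "{n. component R x n \<noteq> 0} \<union> {n. component R y n \<noteq> 0}"
  have S: "finite ?S" "{n. ?f n \<noteq> 0} \<subseteq> ?S" using component_finite by auto
  have "x + y = (\<Sum>n\<in>?S. ?f n)"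
    unfolding sum.distrib by (subst (1 2) component_sum'[OF S(1)]) auto
  also have "\<dots> = (\<Sum>n | ?f n \<noteq> 0. ?f n)" by (rule sum.mono_neutral_right[OF S]) auto
  finally have "is_decomposition R (x + y) ?f"
    unfolding is_decomposition_def using finite_subset[OF S(2,1)] component_piece by (auto intro: piece_add)
  then show ?thesis by (simp add: component_unique)
qed

lemma component_scale: "component R (scal R c x) n = scal R c (component R x n)"
proof -
  let ?f = "\<lambda>n. scal R c (component R x n)"
  let ?S = "{n. component R x n \<noteq> 0}"
  have S: "finite ?S" "{n. ?f n \<noteq> 0} \<subseteq> ?S" using component_finite by auto
  have "scal R c x = (\<Sum>n\<in>?S. ?f n)"
    unfolding V.scale_sum_right[symmetric] component_sum ..
  also have "\<dots> = (\<Sum>n | ?f n \<noteq> 0. ?f n)" by (rule sum.mono_neutral_right[OF S]) auto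
  finally have "is_decomposition R (scal R c x) ?f"
    unfolding is_decomposition_def using finite_subset[OF S(2,1)] component_piece by (auto intro: piece_scale)
  then show ?thesis by (simp add: component_unique)
qed

text \<open>
  Linear statements about graded algebras need to be checked on homogeneous elements only, where the
  signs are explicit.
\<close>

lemma homogeneous_induct [case_names homogeneous add]:
  assumes h: "\<And>n x. x \<in> piece R n \<Longrightarrow> P x" and a: "\<And>x y. P x \<Longrightarrow> P y \<Longrightarrow> P (x + y)"
  shows "P x"
proof -
  have "P (\<Sum>n\<in>S. component R x n)" if "finite S" for S
    using that by (induction S) (auto intro: h[OF component_piece] h[OF piece_zero] a)
  from this[OF component_finite[of x]] show ?thesis unfolding component_sum .
qed

lemma parity_alt:
  assumes "finite S" "{n. component R x n \<noteq> 0} \<subseteq> S"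
  shows "parity R x = (\<Sum>n\<in>S. ksign n * component R x n)"
  unfolding parity_def by (rule sum.mono_neutral_left[OF assms]) auto

lemma parity_add: "parity R (x + y) = parity R x + parity R y"
proof -
  let ?S = "{n. component R x n \<noteq> 0} \<union> {n. component R y n \<noteq> 0}"
  have "finite ?S" "{n. component R (x + y) n \<noteq> 0} \<subseteq> ?S" using component_finite by (auto simp: component_add)
  from parity_alt[OF this] parity_alt[of ?S x] parity_alt[of ?S y] this(1)
  show ?thesis by (simp add: component_add distrib_left sum.distrib)
qed

lemma parity_homog: "x \<in> piece R n \<Longrightarrow> parity R x = ksign n * x"
  by (rule parity_homogeneous[OF dg])

lemma parity_scale: "parity R (scal R c x) = scal R c (parity R x)"
proof (induction x rule: homogeneous_induct)
  case (homogeneous n x)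
  then show ?case using parity_homog[OF piece_scale[OF homogeneous]] by (simp add: parity_homog)
qed (simp add: V.scale_right_distrib parity_add)

lemma parity_linear: "Vector_Spaces.linear (scal R) (scal R) (parity R)"
  by (rule linearI) (simp_all only: vs parity_add parity_scale)

sublocale parity: Vector_Spaces.linear "scal R" "scal R" "parity R" by (rule parity_linear)

lemma parity_piece: "x \<in> piece R n \<Longrightarrow> parity R x \<in> piece R n"
  by (simp add: parity_homog piece_ksign)

lemma parity_one: "parity R 1 = 1"
  using parity_homog[OF one_piece] by simp

lemma parity_mult: "parity R (x * y) = parity R x * parity R y"
proof (induction x rule: homogeneous_induct)
  case x: (homogeneous m x)
  show ?case
  proof (induction y rule: homogeneous_induct)
    case (homogeneous n y)
    then show ?case using parity_homog[OF mult_piece[OF x homogeneous]] x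
      by (cases "even m"; cases "even n") (simp_all add: parity_homog)
  qed (simp add: distrib_left parity_add)
qed (simp add: distrib_right parity_add)

lemma parity_parity: "parity R (parity R x) = x"
proof (induction x rule: homogeneous_induct)
  case (homogeneous n x)
  then show ?case using parity_homog[OF parity_piece[OF homogeneous]] by (simp add: parity_homog)
qed (simp add: parity_add)

lemma dif_parity: "dif R (parity R x) = - parity R (dif R x)"
proof (induction x rule: homogeneous_induct)
  case (homogeneous n x)
  then show ?case using parity_homog[OF dif_piece[OF homogeneous]]
    by (cases "even n") (simp_all add: parity_homog d.neg)
qed (simp add: parity_add d.add)

lemma dif_mult: "dif R (x * y) = dif R x * y + parity R x * dif R y"
proof (induction x rule: homogeneous_induct)
  case (homogeneous n x)
  then show ?case by (simp add: leibniz parity_homog mult.assoc)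
qed (simp add: distrib_right parity_add d.add)

text \<open>
  The subtrahend of the graded commutator, \<open>\<plusminus> y x\<close> for homogeneous \<open>x\<close> and \<open>y\<close>. It is a sum over the components;
  it is additive because the indices may run over any larger finite set.
\<close>

definition swap_mult :: "'r \<Rightarrow> 'r \<Rightarrow> 'r" where "swap_mult x y = x * y - commutator R x y"

lemma swap_mult_alt:
  assumes "finite S" "{n. component R x n \<noteq> 0} \<subseteq> S" "finite T" "{n. component R y n \<noteq> 0} \<subseteq> T"
  shows "swap_mult x y = (\<Sum>m\<in>S. \<Sum>n\<in>T. ksign (m * n) * (component R y n * component R x m))"
proof -
  have "(\<Sum>n | component R y n \<noteq> 0. ksign (m * n) * (component R y n * component R x m))
      = (\<Sum>n\<in>T. ksign (m * n) * (component R y n * component R x m))" for m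
    using assms by (intro sum.mono_neutral_left) auto
  then have "swap_mult x y = (\<Sum>m | component R x m \<noteq> 0. \<Sum>n\<in>T. ksign (m * n) * (component R y n * component R x m))"
    unfolding swap_mult_def commutator_def by simp
  also have "\<dots> = (\<Sum>m\<in>S. \<Sum>n\<in>T. ksign (m * n) * (component R y n * component R x m))"
    using assms by (intro sum.mono_neutral_left) auto
  finally show ?thesis .
qed

lemma swap_mult_add_left: "swap_mult (x + x') y = swap_mult x y + swap_mult x' y"
proof -
  let ?S = "{n. component R x n \<noteq> 0} \<union> {n. component R x' n \<noteq> 0}" and ?T = "{n. component R y n \<noteq> 0}"
  have "finite ?S" "{n. component R (x + x') n \<noteq> 0} \<subseteq> ?S" "finite ?T"
    using component_finite by (auto simp: component_add)
  then show ?thesis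
    using swap_mult_alt[of ?S "x + x'" ?T y] swap_mult_alt[of ?S x ?T y] swap_mult_alt[of ?S x' ?T y]
    by (simp add: component_add distrib_left sum.distrib)
qed

lemma swap_mult_add_right: "swap_mult x (y + y') = swap_mult x y + swap_mult x y'"
proof -
  let ?S = "{n. component R y n \<noteq> 0} \<union> {n. component R y' n \<noteq> 0}" and ?T = "{n. component R x n \<noteq> 0}"
  have "finite ?S" "{n. component R (y + y') n \<noteq> 0} \<subseteq> ?S" "finite ?T"
    using component_finite by (auto simp: component_add)
  then show ?thesis
    using swap_mult_alt[of ?T x ?S "y + y'"] swap_mult_alt[of ?T x ?S y] swap_mult_alt[of ?T x ?S y']
    by (simp add: component_add distrib_left distrib_right sum.distrib)
qed

lemma swap_mult_homog: "\<lbrakk>x \<in> piece R m; y \<in> piece R n\<rbrakk> \<Longrightarrow> swap_mult x y = ksign (m * n) * (y * x)"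
  by (subst swap_mult_alt[of "{m}" x "{n}" y]) (auto simp: component_homogeneous split: if_splits)

lemma commutator_swap: "commutator R x y = x * y - swap_mult x y"
  by (simp add: swap_mult_def)

lemma commutator_homog: "\<lbrakk>x \<in> piece R m; y \<in> piece R n\<rbrakk> \<Longrightarrow> commutator R x y = x * y - ksign (m * n) * (y * x)"
  by (simp add: commutator_swap swap_mult_homog)

lemma commutator_add: "commutator R (x + x') y = commutator R x y + commutator R x' y"
  "commutator R x (y + y') = commutator R x y + commutator R x y'"
  by (simp_all add: commutator_swap swap_mult_add_left swap_mult_add_right algebra_simps)

lemma commutator_scale: "commutator R (scal R c x) y = scal R c (commutator R x y)"
  "commutator R x (scal R c y) = scal R c (commutator R x y)"
proof -
  have "commutator R (scal R c x) y = scal R c (commutator R x y) \<and>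
      commutator R x (scal R c y) = scal R c (commutator R x y)"
  proof (induction x rule: homogeneous_induct)
    case x: (homogeneous m x)
    show ?case
    proof (induction y rule: homogeneous_induct)
      case y: (homogeneous n y)
      show ?case
        using commutator_homog[OF piece_scale[OF x, of c] y] commutator_homog[OF x piece_scale[OF y, of c]]
        by (simp add: commutator_homog[OF x y] V.scale_right_diff_distrib)
    qed (simp add: commutator_add V.scale_right_distrib)
  qed (simp add: commutator_add V.scale_right_distrib)
  then show "commutator R (scal R c x) y = scal R c (commutator R x y)"
    "commutator R x (scal R c y) = scal R c (commutator R x y)" by blast+
qed

lemma commutator_piece: "\<lbrakk>x \<in> piece R m; y \<in> piece R n\<rbrakk> \<Longrightarrow> commutator R x y \<in> piece R (m + n)"
  using mult_piece[of x m y n] mult_piece[of y n x m]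
  by (simp add: commutator_homog add.commute piece_diff piece_ksign)

lemma commutator_one: "commutator R 1 x = 0" "commutator R x 1 = 0"
proof -
  have "commutator R 1 x = 0 \<and> commutator R x 1 = 0"
    by (induction x rule: homogeneous_induct)
      (simp_all add: commutator_homog[OF one_piece] commutator_homog[OF _ one_piece] commutator_add)
  then show "commutator R 1 x = 0" "commutator R x 1 = 0" by blast+
qed

lemma dif_commutator: "dif R (commutator R x y) = commutator R (dif R x) y + commutator R (parity R x) (dif R y)"
proof (induction x rule: homogeneous_induct)
  case x: (homogeneous m x)
  show ?case
  proof (induction y rule: homogeneous_induct)
    case y: (homogeneous n y)
    show ?case
      unfolding commutator_homog[OF x y] commutator_homog[OF dif_piece[OF x] y]
        commutator_homog[OF parity_piece[OF x] dif_piece[OF y]]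
      by (cases "even m"; cases "even n") (simp_all add: parity_homog[OF x] d.diff d.add d.neg leibniz[OF x, of y] leibniz[OF y, of x])
  qed (simp add: commutator_add d.add)
qed (simp add: commutator_add d.add parity_add)

end

section \<open>The bicomplex of noncommutative forms\<close>

lemmas lin_ext_pscale = lin_ext_add[OF vector_space_pscale] lin_ext_scale[OF vector_space_pscale]
  lin_ext_diff[OF vector_space_pscale] lin_ext_uminus[OF vector_space_pscale] lin_ext_0
  lin_ext_tens[OF vector_space_pscale]

lemma lact_simps: "lact x (t + u) = lact x t + lact x u" "lact x (pscale c t) = pscale c (lact x t)"
  "lact x (t - u) = lact x t - lact x u" "lact x (- t) = - lact x t" "lact x 0 = 0"
  "lact x (tens a b) = tens (x * a) b"
  by (simp_all add: lact_def lin_ext_pscale)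

lemma ract_simps: "ract (t + u) x = ract t x + ract u x" "ract (pscale c t) x = pscale c (ract t x)"
  "ract (t - u) x = ract t x - ract u x" "ract (- t) x = - ract t x" "ract 0 x = 0"
  "ract (tens a b) x = tens a (b * x)"
  by (simp_all add: ract_def lin_ext_pscale)

context dga
begin

sublocale tmult: Vector_Spaces.linear pscale "scal R" "tens_mult R"
  unfolding tens_mult_def by (rule lin_ext_linear[OF vs])

sublocale beta: Vector_Spaces.linear pscale "scal R" "beta R"
  unfolding beta_def by (rule lin_ext_linear[OF vs])

sublocale tdif: Vector_Spaces.linear pscale pscale "tens_dif R"
  unfolding tens_dif_def by (rule lin_ext_linear[OF vector_space_pscale])

lemma tmult_tens: "tens_mult R (tens a b) = a * b"
  and beta_tens: "beta R (tens a b) = commutator R a b"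
  and tdif_tens: "tens_dif R (tens a b) = tens (dif R a) b + tens (parity R a) (dif R b)"
  by (simp_all add: tens_mult_def beta_def tens_dif_def lin_ext_tens vs vector_space_pscale)

lemma tens_deg_subspace: "ps.subspace (tens_deg R n)"
  by (simp add: tens_deg_def ps.subspace_span)

lemma tens_in_deg: "\<lbrakk>a \<in> piece R p; b \<in> piece R q; p + q = n\<rbrakk> \<Longrightarrow> tens a b \<in> tens_deg R n"
  unfolding tens_deg_def by (rule ps.span_base) blast

lemma tdif_deg: "t \<in> tens_deg R n \<Longrightarrow> tens_dif R t \<in> tens_deg R (n - 1)"
proof (rule span_linear_mem[OF tdif.linear_axioms tens_deg_subspace])
  assume "t \<in> tens_deg R n"
  then show "t \<in> ps.span {tens a b | a b p q. a \<in> piece R p \<and> b \<in> piece R q \<and> p + q = n}"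
    by (simp add: tens_deg_def)
  fix x :: "('k, 'r) tensors" assume "x \<in> {tens a b | a b p q. a \<in> piece R p \<and> b \<in> piece R q \<and> p + q = n}"
  then obtain a b p q where x: "x = tens a b" "a \<in> piece R p" "b \<in> piece R q" "p + q = n" by blast
  have "tens (dif R a) b \<in> tens_deg R (n - 1)" "tens (parity R a) (dif R b) \<in> tens_deg R (n - 1)"
    using tens_in_deg[OF dif_piece[OF x(2)] x(3)] tens_in_deg[OF parity_piece[OF x(2)] dif_piece[OF x(3)]] x(4)
    by (simp_all add: algebra_simps)
  then show "tens_dif R x \<in> tens_deg R (n - 1)"
    by (simp add: x(1) tdif_tens ps.subspace_add[OF tens_deg_subspace])
qed

lemma tmult_tdif: "tens_mult R (tens_dif R t) = dif R (tens_mult R t)"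
  by (rule span_linear_eq[OF _ _ span_tens[of t]])
    (auto intro!: linearI vs vector_space_pscale simp: tdif.add tdif.scale tmult.add tmult.scale d.add d.scale
      tdif_tens tmult_tens dif_mult)

lemma beta_tdif: "beta R (tens_dif R t) = dif R (beta R t)"
  by (rule span_linear_eq[OF _ _ span_tens[of t]])
    (auto intro!: linearI vs vector_space_pscale simp: tdif.add tdif.scale beta.add beta.scale d.add d.scale
      tdif_tens beta_tens dif_commutator)

lemma beta_tensor_null: "t \<in> tensor_null (scal R) \<Longrightarrow> beta R t = 0"
  using bilinear_tensor_null[OF vs V.subspace_single_0, of "commutator R" "scal R" t]
  by (simp add: beta_def commutator_add commutator_scale)

lemma beta_deg: "t \<in> tens_deg R n \<Longrightarrow> beta R t \<in> piece R n"
  by (rule span_linear_mem[OF beta.linear_axioms piece_subspace])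
    (auto simp: tens_deg_def beta_tens intro: commutator_piece)

abbreviation \<tau> :: "('k, 'r) tensors \<Rightarrow> ('k, 'r) tensors" where "\<tau> \<equiv> mod_out (tensor_null (scal R))"

sublocale tau: tensor_projection "scal R" \<tau>
  by (rule tensor_projection_mod_out[OF vs subspace_tensor_null order_refl])

lemma tau_ker: "\<tau> t = 0 \<longleftrightarrow> t \<in> tensor_null (scal R)"
  by (rule mod_out[OF subspace_tensor_null])

lemma tdif_tdif: "tens_dif R (tens_dif R t) \<in> tensor_null (scal R)"
proof -
  have "\<tau> (tens_dif R (tens_dif R t)) = 0"
    by (rule span_linear_eq[OF _ _ span_tens[of t], where G = "\<lambda>_. 0"])
      (auto intro!: linearI vector_space_pscale
        simp: tdif.add tdif.scale tdif_tens tau.tens_simps dif_dif dif_parity parity_parity)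
  then show ?thesis by (simp add: tau_ker)
qed

lemma tdif_tensor_null:
  assumes "t \<in> tensor_null (scal R)" shows "tens_dif R t \<in> tensor_null (scal R)"
proof -
  show ?thesis
    unfolding tens_dif_def
    by (rule bilinear_tensor_null[OF vector_space_pscale subspace_tensor_null _ _ _ _ assms])
      (simp_all add: tau_ker[symmetric] tau.tens_simps d.add d.scale parity_add parity_scale algebra_simps)
qed

lemma tdif_lact:
  assumes x: "x \<in> piece R m"
  shows "tens_dif R (lact x t) - (lact (dif R x) t + pscale (ksign m) (lact x (tens_dif R t))) \<in> tensor_null (scal R)"
proof -
  have "\<tau> (tens_dif R (lact x t)) = \<tau> (lact (dif R x) t + pscale (ksign m) (lact x (tens_dif R t)))"
  proof (rule span_linear_eq[OF _ _ span_tens[of t]])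
    fix t' :: "('k, 'r) tensors" assume "t' \<in> {tens a b | a b. True}"
    then obtain a b where "t' = tens a b" by blast
    then show "\<tau> (tens_dif R (lact x t')) = \<tau> (lact (dif R x) t' + pscale (ksign m) (lact x (tens_dif R t')))"
      by (cases "even m") (simp_all add: lact_simps tdif_tens tau.tens_simps leibniz[OF x] parity_mult parity_homog[OF x])
  qed (auto intro!: linearI vector_space_pscale simp: lact_simps tdif.add tdif.scale tau.tens_simps
      ps.scale_right_distrib ps.scale_left_commute)
  then have "\<tau> (tens_dif R (lact x t) - (lact (dif R x) t + pscale (ksign m) (lact x (tens_dif R t)))) = 0"
    by (simp add: tau.\<pi>.diff)
  then show ?thesis by (simp only: tau_ker)
qed

lemma tdif_ract:
  assumes t: "t \<in> tens_deg R n"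
  shows "tens_dif R (ract t x) - (ract (tens_dif R t) x + pscale (ksign n) (ract t (dif R x))) \<in> tensor_null (scal R)"
proof -
  have "\<tau> (tens_dif R (ract t x)) = \<tau> (ract (tens_dif R t) x + pscale (ksign n) (ract t (dif R x)))"
  proof (rule span_linear_eq[OF _ _ t[unfolded tens_deg_def]])
    fix t' :: "('k, 'r) tensors" assume "t' \<in> {tens a b | a b p q. a \<in> piece R p \<and> b \<in> piece R q \<and> p + q = n}"
    then obtain a b p q where "t' = tens a b" "a \<in> piece R p" "b \<in> piece R q" "p + q = n" by blast
    then show "\<tau> (tens_dif R (ract t' x)) = \<tau> (ract (tens_dif R t') x + pscale (ksign n) (ract t' (dif R x)))"
      by (cases "even p"; cases "even q")
        (auto simp: ract_simps tdif_tens tau.tens_simps leibniz parity_homog)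
  qed (auto intro!: linearI vector_space_pscale simp: ract_simps tdif.add tdif.scale tau.tens_simps
      ps.scale_right_distrib ps.scale_left_commute)
  then have "\<tau> (tens_dif R (ract t x) - (ract (tens_dif R t) x + pscale (ksign n) (ract t (dif R x)))) = 0"
    by (simp add: tau.\<pi>.diff)
  then show ?thesis by (simp only: tau_ker)
qed

text \<open>
  The null part of \<open>\<Omega>\<^sup>1(R)\<^sub>\<natural>\<close>, which is the same in every degree.
\<close>

definition form_null :: "('k, 'r) tensors set" where
  "form_null = ps.span (tensor_null (scal R) \<union>
     {lact x \<omega> - pscale (ksign (m * n)) (ract \<omega> x) | x \<omega> m n. x \<in> piece R m \<and> \<omega> \<in> deg_part (Omega R) n})"

lemma Omega_deg: "t \<in> deg_part (Omega R) n \<longleftrightarrow> t \<in> tens_deg R n \<and> tens_mult R t = 0"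
  by (simp add: Omega_def)

lemma Omega_nat_simps: "deg_part (Omega_nat R) = deg_part (Omega R)" "null_part (Omega_nat R) n = form_null"
  "differential (Omega_nat R) = tens_dif R"
  by (simp_all add: Omega_nat_def form_null_def)

lemma Rbar_simps: "deg_part (Rbar R) = piece R" "null_part (Rbar R) n = V.span {1}" "differential (Rbar R) = dif R"
  by (simp_all add: Rbar_def)

lemma Rbar_nat_simps: "deg_part (Rbar_nat R) = piece R"
  "null_part (Rbar_nat R) n = V.span (insert 1 {commutator R x y | x y. True})" "differential (Rbar_nat R) = dif R"
  by (simp_all add: Rbar_nat_def)

lemma form_null_subspace: "ps.subspace form_null"
  by (simp add: form_null_def ps.subspace_span)

lemma tensor_null_form_null: "tensor_null (scal R) \<subseteq> form_null"
  unfolding form_null_def using ps.span_superset by blast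

lemma form_null_cyclic: "\<lbrakk>x \<in> piece R m; \<omega> \<in> deg_part (Omega R) n\<rbrakk> \<Longrightarrow> lact x \<omega> - pscale (ksign (m * n)) (ract \<omega> x) \<in> form_null"
  unfolding form_null_def by (rule ps.span_base) blast

abbreviation \<nu> :: "('k, 'r) tensors \<Rightarrow> ('k, 'r) tensors" where "\<nu> \<equiv> mod_out form_null"

sublocale nu: tensor_projection "scal R" \<nu>
  by (rule tensor_projection_mod_out[OF vs form_null_subspace tensor_null_form_null])

lemma nu_ker: "\<nu> t = 0 \<longleftrightarrow> t \<in> form_null"
  by (rule mod_out[OF form_null_subspace])

lemma Omega_subspace: "ps.subspace (deg_part (Omega R) n)"
  unfolding ps.subspace_def
  using ps.subspace_0[OF tens_deg_subspace] ps.subspace_add[OF tens_deg_subspace] ps.subspace_scale[OF tens_deg_subspace]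
  by (auto simp: Omega_deg tmult.add tmult.scale tmult.zero)

lemma tdif_Omega: "\<omega> \<in> deg_part (Omega R) n \<Longrightarrow> tens_dif R \<omega> \<in> deg_part (Omega R) (n - 1)"
  by (simp add: Omega_deg tdif_deg tmult_tdif d.zero)

text \<open>
  By the Leibniz rule, \<open>d [x, \<omega>] = [d x, \<omega>] \<plusminus> [x, d \<omega>]\<close>.
\<close>

lemma tdif_form_null:
  assumes "t \<in> form_null" shows "tens_dif R t \<in> form_null"
proof (rule span_linear_mem[OF tdif.linear_axioms form_null_subspace assms[unfolded form_null_def]])
  fix t assume "t \<in> tensor_null (scal R) \<union>
     {lact x \<omega> - pscale (ksign (m * n)) (ract \<omega> x) | x \<omega> m n. x \<in> piece R m \<and> \<omega> \<in> deg_part (Omega R) n}"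
  then show "tens_dif R t \<in> form_null"
  proof
    assume "t \<in> tensor_null (scal R)"
    then show ?thesis using tdif_tensor_null tensor_null_form_null by blast
  next
    assume "t \<in> {lact x \<omega> - pscale (ksign (m * n)) (ract \<omega> x) | x \<omega> m n. x \<in> piece R m \<and> \<omega> \<in> deg_part (Omega R) n}"
    then obtain x \<omega> m n where t: "t = lact x \<omega> - pscale (ksign (m * n)) (ract \<omega> x)"
      and x: "x \<in> piece R m" and w: "\<omega> \<in> deg_part (Omega R) n" by blast
    have wd: "\<omega> \<in> tens_deg R n" using w by (simp add: Omega_deg)
    have 1: "\<nu> (tens_dif R (lact x \<omega>)) = \<nu> (lact (dif R x) \<omega>) + pscale (ksign m) (\<nu> (lact x (tens_dif R \<omega>)))"
      using subsetD[OF tensor_null_form_null tdif_lact[OF x, of \<omega>]] by (simp add: nu_ker[symmetric] nu.tens_simps)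
    have 2: "\<nu> (tens_dif R (ract \<omega> x)) = \<nu> (ract (tens_dif R \<omega>) x) + pscale (ksign n) (\<nu> (ract \<omega> (dif R x)))"
      using subsetD[OF tensor_null_form_null tdif_ract[OF wd, of x]] by (simp add: nu_ker[symmetric] nu.tens_simps)
    have 3: "\<nu> (lact (dif R x) \<omega>) = pscale (ksign ((m - 1) * n)) (\<nu> (ract \<omega> (dif R x)))"
      using form_null_cyclic[OF dif_piece[OF x] w] by (simp add: nu_ker[symmetric] nu.tens_simps)
    have 4: "\<nu> (lact x (tens_dif R \<omega>)) = pscale (ksign (m * (n - 1))) (\<nu> (ract (tens_dif R \<omega>) x))"
      using form_null_cyclic[OF x tdif_Omega[OF w]] by (simp add: nu_ker[symmetric] nu.tens_simps)
    have "\<nu> (tens_dif R t) = 0"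
      unfolding t tdif.diff tdif.scale nu.\<pi>.diff nu.\<pi>.scale 1 2 3 4
      by (cases "even m"; cases "even n") (simp_all add: ps.scale_right_distrib)
    then show ?thesis by (simp only: nu_ker)
  qed
qed

text \<open>
  For \<open>\<omega> = \<Sum> a \<otimes> b\<close> one has \<open>[x a, b] - (\<plusminus>) [a, b x] = x a b - (\<plusminus>) a b x\<close>, where the terms \<open>b x a\<close>
  cancel. On \<open>\<Omega>\<^sup>1(R)\<close> the sum \<open>\<Sum> a b\<close> is zero, so \<open>\<beta>\<close> vanishes on \<open>[R, \<Omega>\<^sup>1(R)]\<close>.
\<close>

lemma beta_cyclic:
  assumes x: "x \<in> piece R m" and w: "\<omega> \<in> tens_deg R n"
  shows "beta R (lact x \<omega> - pscale (ksign (m * n)) (ract \<omega> x))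
    = x * tens_mult R \<omega> - scal R (ksign (m * n)) (tens_mult R \<omega> * x)"
proof (rule span_linear_eq[OF _ _ w[unfolded tens_deg_def]])
  fix t' :: "('k, 'r) tensors" assume "t' \<in> {tens a b | a b p q. a \<in> piece R p \<and> b \<in> piece R q \<and> p + q = n}"
  then obtain a b p q where t: "t' = tens a b" and a: "a \<in> piece R p" and b: "b \<in> piece R q" and n: "n = p + q" by blast
  show "beta R (lact x t' - pscale (ksign (m * n)) (ract t' x)) = x * tens_mult R t' - scal R (ksign (m * n)) (tens_mult R t' * x)"
    using commutator_homog[OF mult_piece[OF x a] b] commutator_homog[OF a mult_piece[OF b x]]
    by (cases "even m"; cases "even p"; cases "even q")
      (simp_all add: t n lact_simps ract_simps beta.diff beta.neg beta.add beta.scale beta_tens tmult_tens mult.assoc)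
qed (auto intro!: linearI vector_space_pscale vs simp: lact_simps ract_simps beta.add beta.diff beta.scale tmult.add tmult.scale
      ps.scale_right_distrib ps.scale_left_commute V.scale_right_distrib V.scale_left_commute V.scale_right_diff_distrib distrib_left distrib_right)

lemma beta_form_null: assumes "t \<in> form_null" shows "beta R t = 0"
proof -
  have "beta R t \<in> {0}"
    by (rule span_linear_mem[OF beta.linear_axioms V.subspace_single_0 assms[unfolded form_null_def]])
      (auto simp: beta_tensor_null beta_cyclic Omega_deg)
  then show ?thesis by simp
qed

lemma dif_span_one: "x \<in> V.span {1} \<Longrightarrow> dif R x \<in> V.span {1}"
  by (rule span_linear_mem[OF dif_linear]) (auto simp: dif_one V.span_zero)

lemma chain_complex_Rbar: "chain_complex (Rbar R)"
  by (rule linear_chain_complex[OF vs])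
    (simp_all add: Rbar_simps dif_linear piece_subspace dif_piece dif_span_one dif_dif V.span_zero)

lemma chain_complex_Rbar_nat: "chain_complex (Rbar_nat R)"
proof (rule linear_chain_complex[OF vs], unfold Rbar_nat_simps)
  fix x assume x: "x \<in> V.span (insert 1 {commutator R x y | x y. True})"
  show "dif R x \<in> V.span (insert 1 {commutator R x y | x y. True})"
  proof (rule span_linear_mem[OF dif_linear _ x])
    fix y assume "y \<in> insert 1 {commutator R x y | x y. True}"
    then consider "y = 1" | a b where "y = commutator R a b" by blast
    then show "dif R y \<in> V.span (insert 1 {commutator R x y | x y. True})"
    proof cases
      case 2 then show ?thesis unfolding 2 dif_commutator by (intro V.span_add V.span_base) auto
    qed (simp add: dif_one V.span_zero)
  qed (rule V.subspace_span)
qed (simp_all add: dif_linear piece_subspace dif_piece dif_dif V.span_zero)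

lemma chain_complex_Omega_nat: "chain_complex (Omega_nat R)"
  by (rule linear_chain_complex[OF vector_space_pscale])
    (simp_all add: Omega_nat_simps tdif.linear_axioms Omega_subspace form_null_subspace tdif_Omega tdif_form_null
      subsetD[OF tensor_null_form_null tdif_tdif])

lemma beta_chain_map: "chain_map (Omega_nat R) (Rbar R) (beta R)"
  by (rule linear_chain_mapI[OF beta.linear_axioms])
    (simp_all add: Omega_nat_simps Rbar_simps Omega_deg beta_deg beta_form_null beta_tdif V.span_zero)

lemma univ_der_deg: "x \<in> piece R n \<Longrightarrow> univ_der x \<in> deg_part (Omega R) n"
  unfolding Omega_deg univ_der_def
  using tens_in_deg[OF one_piece, of x n n] tens_in_deg[OF _ one_piece, of x n n]
  by (simp add: ps.subspace_diff[OF tens_deg_subspace] tmult.diff tmult_tens)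

lemma beta_univ_der: "beta R (univ_der x) = 0"
  by (simp add: univ_der_def beta.diff beta_tens commutator_one)

lemma univ_der_mult: "univ_der (x * y) = lact x (univ_der y) + (ract (univ_der x) y :: ('k, 'r) tensors)"
  by (simp add: univ_der_def lact_simps ract_simps)

text \<open>
  \<open>\<partial>[x, y] = [x, \<partial>y] \<plusminus> [y, \<partial>x]\<close>.
\<close>

lemma univ_der_commutator: "univ_der (commutator R x y) \<in> form_null"
proof -
  have add: "\<nu> (univ_der (x + y)) = \<nu> (univ_der x) + \<nu> (univ_der y)"
   and diff: "\<nu> (univ_der (x - y)) = \<nu> (univ_der x) - \<nu> (univ_der y)"
   and neg: "\<nu> (univ_der (- x)) = - \<nu> (univ_der x)" for x y
    by (simp_all add: univ_der_def nu.tens_simps)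
  have "\<nu> (univ_der (commutator R x y)) = 0"
  proof (induction x rule: homogeneous_induct)
    case x: (homogeneous m x)
    show ?case
    proof (induction y rule: homogeneous_induct)
      case y: (homogeneous n y)
      have 1: "\<nu> (lact x (univ_der y)) = pscale (ksign (m * n)) (\<nu> (ract (univ_der y) x))"
        using form_null_cyclic[OF x univ_der_deg[OF y]] by (simp add: nu_ker[symmetric] nu.tens_simps)
      have 2: "\<nu> (lact y (univ_der x)) = pscale (ksign (n * m)) (\<nu> (ract (univ_der x) y))"
        using form_null_cyclic[OF y univ_der_deg[OF x]] by (simp add: nu_ker[symmetric] nu.tens_simps)
      show ?case
        unfolding commutator_homog[OF x y] diff
        by (cases "even m"; cases "even n") (simp_all add: neg univ_der_mult nu.tens_simps 1 2)
    qed (simp add: commutator_add add)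
  qed (simp add: commutator_add add)
  then show ?thesis by (simp only: nu_ker)
qed

lemma univ_der_null:
  assumes "x \<in> V.span (insert 1 {commutator R x y | x y. True})" shows "univ_der x \<in> form_null"
proof -
  have "\<nu> (univ_der x) \<in> {0}"
  proof (rule span_linear_mem[OF _ ps.subspace_single_0 assms])
    show "Vector_Spaces.linear (scal R) pscale (\<lambda>x. \<nu> (univ_der x))"
      by (rule linearI) (simp_all add: vs vector_space_pscale univ_der_def nu.tens_simps ps.scale_right_diff_distrib)
    fix y assume "y \<in> insert 1 {commutator R x y | x y. True}"
    then show "\<nu> (univ_der y) \<in> {0}"
      using univ_der_commutator by (auto simp: nu_ker) (simp add: univ_der_def ps.subspace_0[OF form_null_subspace])
  qed
  then show ?thesis by (simp add: nu_ker)
qed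

lemma univ_der_chain_map: "chain_map (Rbar R) (Omega_nat R) univ_der"
proof -
  have 1: "univ_der (x - y) - (univ_der x - univ_der y) \<in> form_null" for x y
    by (simp add: nu_ker[symmetric] nu.tens_simps univ_der_def)
  have 2: "univ_der (dif R x) - tens_dif R (univ_der x) \<in> form_null" for x
    by (simp add: nu_ker[symmetric] nu.tens_simps univ_der_def tdif.diff tdif_tens dif_one parity_one)
  have 3: "univ_der x \<in> form_null" if "x \<in> V.span {1}" for x
    by (rule univ_der_null) (use that V.span_mono[of "{1}" "insert 1 _"] in blast)
  show ?thesis
    unfolding chain_map_def graded_map_def Rbar_simps Omega_nat_simps using 1 2 3 univ_der_deg by auto
qed

lemma univ_der_beta:
  assumes w: "\<omega> \<in> deg_part (Omega R) n" shows "univ_der (beta R \<omega>) \<in> form_null"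
proof (rule univ_der_null, rule span_linear_mem[OF beta.linear_axioms V.subspace_span span_tens])
  fix x :: "('k, 'r) tensors" assume "x \<in> {tens a b | a b. True}"
  then obtain a b where x: "x = tens a b" by blast
  show "beta R x \<in> V.span (insert 1 {commutator R x y | x y. True})"
    unfolding x beta_tens by (rule V.span_base) blast
qed

lemma periodic_Xplus: "periodic (Rbar R) (Omega_nat R) (beta R) univ_der"
  unfolding periodic_def
  using beta_chain_map univ_der_chain_map chain_complex_Rbar chain_complex_Omega_nat univ_der_beta
  by (auto simp: Rbar_simps Omega_nat_simps beta_univ_der V.span_zero)

lemma commutator_component:
  obtains \<omega> where "\<omega> \<in> deg_part (Omega R) n" "component R (commutator R x y) n = beta R \<omega>"
proof -
  have "\<exists>\<omega> \<in> deg_part (Omega R) n. component R (commutator R x y) n = beta R \<omega>"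
  proof (induction x rule: homogeneous_induct)
    case x: (homogeneous p x)
    show ?case
    proof (induction y rule: homogeneous_induct)
      case y: (homogeneous q y)
      show ?case
      proof (cases "p + q = n")
        case True
        have "tens x y - tens (x * y) 1 \<in> deg_part (Omega R) n"
          using tens_in_deg[OF x y True] tens_in_deg[OF mult_piece[OF x y] one_piece, of n] True
          by (simp add: Omega_deg ps.subspace_diff[OF tens_deg_subspace] tmult.diff tmult_tens)
        moreover have "component R (commutator R x y) n = beta R (tens x y - tens (x * y) 1)"
          using component_homogeneous[OF commutator_piece[OF x y]] True
          by (simp add: beta.diff beta_tens commutator_one)
        ultimately show ?thesis by blast
      next
        case False
        then have "component R (commutator R x y) n = beta R 0"
          using component_homogeneous[OF commutator_piece[OF x y]] by (simp add: beta.zero)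
        then show ?thesis using ps.subspace_0[OF Omega_subspace] by blast
      qed
    next
      case (add y z)
      then show ?case
        using ps.subspace_add[OF Omega_subspace] by (auto simp: commutator_add component_add beta.add[symmetric])
    qed
  next
    case (add y z)
    then show ?case
      using ps.subspace_add[OF Omega_subspace] by (auto simp: commutator_add component_add beta.add[symmetric])
  qed
  then show thesis using that by blast
qed

text \<open>
  An element of degree \<open>n\<close> in \<open>k + [R, R]\<close> is a sum of commutators of arbitrary, inhomogeneous elements.
  Taking components of degree \<open>n\<close> makes it a multiple of \<open>1\<close> plus commutators of homogeneous elements of
  total degree \<open>n\<close>, and \<open>[x, y] = \<beta>(x \<partial>y)\<close>.
\<close>

lemma image_beta:
  assumes x: "x \<in> piece R n" and null: "x \<in> V.span (insert 1 {commutator R x y | x y. True})"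
  shows "\<exists>\<omega> \<in> deg_part (Omega R) n. x - beta R \<omega> \<in> V.span {1}"
proof -
  have "\<exists>\<omega> \<in> deg_part (Omega R) n. component R x n - beta R \<omega> \<in> V.span {1}"
    using null
  proof (induction rule: V.span_induct_alt)
    case base
    have "component R 0 n - beta R 0 \<in> V.span {1}"
      using component_homogeneous[OF piece_zero, of 0] by (simp add: beta.zero V.span_zero)
    then show ?case using ps.subspace_0[OF Omega_subspace] by blast
  next
    case (step c y z)
    then obtain \<omega> where w: "\<omega> \<in> deg_part (Omega R) n" "component R z n - beta R \<omega> \<in> V.span {1}" by blast
    obtain \<theta> where t: "\<theta> \<in> deg_part (Omega R) n" "component R y n - beta R \<theta> \<in> V.span {1}"
    proof (cases "y = 1")
      case True
      then have "component R y n - beta R 0 \<in> V.span {1}"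
        using component_homogeneous[OF one_piece] by (simp add: beta.zero V.span_zero V.span_base)
      then show thesis using that ps.subspace_0[OF Omega_subspace] by blast
    next
      case False
      then obtain a b where y: "y = commutator R a b" using step by blast
      obtain \<theta> where "\<theta> \<in> deg_part (Omega R) n" "component R y n = beta R \<theta>"
        unfolding y by (rule commutator_component)
      then show thesis using that[of \<theta>] V.span_zero by simp
    qed
    have "component R (scal R c y + z) n - beta R (pscale c \<theta> + \<omega>)
        = scal R c (component R y n - beta R \<theta>) + (component R z n - beta R \<omega>)"
      by (simp add: component_add component_scale beta.add beta.scale V.scale_right_diff_distrib)
    also have "\<dots> \<in> V.span {1}" by (intro V.span_add V.span_scale t w)
    finally show ?case
      using ps.subspace_add[OF Omega_subspace ps.subspace_scale[OF Omega_subspace t(1)] w(1)] by blast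
  qed
  then show ?thesis using component_homogeneous[OF x] by simp
qed

end

section \<open>Eigenvalues of Euler operators\<close>

text \<open>
  Eigenvectors for different eigenvalues are independent, modulo an invariant subspace \<open>I\<close>.
\<close>

lemma eigen_components:
  fixes s :: "'k::field_char_0 \<Rightarrow> 'c::ab_group_add \<Rightarrow> 'c"
  assumes lin: "Vector_Spaces.linear s s T" and I: "module.subspace s I"
    and TI: "\<And>v. v \<in> I \<Longrightarrow> T v \<in> I" and S: "finite S"
    and f: "\<And>m. m \<in> S \<Longrightarrow> T (f m) - s (of_nat m) (f m) \<in> I" and total: "(\<Sum>m\<in>S. f m) \<in> I"
  shows "\<forall>m\<in>S. f m \<in> I"
  using S f total
proof (induction S arbitrary: f)
  interpret Vector_Spaces.linear s s T by fact
  case (insert n S)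
  have comm: "T (s c v) - s (of_nat m) (s c v) = s c (T v - s (of_nat m) v)" for c v m
    by (simp add: scale vs1.scale_right_diff_distrib mult.commute)
  have 1: "(\<Sum>m\<in>insert n S. T (f m) - s (of_nat m) (f m)) \<in> I"
    using insert.prems(1) by (intro vs1.subspace_sum[OF I]) blast
  have "T (\<Sum>m\<in>insert n S. f m) - (\<Sum>m\<in>insert n S. T (f m) - s (of_nat m) (f m))
      = (\<Sum>m\<in>insert n S. s (of_nat m) (f m))"
    unfolding sum sum_subtractf by (simp del: sum.insert)
  then have "(\<Sum>m\<in>insert n S. s (of_nat m) (f m)) \<in> I"
    using vs1.subspace_diff[OF I TI[OF insert.prems(2)] 1] by metis
  from vs1.subspace_diff[OF I this vs1.subspace_scale[OF I insert.prems(2)]]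
  have "(\<Sum>m\<in>insert n S. s (of_nat m) (f m)) - s (of_nat n) (\<Sum>m\<in>insert n S. f m) \<in> I" .
  also have "(\<Sum>m\<in>insert n S. s (of_nat m) (f m)) - s (of_nat n) (\<Sum>m\<in>insert n S. f m)
      = (\<Sum>m\<in>S. s (of_nat m - of_nat n) (f m))"
    using insert(1,2) by (simp add: vs1.scale_left_diff_distrib sum_subtractf vs1.scale_sum_right vs1.scale_right_distrib)
  finally have "\<forall>m\<in>S. s (of_nat m - of_nat n) (f m) \<in> I"
  proof (intro insert.IH)
    fix m assume "m \<in> S"
    then show "T (s (of_nat m - of_nat n) (f m)) - s (of_nat m) (s (of_nat m - of_nat n) (f m)) \<in> I"
      unfolding comm by (intro vs1.subspace_scale[OF I] insert.prems(1)) simp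
  qed
  then have "f m \<in> I" if "m \<in> S" for m
    using vs1.subspace_scale[OF I, of "s (of_nat m - of_nat n) (f m)" "inverse (of_nat m - of_nat n)"] that insert(2)
    by (cases "m = n") auto
  moreover from this have "f n \<in> I"
    using insert(1,2,5) vs1.subspace_diff[OF I _ vs1.subspace_sum[OF I], of _ S f] by fastforce
  ultimately show ?case by simp
qed simp

text \<open>
  If the space is spanned modulo \<open>I\<close> by a vector \<open>u\<close> of weight \<open>0\<close> and by eigenvectors of positive integral
  weight, then \<open>T\<close> is injective modulo \<open>I\<close> up to multiples of \<open>u\<close>. This is applied with \<open>u = 1\<close> to \<open>R\<close>
  modulo commutators and to \<open>R\<^sub>V\<close>.
\<close>

lemma kernel_of_euler_operator:
  fixes s :: "'k::field_char_0 \<Rightarrow> 'c::ab_group_add \<Rightarrow> 'c"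
  assumes lin: "Vector_Spaces.linear s s T" and I: "module.subspace s I"
    and TI: "\<And>v. v \<in> I \<Longrightarrow> T v \<in> I" and Tu: "T u \<in> I"
    and x: "x \<in> module.span s (insert u (I \<union> {v. \<exists>m>0. T v - s (of_nat m) v \<in> I}))" and Tx: "T x \<in> I"
  shows "x \<in> module.span s (insert u I)"
proof -
  interpret Vector_Spaces.linear s s T by fact
  define W where "W m = (if m = 0 then vs1.span (insert u I) else {v. T v - s (of_nat m) v \<in> I})" for m
  have T0: "T v \<in> I" if "v \<in> vs1.span (insert u I)" for v
    by (rule span_linear_mem[OF lin I that]) (use TI Tu in auto)
  have "vs1.subspace {v. T v - s (of_nat m) v \<in> I}" for m
  proof -
    have *: "T (v + w) - s (of_nat m) (v + w) = (T v - s (of_nat m) v) + (T w - s (of_nat m) w)"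
      "T (s c v) - s (of_nat m) (s c v) = s c (T v - s (of_nat m) v)" for v w c
      by (simp_all add: add scale vs1.scale_right_diff_distrib vs1.scale_right_distrib mult.commute)
    show ?thesis
      unfolding vs1.subspace_def mem_Collect_eq *
      using vs1.subspace_0[OF I] vs1.subspace_add[OF I] vs1.subspace_scale[OF I] by (auto simp: zero)
  qed
  then have W: "vs1.subspace (W m)" for m by (simp add: W_def vs1.subspace_span)
  have WT: "T v - s (of_nat m) v \<in> I" if "v \<in> W m" for v m
    using that T0 by (auto simp: W_def split: if_splits)
  have "\<exists>f N. (\<forall>m. f m \<in> W m) \<and> (\<forall>m\<ge>N. f m = 0) \<and> x = (\<Sum>m<N. f m)"
    using x
  proof (induction rule: vs1.span_induct_alt)
    case base
    have "(\<forall>m. (\<lambda>_. 0) m \<in> W m) \<and> (\<forall>m\<ge>(0::nat). (\<lambda>_. 0) m = 0) \<and> 0 = (\<Sum>m<0. (\<lambda>_. 0) m)"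
      using vs1.subspace_0[OF W] by simp
    then show ?case by (intro exI[of _ "\<lambda>_. 0"] exI[of _ 0])
  next
    case (step c y z)
    then obtain f N where f: "\<And>m. f m \<in> W m" "\<And>m. N \<le> m \<Longrightarrow> f m = 0" "z = (\<Sum>m<N. f m)" by blast
    obtain k where k: "y \<in> W k"
    proof -
      consider "y = u" | "y \<in> I" | m where "m > 0" "T y - s (of_nat m) y \<in> I" using step(1) by blast
      then show thesis
      proof cases
        case 1 then show ?thesis using that[of 0] by (simp add: W_def vs1.span_base)
      next
        case 2 then show ?thesis using that[of 0] by (simp add: W_def vs1.span_base)
      next
        case 3 then show ?thesis using that[of m] by (simp add: W_def)
      qed
    qed
    define g where "g m = f m + (if m = k then s c y else 0)" for m
    let ?M = "max N (Suc k)"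
    have "(\<Sum>m<N. f m) = (\<Sum>m<?M. f m)" using f(2) by (intro sum.mono_neutral_left) auto
    then have "s c y + z = (\<Sum>m<?M. g m)" by (simp add: g_def f(3) sum.distrib add.commute less_max_iff_disj)
    moreover have "g m \<in> W m" for m
      using f(1) k vs1.subspace_add[OF W] vs1.subspace_scale[OF W] by (simp add: g_def)
    moreover have "g m = 0" if "?M \<le> m" for m using that f(2) by (simp add: g_def)
    ultimately show ?case by blast
  qed
  then obtain f N where f: "\<And>m. f m \<in> W m" "x = (\<Sum>m<N. f m)" by blast
  have 1: "(\<Sum>m<N. T (f m) - s (of_nat m) (f m)) \<in> I" using WT f(1) by (intro vs1.subspace_sum[OF I]) auto
  have "(\<Sum>m<N. s (of_nat m) (f m)) \<in> I"
    using vs1.subspace_diff[OF I Tx 1] by (simp add: f(2) sum sum_subtractf)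
  moreover have "T (s (of_nat m) (f m)) - s (of_nat m) (s (of_nat m) (f m)) \<in> I" for m
  proof -
    have "T (s (of_nat m) (f m)) - s (of_nat m) (s (of_nat m) (f m)) = s (of_nat m) (T (f m) - s (of_nat m) (f m))"
      by (simp add: scale vs1.scale_right_diff_distrib)
    then show ?thesis using vs1.subspace_scale[OF I WT[OF f(1)]] by simp
  qed
  ultimately have *: "\<forall>m\<in>{..<N}. s (of_nat m) (f m) \<in> I"
    using eigen_components[OF lin I TI finite_lessThan, of N "\<lambda>m. s (of_nat m) (f m)"] by blast
  have "f m \<in> vs1.span (insert u I)" if "m < N" for m
  proof (cases "m = 0")
    case True then show ?thesis using f(1)[of 0] by (simp add: W_def)
  next
    case False
    then have "f m \<in> I" using vs1.subspace_scale[OF I, of "s (of_nat m) (f m)" "inverse (of_nat m)"] * that by auto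
    then show ?thesis by (simp add: vs1.span_base)
  qed
  then show ?thesis unfolding f(2) by (intro vs1.span_sum) auto
qed

section \<open>Free graded algebras\<close>

locale free_dga = dga R for R :: "('k::field_char_0, 'r::ring_1) dg_alg" +
  fixes X :: "'r set"
  assumes generators_homogeneous: "X \<subseteq> (\<Union>n. piece R n)"
    and inj_words: "inj_on prod_list (lists X)"
    and independent_words: "\<not> V.dependent (prod_list ` lists X)"
    and span_words: "V.span (prod_list ` lists X) = UNIV"
begin

definition gdeg :: "'r \<Rightarrow> int" where "gdeg x = (SOME n. x \<in> piece R n)"

definition wdeg :: "'r list \<Rightarrow> int" where "wdeg w = sum_list (map gdeg w)"

lemma wdeg_simps [simp]: "wdeg [] = 0" "wdeg (x # w) = gdeg x + wdeg w" "wdeg (v @ w) = wdeg v + wdeg w"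
  by (simp_all add: wdeg_def)

lemma gdeg:
  assumes "x \<in> X" shows "x \<in> piece R (gdeg x)"
proof -
  obtain n where "x \<in> piece R n" using assms generators_homogeneous by blast
  then show ?thesis unfolding gdeg_def by (rule someI)
qed

lemma word_piece: "w \<in> lists X \<Longrightarrow> prod_list w \<in> piece R (wdeg w)"
  by (induction w) (auto intro: one_piece mult_piece gdeg)

lemma word_induct [case_names word zero add scale]:
  assumes "\<And>w. w \<in> lists X \<Longrightarrow> P (prod_list w)" "P 0" "\<And>x y. P x \<Longrightarrow> P y \<Longrightarrow> P (x + y)" "\<And>c x. P x \<Longrightarrow> P (scal R c x)"
  shows "P x"
proof -
  have "x \<in> V.span (prod_list ` lists X)" by (simp add: span_words)
  then show ?thesis
  proof (induction rule: V.span_induct_alt)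
    case (step c y z)
    then obtain w where "y = prod_list w" "w \<in> lists X" by blast
    then show ?case using assms(3)[OF assms(4)[OF assms(1)] step(2)] by simp
  qed (rule assms(2))
qed

lemma piece_span:
  assumes "x \<in> piece R n" shows "x \<in> V.span {prod_list w | w. w \<in> lists X \<and> wdeg w = n}"
proof -
  have "component R x n \<in> V.span {prod_list w | w. w \<in> lists X \<and> wdeg w = n}"
  proof (induction x rule: word_induct)
    case (word w)
    show ?case
    proof (cases "wdeg w = n")
      case True
      then show ?thesis using component_homogeneous[OF word_piece[OF word]] word
        by (auto intro!: V.span_base)
    next
      case False
      then show ?thesis using component_homogeneous[OF word_piece[OF word]] by (simp add: V.span_zero)
    qed
  next
    case zero
    then show ?case using component_homogeneous[OF piece_zero] by (simp add: V.span_zero)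
  qed (simp_all add: component_add component_scale V.span_add V.span_scale)
  then show ?thesis using component_homogeneous[OF assms] by simp
qed

text \<open>
  The derivation that is the identity on the generators \<open>X\<close>; it multiplies a word by its length.
\<close>

definition euler :: "'r \<Rightarrow> 'r" where
  "euler = (SOME E. Vector_Spaces.linear (scal R) (scal R) E \<and>
     (\<forall>w \<in> lists X. E (prod_list w) = scal R (of_nat (length w)) (prod_list w)))"

lemma euler_properties: "Vector_Spaces.linear (scal R) (scal R) euler"
  "w \<in> lists X \<Longrightarrow> euler (prod_list w) = scal R (of_nat (length w)) (prod_list w)"
proof -
  interpret vector_space_pair "scal R" "scal R" ..
  obtain E where E: "Vector_Spaces.linear (scal R) (scal R) E"
    "\<And>b. b \<in> prod_list ` lists X \<Longrightarrow> E b = scal R (of_nat (length (the_inv_into (lists X) prod_list b))) b"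
    using linear_independent_extend[OF independent_words,
      of "\<lambda>b. scal R (of_nat (length (the_inv_into (lists X) prod_list b))) b"] by blast
  have "E (prod_list w) = scal R (of_nat (length w)) (prod_list w)" if "w \<in> lists X" for w
    using E(2)[of "prod_list w"] that by (simp add: the_inv_into_f_f[OF inj_words])
  with E(1) have "\<exists>E. Vector_Spaces.linear (scal R) (scal R) E \<and>
     (\<forall>w \<in> lists X. E (prod_list w) = scal R (of_nat (length w)) (prod_list w))" by blast
  from someI_ex[OF this, folded euler_def]
  show "Vector_Spaces.linear (scal R) (scal R) euler"
    "w \<in> lists X \<Longrightarrow> euler (prod_list w) = scal R (of_nat (length w)) (prod_list w)" by blast+
qed

lemmas euler_word = euler_properties(2)

sublocale euler: Vector_Spaces.linear "scal R" "scal R" euler by (rule euler_properties(1))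

lemma euler_one: "euler 1 = 0"
  using euler_word[of "[]"] by simp

lemma euler_mult: "euler (x * y) = euler x * y + x * euler y"
proof (induction x rule: word_induct)
  case v: (word v)
  show ?case
  proof (induction y rule: word_induct)
    case w: (word w)
    then have "euler (prod_list (v @ w)) = scal R (of_nat (length v) + of_nat (length w)) (prod_list (v @ w))"
      using euler_word[of "v @ w"] v by simp
    then show ?case by (simp add: euler_word v w V.scale_left_distrib)
  qed (simp_all add: euler.zero euler.add euler.scale distrib_left V.scale_right_distrib)
qed (simp_all add: euler.zero euler.add euler.scale distrib_right V.scale_right_distrib)

lemma euler_piece:
  assumes "x \<in> piece R n" shows "euler x \<in> piece R n"
proof (rule span_linear_mem[OF euler.linear_axioms piece_subspace piece_span[OF assms]])
  fix y assume "y \<in> {prod_list w | w. w \<in> lists X \<and> wdeg w = n}"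
  then obtain w where w: "y = prod_list w" "w \<in> lists X" "wdeg w = n" by blast
  show "euler y \<in> piece R n"
    unfolding w(1) euler_word[OF w(2)] using word_piece[OF w(2)] w(3) by (simp add: piece_scale)
qed

lemma euler_commutator: "euler (commutator R x y) = commutator R (euler x) y + commutator R x (euler y)"
proof (induction x rule: homogeneous_induct)
  case x: (homogeneous m x)
  show ?case
  proof (induction y rule: homogeneous_induct)
    case y: (homogeneous n y)
    show ?case
      unfolding commutator_homog[OF x y] commutator_homog[OF euler_piece[OF x] y] commutator_homog[OF x euler_piece[OF y]]
      by (cases "even (m * n)") (simp_all add: euler.diff euler.add euler_mult)
  qed (simp add: commutator_add euler.add)
qed (simp add: commutator_add euler.add)

abbreviation comms where "comms \<equiv> {commutator R x y | x y. True}"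

lemma euler_comms: "x \<in> V.span comms \<Longrightarrow> euler x \<in> V.span comms"
proof (rule span_linear_mem[OF euler.linear_axioms V.subspace_span])
  fix x assume "x \<in> comms"
  then obtain a b where x: "x = commutator R a b" by blast
  show "euler x \<in> V.span comms"
    unfolding x euler_commutator by (intro V.span_add V.span_base) blast+
qed

text \<open>
  Contraction of forms with the Euler derivation. On \<open>\<Omega>\<^sup>1(R)\<^sub>\<natural>\<close> its values are defined in \<open>R/[R, R]\<close>
  (\<open>contract_form_null\<close>), and \<open>contract (\<partial>x) = euler x\<close>.
\<close>

definition contract :: "('k, 'r) tensors \<Rightarrow> 'r" where "contract = lin_ext (scal R) (\<lambda>(a, b). a * euler b)"

sublocale contract: Vector_Spaces.linear pscale "scal R" contract
  unfolding contract_def by (rule lin_ext_linear[OF vs])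

lemma contract_tens: "contract (tens a b) = a * euler b"
  by (simp add: contract_def lin_ext_tens vs)

lemma contract_deg: "t \<in> tens_deg R n \<Longrightarrow> contract t \<in> piece R n"
  by (rule span_linear_mem[OF contract.linear_axioms piece_subspace])
    (auto simp: tens_deg_def contract_tens intro!: mult_piece euler_piece)

text \<open>
  The last summand appears because \<open>euler\<close> differentiates the factor \<open>x\<close> of \<open>a \<otimes> b x\<close> too; it vanishes on
  \<open>\<Omega>\<^sup>1(R)\<close>.
\<close>

lemma contract_cyclic:
  assumes x: "x \<in> piece R m" and w: "\<omega> \<in> tens_deg R n"
  shows "contract (lact x \<omega> - pscale (ksign (m * n)) (ract \<omega> x))
    = x * contract \<omega> - scal R (ksign (m * n)) (contract \<omega> * x) - scal R (ksign (m * n)) (tens_mult R \<omega> * euler x)"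
proof (rule span_linear_eq[OF _ _ w[unfolded tens_deg_def]])
  fix t' :: "('k, 'r) tensors" assume "t' \<in> {tens a b | a b p q. a \<in> piece R p \<and> b \<in> piece R q \<and> p + q = n}"
  then obtain a b where t: "t' = tens a b" by blast
  show "contract (lact x t' - pscale (ksign (m * n)) (ract t' x))
    = x * contract t' - scal R (ksign (m * n)) (contract t' * x) - scal R (ksign (m * n)) (tens_mult R t' * euler x)"
    by (simp add: t lact_simps ract_simps contract.diff contract.scale contract_tens tmult_tens euler_mult
      distrib_left V.scale_right_distrib mult.assoc)
qed (auto intro!: linearI vector_space_pscale vs simp: lact_simps ract_simps contract.add contract.diff contract.scale tmult.add tmult.scale
      ps.scale_right_distrib ps.scale_left_commute V.scale_right_distrib V.scale_left_commute V.scale_right_diff_distrib distrib_left distrib_right mult.commute[of "ksign _"])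

lemma contract_form_null:
  assumes "t \<in> form_null" shows "contract t \<in> V.span comms"
proof (rule span_linear_mem[OF contract.linear_axioms V.subspace_span assms[unfolded form_null_def]])
  fix t assume "t \<in> tensor_null (scal R) \<union>
     {lact x \<omega> - pscale (ksign (m * n)) (ract \<omega> x) | x \<omega> m n. x \<in> piece R m \<and> \<omega> \<in> deg_part (Omega R) n}"
  then show "contract t \<in> V.span comms"
  proof
    assume "t \<in> tensor_null (scal R)"
    then have "contract t \<in> {0}"
      unfolding contract_def
      by (intro bilinear_tensor_null[OF vs V.subspace_single_0])
        (simp_all add: distrib_left distrib_right euler.add euler.scale)
    then show ?thesis by (simp add: V.span_zero)
  next
    assume "t \<in> {lact x \<omega> - pscale (ksign (m * n)) (ract \<omega> x) | x \<omega> m n. x \<in> piece R m \<and> \<omega> \<in> deg_part (Omega R) n}"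
    then obtain x \<omega> m n where t: "t = lact x \<omega> - pscale (ksign (m * n)) (ract \<omega> x)"
      and x: "x \<in> piece R m" and w: "\<omega> \<in> deg_part (Omega R) n" by blast
    have wd: "\<omega> \<in> tens_deg R n" "tens_mult R \<omega> = 0" using w by (simp_all add: Omega_deg)
    have "contract t = commutator R x (contract \<omega>)"
      unfolding t contract_cyclic[OF x wd(1)] commutator_homog[OF x contract_deg[OF wd(1)]]
      by (simp add: wd(2) ksign_scal)
    then show ?thesis by (auto intro: V.span_base)
  qed
qed

text \<open>
  If \<open>\<partial>x \<equiv> 0\<close>, then \<open>E(x)\<close> is the contraction of a null form, so it lies in \<open>[R, R]\<close>. Since \<open>R\<close> is spanned by
  words, on which \<open>E\<close> is multiplication by the length, the same holds for \<open>x\<close> up to a scalar.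
\<close>

lemma kernel_univ_der:
  assumes "univ_der x \<in> form_null" shows "x \<in> V.span (insert 1 comms)"
proof -
  have "euler x = contract (univ_der x)"
    by (simp add: univ_der_def contract.diff contract_tens euler_one)
  then have Ex: "euler x \<in> V.span comms" using contract_form_null[OF assms] by simp
  have "x \<in> V.span (insert 1 (V.span comms \<union> {v. \<exists>m>0. euler v - scal R (of_nat m) v \<in> V.span comms}))"
  proof (induction x rule: word_induct)
    case (word w)
    show ?case
    proof (cases w)
      case (Cons a v)
      then have "euler (prod_list w) - scal R (of_nat (length w)) (prod_list w) \<in> V.span comms" "0 < length w"
        using euler_word[OF word] by (simp_all add: V.span_zero)
      then show ?thesis by (intro V.span_base) blast
    qed (simp add: V.span_base)
  qed (simp_all add: V.span_zero V.span_add V.span_scale)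
  from kernel_of_euler_operator[OF euler.linear_axioms V.subspace_span euler_comms _ this Ex]
  have "x \<in> V.span (insert 1 (V.span comms))" by (simp add: euler_one V.span_zero)
  moreover have "insert 1 (V.span comms) \<subseteq> V.span (insert 1 comms)"
    using V.span_mono[of comms "insert 1 comms"] V.span_base[of 1 "insert 1 comms"] by blast
  ultimately show ?thesis using V.span_minimal[OF _ V.subspace_span] by blast
qed

end

section \<open>Exactness for a free graded algebra\<close>

context free_dga
begin

text \<open>
  For the kernel of \<open>\<beta>\<close>, elements of \<open>R\<close> are represented by finitely supported functions on words, on which
  operations that depend on the positions of letters can be defined. By freeness, \<open>eval_word\<close> is
  injective on functions supported on words in \<open>X\<close>.
\<close>

definition eval_word :: "('r list \<Rightarrow>\<^sub>0 'k) \<Rightarrow> 'r" where "eval_word = lin_ext (scal R) prod_list"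

sublocale eval: Vector_Spaces.linear pscale "scal R" eval_word
  unfolding eval_word_def by (rule lin_ext_linear[OF vs])

lemma eval_single: "eval_word (Poly_Mapping.single w c) = scal R c (prod_list w)"
  by (simp add: eval_word_def lin_ext_single[OF vs])

lemma eval_inj:
  assumes keys: "Poly_Mapping.keys r \<subseteq> lists X" and r: "eval_word r = 0" shows "r = 0"
proof (rule poly_mapping_eqI)
  fix w
  have inj: "inj_on prod_list (Poly_Mapping.keys r)" using inj_on_subset[OF inj_words keys] .
  define c where "c b = Poly_Mapping.lookup r (the_inv_into (Poly_Mapping.keys r) prod_list b)" for b
  have "(\<Sum>b\<in>prod_list ` Poly_Mapping.keys r. scal R (c b) b) = eval_word r"
    unfolding sum.reindex[OF inj] eval_word_def lin_ext_def
    by (intro sum.cong) (simp_all add: c_def the_inv_into_f_f[OF inj])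
  then have "(\<Sum>b\<in>prod_list ` Poly_Mapping.keys r. scal R (c b) b) = 0" using r by simp
  then have "c b = 0" if "b \<in> prod_list ` Poly_Mapping.keys r" for b
    using V.independentD[OF independent_words, of "prod_list ` Poly_Mapping.keys r" c b] keys that by auto
  then have "Poly_Mapping.lookup r w = 0" if "w \<in> Poly_Mapping.keys r"
    using that by (force simp: c_def the_inv_into_f_f[OF inj])
  then show "Poly_Mapping.lookup r w = Poly_Mapping.lookup 0 w"
    by (cases "w \<in> Poly_Mapping.keys r") (auto simp: in_keys_iff)
qed

text \<open>
  The signed rotation moves the last letter to the front, with the sign of the graded commutator.
\<close>

definition rotate_sign :: "'r list \<Rightarrow> 'k" where "rotate_sign w = ksign (gdeg (last w) * wdeg (butlast w))"

definition rotation :: "('r list \<Rightarrow>\<^sub>0 'k) \<Rightarrow> ('r list \<Rightarrow>\<^sub>0 'k)" where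
  "rotation = lin_ext pscale (\<lambda>w. Poly_Mapping.single (last w # butlast w) (rotate_sign w))"

sublocale rotation: Vector_Spaces.linear pscale pscale rotation
  unfolding rotation_def by (rule lin_ext_linear[OF vector_space_pscale])

lemma rotation_single: "rotation (Poly_Mapping.single w 1) = pscale (rotate_sign w) (Poly_Mapping.single (last w # butlast w) 1)"
  by (simp add: rotation_def lin_ext_single[OF vector_space_pscale] pscale_single)

text \<open>
  For \<open>w = x\<^sub>0 \<dots> x\<^sub>m\<^sub>-\<^sub>1\<close> this is the form \<open>x\<^sub>0 \<dots> x\<^sub>k\<^sub>-\<^sub>1 (\<partial>x\<^sub>k) x\<^sub>k\<^sub>+\<^sub>1 \<dots> x\<^sub>m\<^sub>-\<^sub>1\<close>, so that \<open>\<partial>w\<close> is a telescoping sum.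
\<close>

definition letter_form :: "nat \<Rightarrow> 'r list \<Rightarrow> ('k, 'r) tensors" where
  "letter_form k w = tens (prod_list (take k w)) (prod_list (drop k w))
     - tens (prod_list (take (Suc k) w)) (prod_list (drop (Suc k) w))"

lemma sum_letter_form: "(\<Sum>k<length w. letter_form k w) = univ_der (prod_list w)"
  using sum_lessThan_telescope'[of "\<lambda>k. tens (prod_list (take k w)) (prod_list (drop k w)) :: ('k, 'r) tensors" "length w"]
  by (simp add: letter_form_def univ_der_def)

lemma letter_form_deg:
  assumes w: "w \<in> lists X" and k: "k < length w" shows "letter_form k w \<in> deg_part (Omega R) (wdeg w)"
proof -
  have td: "take j w \<in> lists X" "drop j w \<in> lists X" for j
    using w by (auto dest: in_set_takeD in_set_dropD)
  have "tens (prod_list (take j w)) (prod_list (drop j w)) \<in> tens_deg R (wdeg w)" for j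
    by (rule tens_in_deg[OF word_piece[OF td(1)] word_piece[OF td(2)]]) (metis wdeg_simps(3) append_take_drop_id)
  moreover have "prod_list (take j w) * prod_list (drop j w) = prod_list w" for j
    by (metis append_take_drop_id prod_list.append)
  ultimately show ?thesis
    by (simp add: letter_form_def Omega_deg ps.subspace_diff[OF tens_deg_subspace] tmult.diff tmult_tens)
qed

lemma letter_form_Cons: "letter_form (Suc k) (x # w) = lact x (letter_form k w)"
  by (simp add: letter_form_def lact_simps)

lemma letter_form_append: "k < length v \<Longrightarrow> letter_form k (v @ w) = ract (letter_form k v) (prod_list w)"
  by (simp add: letter_form_def ract_simps)

text \<open>\<open>last_form\<close> sends a word \<open>a x\<close> with last letter \<open>x\<close> to the form \<open>a \<partial>x\<close>.\<close>

definition last_form :: "('r list \<Rightarrow>\<^sub>0 'k) \<Rightarrow> ('k, 'r) tensors" where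
  "last_form = lin_ext pscale (\<lambda>w. letter_form (length w - 1) w)"

sublocale last_form: Vector_Spaces.linear pscale pscale last_form
  unfolding last_form_def by (rule lin_ext_linear[OF vector_space_pscale])

lemma last_form_single: "last_form (Poly_Mapping.single w 1) = letter_form (length w - 1) w"
  by (simp add: last_form_def lin_ext_single[OF vector_space_pscale])

abbreviation words :: "('r list \<Rightarrow>\<^sub>0 'k) set" where
  "words \<equiv> {Poly_Mapping.single w 1 | w. w \<in> lists X \<and> w \<noteq> []}"

text \<open>
  \<open>\<beta>(a \<partial>x) = a x - (\<plusminus>) x a\<close> is a word minus its signed rotation.
\<close>

lemma beta_last_form:
  assumes "r \<in> ps.span words" shows "beta R (last_form r) = eval_word (r - rotation r)"
proof (rule span_linear_eq[OF _ _ assms])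
  fix r :: "'r list \<Rightarrow>\<^sub>0 'k" assume "r \<in> words"
  then obtain w where r: "r = Poly_Mapping.single w 1" and w: "w \<in> lists X" "w \<noteq> []" by blast
  obtain v x where vx: "w = v @ [x]" using w(2) by (metis append_butlast_last_id)
  have v: "v \<in> lists X" "x \<in> X" using w vx by auto
  show "beta R (last_form r) = eval_word (r - rotation r)"
    unfolding r last_form_single rotation_single eval.diff eval.scale eval_single
    by (simp add: vx letter_form_def beta.diff beta_tens commutator_one rotate_sign_def
        commutator_homog[OF word_piece[OF v(1)] gdeg[OF v(2)]] ksign_scal mult.commute)
qed (auto intro!: linearI vector_space_pscale vs simp: last_form.add last_form.scale beta.add beta.scale
    eval.add eval.scale eval.diff rotation.add rotation.scale V.scale_right_diff_distrib)

text \<open>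
  Differentiating a letter of \<open>w\<close> and rotating afterwards agree modulo \<open>[R, \<Omega>\<^sup>1(R)]\<close>: if \<open>x\<close> is the last
  letter of \<open>w = v x\<close>, the two forms are \<open>x \<theta>\<close> and \<open>\<theta> x\<close> with \<open>\<theta>\<close> obtained from \<open>v\<close>.
\<close>

lemma rotated_letter_form:
  assumes w: "w \<in> lists X" and k: "Suc k < length w"
  shows "pscale (rotate_sign w) (\<nu> (letter_form (Suc k) (last w # butlast w))) = \<nu> (letter_form k w)"
proof -
  have "w \<noteq> []" using k by auto
  then obtain v x where vx: "w = v @ [x]" by (metis append_butlast_last_id)
  have v: "v \<in> lists X" "x \<in> X" "k < length v" using w vx k by auto
  have "\<nu> (lact x (letter_form k v)) = pscale (ksign (gdeg x * wdeg v)) (\<nu> (ract (letter_form k v) x))"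
    using form_null_cyclic[OF gdeg[OF v(2)] letter_form_deg[OF v(1,3)]] by (simp add: nu_ker[symmetric] nu.tens_simps)
  then show ?thesis
    by (simp add: vx letter_form_Cons letter_form_append[OF v(3)] rotate_sign_def)
      (cases "even (gdeg x * wdeg v)"; simp)
qed

text \<open>
  Rotating \<open>j\<close> times brings the letter that is \<open>j\<close> places before the end to the last place.
\<close>

lemma iterated_rotation:
  shows "w \<in> lists X \<Longrightarrow> j < length w \<Longrightarrow>
    \<nu> (last_form ((rotation ^^ j) (Poly_Mapping.single w 1))) = \<nu> (letter_form (length w - 1 - j) w)"
proof (induction j arbitrary: w)
  case 0 then show ?case by (simp add: last_form_single)
next
  case (Suc j)
  have it: "(rotation ^^ j) (pscale c r) = pscale c ((rotation ^^ j) r)" for c r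
    by (induction j) (simp_all add: rotation.scale)
  have "w \<noteq> []" using Suc.prems by auto
  then have len: "length (last w # butlast w) = length w" and wX: "last w # butlast w \<in> lists X"
    using Suc.prems by (auto dest: in_set_butlastD)
  let ?k = "length w - 1 - Suc j"
  have k: "length w - 1 - j = Suc ?k" "Suc ?k < length w" using Suc.prems by auto
  have "\<nu> (last_form ((rotation ^^ Suc j) (Poly_Mapping.single w 1)))
      = pscale (rotate_sign w) (\<nu> (last_form ((rotation ^^ j) (Poly_Mapping.single (last w # butlast w) 1))))"
    unfolding funpow_Suc_right comp_def rotation_single it last_form.scale nu.\<pi>.scale ..
  also have "\<dots> = pscale (rotate_sign w) (\<nu> (letter_form (Suc ?k) (last w # butlast w)))"
    using Suc.IH[OF wX] len Suc.prems k(1) by simp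
  also have "\<dots> = \<nu> (letter_form ?k w)" by (rule rotated_letter_form[OF Suc.prems(1) k(2)])
  finally show ?case .
qed

definition divide_length :: "('r list \<Rightarrow>\<^sub>0 'k) \<Rightarrow> ('r list \<Rightarrow>\<^sub>0 'k)" where
  "divide_length = lin_ext pscale (\<lambda>w. Poly_Mapping.single w (inverse (of_nat (length w))))"

sublocale divide_length: Vector_Spaces.linear pscale pscale divide_length
  unfolding divide_length_def by (rule lin_ext_linear[OF vector_space_pscale])

lemma divide_length_single: "divide_length (Poly_Mapping.single w 1) = pscale (inverse (of_nat (length w))) (Poly_Mapping.single w 1)"
  by (simp add: divide_length_def lin_ext_single[OF vector_space_pscale] pscale_single)

text \<open>
  For a word \<open>w\<close> of length \<open>m\<close> and the rotation \<open>t\<close>, the form \<open>\<partial>w\<close> is the sum of the \<open>last_form (t\<^sup>j w)\<close>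
  over \<open>j < m\<close>, and \<open>m - \<Sum> t\<^sup>j = (\<Sum>\<^sub>j \<Sum>\<^sub>i\<^sub><\<^sub>j t\<^sup>i) (1 - t)\<close>. Dividing by \<open>m\<close> on words of each length
  gives the operator \<open>Q\<close>. On a rotation invariant argument its contribution is \<open>Q 0 = 0\<close>.
\<close>

lemma rotation_homotopy:
  obtains Q where "\<And>r. r \<in> ps.span words \<Longrightarrow>
    \<nu> (last_form r) - \<nu> (univ_der (eval_word (divide_length r))) = Q (r - rotation r)" "Q 0 = 0"
proof -
  define H where "H m r = (\<Sum>j<m. \<Sum>i<j. \<nu> (last_form ((rotation ^^ i) r)))" for m :: nat and r
  have it: "(rotation ^^ j) (pscale c r) = pscale c ((rotation ^^ j) r)"
    "(rotation ^^ j) (r - r') = (rotation ^^ j) r - (rotation ^^ j) r'" for j c r r'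
    by (induction j) (simp_all add: rotation.scale rotation.diff)
  define Q where "Q = lin_ext pscale (\<lambda>w. pscale (inverse (of_nat (length w))) (H (length w) (Poly_Mapping.single w 1)))"
  interpret Q: Vector_Spaces.linear pscale pscale Q
    unfolding Q_def by (rule lin_ext_linear[OF vector_space_pscale])
  have Q_single: "Q (Poly_Mapping.single w 1) = pscale (inverse (of_nat (length w))) (H (length w) (Poly_Mapping.single w 1))" for w
    by (simp add: Q_def lin_ext_single[OF vector_space_pscale])
  have H_lin: "H m (pscale c r) = pscale c (H m r)" "H m (r - r') = H m r - H m r'" for m c r r'
    by (simp_all add: H_def it last_form.scale last_form.diff nu.\<pi>.scale nu.\<pi>.diff ps.scale_sum_right sum_subtractf)
  have "\<nu> (last_form r) - \<nu> (univ_der (eval_word (divide_length r))) = Q (r - rotation r)" if r: "r \<in> ps.span words" for r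
  proof (rule span_linear_eq[OF _ _ r])
    fix r :: "'r list \<Rightarrow>\<^sub>0 'k" assume "r \<in> words"
    then obtain w where r: "r = Poly_Mapping.single w 1" and w: "w \<in> lists X" "w \<noteq> []" by blast
    let ?w = "Poly_Mapping.single w (1::'k)" and ?m = "length w"
    have len: "length (last w # butlast w) = ?m" using w by simp
    have m: "of_nat ?m \<noteq> (0::'k)" using w by simp
    have "Q (r - rotation r) = pscale (inverse (of_nat ?m)) (H ?m (?w - rotation ?w))"
      unfolding r Q.diff rotation_single Q.scale Q_single len H_lin
      by (simp add: ps.scale_right_diff_distrib ps.scale_left_commute)
    also have "H ?m (?w - rotation ?w) = (\<Sum>j<?m. \<nu> (last_form ?w) - \<nu> (last_form ((rotation ^^ j) ?w)))"
    proof -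
      have "(\<Sum>i<j. \<nu> (last_form ((rotation ^^ i) (?w - rotation ?w)))) = \<nu> (last_form ?w) - \<nu> (last_form ((rotation ^^ j) ?w))" for j
        using sum_lessThan_telescope'[of "\<lambda>i. \<nu> (last_form ((rotation ^^ i) ?w))" j]
        by (simp add: it last_form.diff nu.\<pi>.diff funpow_swap1)
      then show ?thesis by (simp add: H_def)
    qed
    also have "\<dots> = pscale (of_nat ?m) (\<nu> (last_form ?w)) - (\<Sum>j<?m. \<nu> (letter_form (?m - Suc j) w))"
      by (simp add: sum_subtractf iterated_rotation[OF w(1)] ps.sum_constant_scale del: sum_constant)
    also have "(\<Sum>j<?m. \<nu> (letter_form (?m - Suc j) w)) = \<nu> (\<Sum>k<?m. letter_form k w)"
      unfolding nu.\<pi>.sum by (rule sum.nat_diff_reindex)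
    also have "\<dots> = \<nu> (univ_der (prod_list w))" by (simp only: sum_letter_form)
    finally have "Q (r - rotation r) = \<nu> (last_form ?w) - pscale (inverse (of_nat ?m)) (\<nu> (univ_der (prod_list w)))"
      using m by (simp add: ps.scale_right_diff_distrib)
    also have "pscale (inverse (of_nat ?m)) (\<nu> (univ_der (prod_list w))) = \<nu> (univ_der (eval_word (divide_length r)))"
      unfolding r divide_length_single eval.scale eval_single
      by (simp add: univ_der_def nu.tens_simps ps.scale_right_diff_distrib)
    finally show "\<nu> (last_form r) - \<nu> (univ_der (eval_word (divide_length r))) = Q (r - rotation r)" by (simp add: r)
  qed (auto intro!: linearI vector_space_pscale simp: last_form.add last_form.scale univ_der_def nu.tens_simps
      eval.add eval.scale divide_length.add divide_length.scale Q.add Q.diff Q.scale rotation.add rotation.scale ps.scale_right_diff_distrib)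
  with Q.zero show thesis using that by blast
qed

abbreviation words_deg :: "int \<Rightarrow> ('r list \<Rightarrow>\<^sub>0 'k) set" where
  "words_deg n \<equiv> {Poly_Mapping.single w 1 | w. w \<in> lists X \<and> w \<noteq> [] \<and> wdeg w = n}"

text \<open>
  Modulo \<open>[R, \<Omega>\<^sup>1(R)]\<close>, the summand \<open>u w\<^sub>1 (\<partial>x) w\<^sub>2\<close> of \<open>u \<partial>w\<close> with \<open>w = w\<^sub>1 x w\<^sub>2\<close> equals \<open>\<plusminus> w\<^sub>2 u w\<^sub>1 \<partial>x\<close>, which
  is a \<open>last_form\<close>.
\<close>

lemma word_forms:
  assumes proj: "tensor_projection (scal R) \<pi>" and ker: "\<And>t. \<pi> t = 0 \<longleftrightarrow> t \<in> ps.span (form_null \<union> last_form ` words_deg n)"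
    and u: "u \<in> lists X" and w: "w \<in> lists X" and n: "wdeg u + wdeg w = n"
  shows "\<pi> (lact (prod_list u) (univ_der (prod_list w))) = 0"
proof -
  interpret tp: tensor_projection "scal R" \<pi> by fact
  have lact_sum: "lact x (\<Sum>k\<in>K. f k) = (\<Sum>k\<in>K. lact x (f k))" for x K and f :: "nat \<Rightarrow> ('k, 'r) tensors"
    by (induction K rule: infinite_finite_induct) (simp_all add: lact_simps)
  have "\<pi> (lact (prod_list u) (letter_form k w)) = 0" if k: "k < length w" for k
  proof -
    define w1 x w2 where "w1 = take k w" and "x = w ! k" and "w2 = drop (Suc k) w"
    have w12: "w = w1 @ x # w2" using id_take_nth_drop[OF k] by (simp add: w1_def x_def w2_def)
    then have X: "w1 \<in> lists X" "x \<in> X" "w2 \<in> lists X" using w by auto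
    have k': "k = length w1" using k by (simp add: w1_def)
    let ?v = "u @ w1 @ [x]"
    have vX: "?v \<in> lists X" "w2 @ ?v \<in> lists X" using u X by auto
    have vn: "wdeg (w2 @ ?v) = n" using n by (simp add: w12)
    have "lact (prod_list u) (letter_form k w) = ract (letter_form (length ?v - 1) ?v) (prod_list w2)"
      by (simp add: letter_form_def w12 k' lact_simps ract_simps mult.assoc)
    moreover have "lact (prod_list w2) (letter_form (length ?v - 1) ?v) = last_form (Poly_Mapping.single (w2 @ ?v) 1)"
      unfolding last_form_single by (simp add: letter_form_def lact_simps mult.assoc)
    moreover have "\<pi> (last_form (Poly_Mapping.single (w2 @ ?v) 1)) = 0"
      unfolding ker using vX(2) vn by (intro ps.span_base) blast
    moreover have "\<pi> (lact (prod_list w2) (letter_form (length ?v - 1) ?v)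
        - pscale (ksign (wdeg w2 * wdeg ?v)) (ract (letter_form (length ?v - 1) ?v) (prod_list w2))) = 0"
      unfolding ker using form_null_cyclic[OF word_piece[OF X(3)] letter_form_deg[OF vX(1)], of "length ?v - 1"]
      by (intro ps.span_base) simp
    ultimately have "pscale (ksign (wdeg w2 * wdeg ?v)) (\<pi> (lact (prod_list u) (letter_form k w))) = 0"
      by (simp add: tp.\<pi>.diff tp.\<pi>.scale)
    then show ?thesis by (cases "even (wdeg w2 * wdeg ?v)") simp_all
  qed
  then show ?thesis unfolding sum_letter_form[symmetric] lact_sum tp.\<pi>.sum by simp
qed

text \<open>
  Since \<open>\<Sum> a \<otimes> b = \<Sum> (a \<otimes> b - a b \<otimes> 1) = \<Sum> a \<partial>b\<close> on \<open>\<Omega>\<^sup>1(R)\<close>, the case \<open>u \<partial>w\<close> for words \<open>u\<close> and \<open>w\<close> suffices.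
\<close>

lemma form_is_last_form:
  assumes w: "\<omega> \<in> deg_part (Omega R) n"
  shows "\<exists>r \<in> ps.span (words_deg n). \<omega> - last_form r \<in> form_null"
proof -
  let ?Y = "ps.span (form_null \<union> last_form ` words_deg n)"
  have TN: "tensor_null (scal R) \<subseteq> ?Y"
    using tensor_null_form_null ps.span_superset[of "form_null \<union> last_form ` words_deg n"] by (meson Un_subset_iff order_trans)
  define \<pi> where "\<pi> = mod_out ?Y"
  have proj: "tensor_projection (scal R) \<pi>" and ker: "\<And>t. \<pi> t = 0 \<longleftrightarrow> t \<in> ?Y"
    unfolding \<pi>_def by (rule tensor_projection_mod_out[OF vs ps.subspace_span TN], rule mod_out[OF ps.subspace_span])
  interpret tp: tensor_projection "scal R" \<pi> by (rule proj)
  have 1: "\<pi> (tens (prod_list u) b - tens (prod_list u * b) 1) \<in> {0}"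
    if u: "u \<in> lists X" and b: "b \<in> piece R (n - wdeg u)" for u b
  proof (rule span_linear_mem[OF _ ps.subspace_single_0 piece_span[OF b]])
    show "Vector_Spaces.linear (scal R) pscale (\<lambda>b. \<pi> (tens (prod_list u) b - tens (prod_list u * b) 1))"
      by (rule linearI) (simp_all add: vs vector_space_pscale tp.tens_simps distrib_left ps.scale_right_diff_distrib)
    fix y assume "y \<in> {prod_list w | w. w \<in> lists X \<and> wdeg w = n - wdeg u}"
    then obtain w where y: "y = prod_list w" "w \<in> lists X" "wdeg w = n - wdeg u" by blast
    then have n: "wdeg u + wdeg w = n" by simp
    show "\<pi> (tens (prod_list u) y - tens (prod_list u * y) 1) \<in> {0}"
      using word_forms[OF proj ker u y(2) n] by (simp add: y(1) univ_der_def lact_simps)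
  qed
  have 2: "\<pi> (tens a b - tens (a * b) 1) \<in> {0}" if a: "a \<in> piece R p" and b: "b \<in> piece R (n - p)" for a b p
  proof (rule span_linear_mem[OF _ ps.subspace_single_0 piece_span[OF a]])
    show "Vector_Spaces.linear (scal R) pscale (\<lambda>a. \<pi> (tens a b - tens (a * b) 1))"
      by (rule linearI) (simp_all add: vs vector_space_pscale tp.tens_simps distrib_right ps.scale_right_diff_distrib)
    fix y assume "y \<in> {prod_list w | w. w \<in> lists X \<and> wdeg w = p}"
    then show "\<pi> (tens y b - tens (y * b) 1) \<in> {0}" using 1 b by blast
  qed
  have wd: "\<omega> \<in> tens_deg R n" "tens_mult R \<omega> = 0" using w by (simp_all add: Omega_deg)
  have "\<pi> (\<omega> - tens (tens_mult R \<omega>) 1) \<in> {0}"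
  proof (rule span_linear_mem[OF _ ps.subspace_single_0 wd(1)[unfolded tens_deg_def]])
    show "Vector_Spaces.linear pscale pscale (\<lambda>\<omega>. \<pi> (\<omega> - tens (tens_mult R \<omega>) 1))"
      by (rule linearI) (simp_all add: vector_space_pscale tp.tens_simps tmult.add tmult.scale ps.scale_right_diff_distrib)
    fix t :: "('k, 'r) tensors" assume "t \<in> {tens a b | a b p q. a \<in> piece R p \<and> b \<in> piece R q \<and> p + q = n}"
    then obtain a b p q where t: "t = tens a b" "a \<in> piece R p" "b \<in> piece R q" "p + q = n" by blast
    then have "b \<in> piece R (n - p)" by (simp add: algebra_simps flip: t(4))
    from 2[OF t(2) this] show "\<pi> (t - tens (tens_mult R t) 1) \<in> {0}" by (simp add: t(1) tmult_tens)
  qed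
  then have "\<pi> \<omega> = 0" by (simp add: wd(2) tp.tens_simps)
  then have "\<omega> \<in> ?Y" by (simp only: ker)
  then show ?thesis
  proof (induction rule: ps.span_induct_alt)
    case base
    then show ?case using ps.span_zero ps.subspace_0[OF form_null_subspace] by (auto intro!: bexI[of _ 0] simp: last_form.zero)
  next
    case (step c y z)
    then obtain r where r: "r \<in> ps.span (words_deg n)" "z - last_form r \<in> form_null" by blast
    obtain r' where r': "r' \<in> ps.span (words_deg n)" "y - last_form r' \<in> form_null"
      using step(1)
    proof
      assume "y \<in> form_null"
      then show thesis using that[OF ps.span_zero] by (simp add: last_form.zero)
    next
      assume "y \<in> last_form ` words_deg n"
      then obtain x where "y = last_form x" "x \<in> words_deg n" by blast
      then show thesis using that[OF ps.span_base[of x]] ps.subspace_0[OF form_null_subspace] by simp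
    qed
    have "pscale c y + z - last_form (pscale c r' + r) = pscale c (y - last_form r') + (z - last_form r)"
      by (simp add: last_form.add last_form.scale ps.scale_right_diff_distrib)
    also have "\<dots> \<in> form_null"
      by (intro ps.subspace_add[OF form_null_subspace] ps.subspace_scale[OF form_null_subspace] r r')
    finally show ?case using ps.span_add[OF ps.span_scale[OF r'(1)] r(1)] by blast
  qed
qed

lemma rotation_words:
  assumes "r \<in> ps.span words"
  shows "rotation r \<in> ps.span words"
proof (rule span_linear_mem[OF rotation.linear_axioms ps.subspace_span assms])
  fix r :: "'r list \<Rightarrow>\<^sub>0 'k" assume "r \<in> words"
  then obtain w where r: "r = Poly_Mapping.single w 1" and w: "w \<in> lists X" "w \<noteq> []" by blast
  then have "last w # butlast w \<in> lists X" by (auto dest: in_set_butlastD)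
  then show "rotation r \<in> ps.span words"
    unfolding r rotation_single by (intro ps.span_scale ps.span_base) blast
qed

lemma words_keys:
  assumes "r \<in> ps.span words"
  shows "Poly_Mapping.keys r \<subseteq> lists X - {[]}"
  using assms
proof (induction rule: ps.span_induct_alt)
  case (step c y z)
  then obtain w where "y = Poly_Mapping.single w 1" "w \<in> lists X - {[]}" by blast
  then have "Poly_Mapping.keys (pscale c y) \<subseteq> lists X - {[]}" by (simp add: pscale_single)
  with step(2) show ?case using Poly_Mapping.keys_add[of "pscale c y" z] by blast
qed simp

text \<open>
  Write \<open>\<omega>\<close> as \<open>last_form r\<close>. Then \<open>r - rotation r\<close> evaluates to a scalar, but it involves nonempty words
  only, so \<open>r\<close> is invariant under rotation and the homotopy applies.
\<close>

lemma kernel_beta: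
  assumes w: "\<omega> \<in> deg_part (Omega R) n" and null: "beta R \<omega> \<in> V.span {1}"
  shows "\<exists>x \<in> piece R n. \<omega> - univ_der x \<in> form_null"
proof -
  obtain r where r: "r \<in> ps.span (words_deg n)" "\<omega> - last_form r \<in> form_null"
    using form_is_last_form[OF w] by blast
  have rw: "r \<in> ps.span words" using r(1) ps.span_mono[of "words_deg n" words] by blast
  have "beta R \<omega> = beta R (last_form r)" using beta_form_null[OF r(2)] by (simp add: beta.diff)
  then have b: "beta R \<omega> = eval_word (r - rotation r)" using beta_last_form[OF rw] by simp
  obtain c where c: "beta R \<omega> = scal R c 1" using null by (auto simp: V.span_singleton)
  have diff: "r - rotation r \<in> ps.span words" by (rule ps.span_diff[OF rw rotation_words[OF rw]])
  have "r - rotation r - Poly_Mapping.single [] c = 0"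
  proof (rule eval_inj)
    show "Poly_Mapping.keys (r - rotation r - Poly_Mapping.single [] c) \<subseteq> lists X"
    proof -
      have "Poly_Mapping.keys (Poly_Mapping.single [] c) \<subseteq> {[] :: 'r list}" by simp
      then show ?thesis
        using words_keys[OF diff] Poly_Mapping.keys_diff[of "r - rotation r" "Poly_Mapping.single [] c"] lists.Nil[of X]
        by blast
    qed
    show "eval_word (r - rotation r - Poly_Mapping.single [] c) = 0"
      unfolding eval.diff[of "r - rotation r"] b[symmetric] c by (simp add: eval_single)
  qed
  then have rc: "r - rotation r = Poly_Mapping.single [] c" by simp
  have "[] \<notin> Poly_Mapping.keys (r - rotation r)" using words_keys[OF diff] by blast
  then have "c = 0" unfolding rc by (simp split: if_splits)
  then have inv: "r - rotation r = 0" using rc by simp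
  have eq: "\<nu> (last_form r) = \<nu> (univ_der (eval_word (divide_length r)))"
    by (rule rotation_homotopy) (use rw inv in force)
  have "eval_word (divide_length r) \<in> piece R n"
  proof (rule span_linear_mem[OF _ piece_subspace r(1)])
    show "Vector_Spaces.linear pscale (scal R) (\<lambda>r. eval_word (divide_length r))"
      by (rule linearI) (simp_all add: vs vector_space_pscale eval.add eval.scale divide_length.add divide_length.scale)
    fix r :: "'r list \<Rightarrow>\<^sub>0 'k" assume "r \<in> words_deg n"
    then obtain w where "r = Poly_Mapping.single w 1" and w: "w \<in> lists X" "wdeg w = n" by blast
    then show "eval_word (divide_length r) \<in> piece R n"
      using word_piece[OF w(1)] by (simp add: divide_length_single eval.scale eval_single piece_scale)
  qed
  moreover have "\<omega> - univ_der (eval_word (divide_length r)) \<in> form_null"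
    using r(2) eq by (simp add: nu_ker[symmetric] nu.\<pi>.diff)
  ultimately show ?thesis by blast
qed

lemma exact_periodic_Xplus: "exact_periodic (Rbar R) (Omega_nat R) (beta R) univ_der (Rbar_nat R)"
  unfolding exact_periodic_def exact_periodic_axioms_def
  using periodic_Xplus chain_complex_Rbar_nat kernel_univ_der univ_der_null image_beta kernel_beta
  by (auto simp: Rbar_simps Rbar_nat_simps Omega_nat_simps)

end

section \<open>The representation algebra\<close>

lemma pscale_mult: "pscale c f * g = pscale c (f * g)" "f * pscale c g = pscale c (f * g)"
  for f g :: "('a::monoid_add) \<Rightarrow>\<^sub>0 'k::field"
proof -
  have 1: "pscale c (Poly_Mapping.single a d) * g = pscale c (Poly_Mapping.single a d * g)" for a d and g :: "'a \<Rightarrow>\<^sub>0 'k"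
    by (induction g rule: pm_induct) (simp_all add: distrib_left ps.scale_right_distrib pscale_single mult_single mult.assoc)
  show "pscale c f * g = pscale c (f * g)"
    by (induction f rule: pm_induct) (simp_all add: distrib_right ps.scale_right_distrib 1)
  have 2: "Poly_Mapping.single a d * pscale c g = pscale c (Poly_Mapping.single a d * g)" for a d
    by (induction g rule: pm_induct) (simp_all add: distrib_left ps.scale_right_distrib pscale_single mult_single mult.left_commute)
  show "f * pscale c g = pscale c (f * g)"
    by (induction f rule: pm_induct) (simp_all add: distrib_right ps.scale_right_distrib 2)
qed

lemma k_algebra_pscale: "k_algebra (pscale :: 'k::field \<Rightarrow> (('a::monoid_add) \<Rightarrow>\<^sub>0 'k) \<Rightarrow> _)"
  by (simp add: k_algebra_def vector_space_pscale pscale_mult)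

lemma ksign_mult_left: "f * (ksign n * g) = ksign n * (f * (g :: 'a::ring_1))"
  by (cases "even n") simp_all

locale rep_algebra = dga R for R :: "('k::field, 'r::ring_1) dg_alg" +
  fixes B :: "'v set"
  assumes finite_B: "finite B"
begin

abbreviation I :: "('k, 'r, 'v) rep_alg set" where "I \<equiv> rep_ideal R B"

abbreviation wd :: "('r \<times> 'v \<times> 'v) list \<Rightarrow> ('k, 'r, 'v) rep_alg" where "wd ls \<equiv> Poly_Mapping.single (Word ls) 1"

lemma ideal_subspace: "ps.subspace I"
  by (simp add: rep_ideal_def ps.subspace_span)

lemma ideal_mult: assumes "g \<in> I" shows "f * g \<in> I" "g * f \<in> I"
proof -
  have lin: "Vector_Spaces.linear pscale pscale (\<lambda>g. f * g)" "Vector_Spaces.linear pscale pscale (\<lambda>g. g * f)"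
    by (auto intro!: linearI vector_space_pscale simp: distrib_left distrib_right pscale_mult)
  note span = assms[unfolded rep_ideal_def]
  show "f * g \<in> I"
  proof (rule span_linear_mem[OF lin(1) ideal_subspace span])
    fix x :: "('k, 'r, 'v) rep_alg" assume "x \<in> {f * g * h | f g h. g \<in> rep_relations R B}"
    then obtain a r h where x: "x = a * r * h" "r \<in> rep_relations R B" by blast
    have "f * x = (f * a) * r * h" by (simp add: x mult.assoc)
    then show "f * x \<in> I" unfolding rep_ideal_def using x(2) by (intro ps.span_base) blast
  qed
  show "g * f \<in> I"
  proof (rule span_linear_mem[OF lin(2) ideal_subspace span])
    fix x :: "('k, 'r, 'v) rep_alg" assume "x \<in> {f * g * h | f g h. g \<in> rep_relations R B}"
    then obtain a r h where x: "x = a * r * h" "r \<in> rep_relations R B" by blast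
    have "x * f = a * r * (h * f)" by (simp add: x mult.assoc)
    then show "x * f \<in> I" unfolding rep_ideal_def using x(2) by (intro ps.span_base) blast
  qed
qed

abbreviation q :: "('k, 'r, 'v) rep_alg \<Rightarrow> ('k, 'r, 'v) rep_alg" where "q \<equiv> mod_out I"

sublocale q: Vector_Spaces.linear pscale pscale q by (rule mod_out[OF ideal_subspace])

lemma q_zero_iff: "q x = 0 \<longleftrightarrow> x \<in> I" by (rule mod_out[OF ideal_subspace])

lemma q_eq_iff: "q x = q y \<longleftrightarrow> x - y \<in> I"
  using q_zero_iff[of "x - y"] by (simp add: q.diff)

lemma q_mult_cong: assumes "q f = q f'" "q g = q g'" shows "q (f * g) = q (f' * g')"
proof -
  have "f * g - f' * g' = (f - f') * g + f' * (g - g')" by (simp add: algebra_simps)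
  also have "\<dots> \<in> I" using assms by (intro ps.subspace_add[OF ideal_subspace] ideal_mult) (simp_all add: q_eq_iff)
  finally show ?thesis by (simp add: q_eq_iff)
qed

lemma q_ksign: "q (ksign n * f) = ksign n * q f"
  by (cases "even n") (simp_all add: q.neg)

lemma q_relation: "x - y \<in> rep_relations R B \<Longrightarrow> q x = q y"
  unfolding q_eq_iff by (rule relation_in_ideal)

lemma q_gen_add: "\<lbrakk>i \<in> B; j \<in> B\<rbrakk> \<Longrightarrow> q (gen (x + y) i j) = q (gen x i j) + q (gen y i j)"
  unfolding q.add[symmetric] by (rule q_relation) (unfold rep_relations_def Un_iff mem_Collect_eq, blast)

lemma q_gen_scale: "\<lbrakk>i \<in> B; j \<in> B\<rbrakk> \<Longrightarrow> q (gen (scal R c x) i j) = pscale c (q (gen x i j))"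
  unfolding q.scale[symmetric] by (rule q_relation) (unfold rep_relations_def Un_iff mem_Collect_eq, blast)

lemma q_gen_one: "\<lbrakk>i \<in> B; j \<in> B\<rbrakk> \<Longrightarrow> q (gen 1 i j) = q (if i = j then 1 else 0)"
  by (rule q_relation) (unfold rep_relations_def Un_iff mem_Collect_eq, blast)

lemma q_gen_mult: "\<lbrakk>i \<in> B; j \<in> B\<rbrakk> \<Longrightarrow> q (gen (x * y) i j) = q (\<Sum>l\<in>B. gen x i l * gen y l j)"
  by (rule q_relation) (unfold rep_relations_def Un_iff mem_Collect_eq, blast)

lemma q_gen_commute: "\<lbrakk>x \<in> piece R m; y \<in> piece R n; i \<in> B; j \<in> B; k \<in> B; l \<in> B\<rbrakk> \<Longrightarrow>
    q (gen x i j * gen y k l) = q (ksign (m * n) * (gen y k l * gen x i j))"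
  by (rule q_relation, unfold rep_relations_def Un_iff mem_Collect_eq, rule disjI2)
    (rule exI[of _ x], rule exI[of _ y], rule exI[of _ i], rule exI[of _ j], rule exI[of _ k], rule exI[of _ l],
      rule exI[of _ m], rule exI[of _ n], simp)

lemma q_gen_zero: "\<lbrakk>i \<in> B; j \<in> B\<rbrakk> \<Longrightarrow> q (gen 0 i j) = 0"
  using q_gen_add[of i j 0 0] by simp

lemma q_gen_neg: "\<lbrakk>i \<in> B; j \<in> B\<rbrakk> \<Longrightarrow> q (gen (- x) i j) = - q (gen x i j)"
  using q_gen_add[of i j x "- x"] by (simp add: q_gen_zero eq_neg_iff_add_eq_0 add.commute)

lemma q_gen_diff: "\<lbrakk>i \<in> B; j \<in> B\<rbrakk> \<Longrightarrow> q (gen (x - y) i j) = q (gen x i j) - q (gen y i j)"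
  using q_gen_add[of i j x "- y"] by (simp add: q_gen_neg)

lemma q_gen_ksign: "\<lbrakk>i \<in> B; j \<in> B\<rbrakk> \<Longrightarrow> q (gen (ksign n * x) i j) = q (ksign n * gen x i j)"
  by (cases "even n") (simp_all add: q_gen_neg q.neg)

subsection \<open>Degrees\<close>

abbreviation rd :: "int \<Rightarrow> ('k, 'r, 'v) rep_alg set" where "rd \<equiv> rep_deg R B"

lemma rd_subspace: "ps.subspace (rd n)"
  by (simp add: rep_deg_def ps.subspace_span)

lemma homogeneous_wordI:
  "list_all2 (\<lambda>(x, i, j) m. x \<in> piece R m \<and> i \<in> B \<and> j \<in> B) ls ms \<Longrightarrow> homogeneous_word R B (sum_list ms) (Word ls)"
  unfolding homogeneous_word_def by auto

text \<open>
  The homogeneous elements of \<open>R\<^sub>V\<close> are obtained from \<open>1\<close> by linear combinations and by multiplication with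
  the entries of homogeneous elements of \<open>R\<close> from the left.
\<close>

lemma rd_induct [consumes 1, case_names one gen_mult zero add scale]:
  assumes f: "f \<in> rd n"
    and one: "P 0 1"
    and gen_mult: "\<And>m n x i j f. \<lbrakk>x \<in> piece R m; i \<in> B; j \<in> B; f \<in> rd n; P n f\<rbrakk> \<Longrightarrow> P (m + n) (gen x i j * f)"
    and zero: "\<And>n. P n 0" and add: "\<And>n f g. \<lbrakk>f \<in> rd n; g \<in> rd n; P n f; P n g\<rbrakk> \<Longrightarrow> P n (f + g)"
    and scale: "\<And>n c f. \<lbrakk>f \<in> rd n; P n f\<rbrakk> \<Longrightarrow> P n (pscale c f)"
  shows "P n f"
proof -
  have word: "P (sum_list ms) (wd ls) \<and> wd ls \<in> rd (sum_list ms)"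
    if "list_all2 (\<lambda>(x, i, j) m. x \<in> piece R m \<and> i \<in> B \<and> j \<in> B) ls ms" for ls ms
    using that
  proof (induction ls ms rule: list_all2_induct)
    case Nil
    have "homogeneous_word R B 0 (Word [])" using homogeneous_wordI[of "[]" "[]"] by simp
    then have "wd [] \<in> rd 0" unfolding rep_deg_def by (intro ps.span_base) blast
    then show ?case using one by (simp add: single_Word_Nil)
  next
    case (Cons y ls m ms)
    obtain x i j where y: "y = (x, i, j)" by (cases y)
    have "list_all2 (\<lambda>(x, i, j) m. x \<in> piece R m \<and> i \<in> B \<and> j \<in> B) (y # ls) (m # ms)" using Cons by simp
    from homogeneous_wordI[OF this] have "wd (y # ls) \<in> rd (sum_list (m # ms))"
      unfolding rep_deg_def by (intro ps.span_base) blast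
    moreover have "P (m + sum_list ms) (gen x i j * wd ls)" using Cons y by (intro gen_mult) auto
    ultimately show ?case by (simp add: y single_Word_Cons)
  qed
  have "P n f \<and> f \<in> rd n"
    using f unfolding rep_deg_def
  proof (induction rule: ps.span_induct_alt)
    case base then show ?case using zero ps.span_zero by blast
  next
    case (step c y z)
    then obtain w where w: "y = Poly_Mapping.single w 1" "homogeneous_word R B n w" by blast
    then obtain ms where "list_all2 (\<lambda>(x, i, j) m. x \<in> piece R m \<and> i \<in> B \<and> j \<in> B) (letters w) ms" "sum_list ms = n"
      unfolding homogeneous_word_def by blast
    with word[of "letters w" ms] w(1) have y: "P n y" "y \<in> rd n" by simp_all
    have z: "P n z" "z \<in> rd n" using step by (auto simp: rep_deg_def)
    have cy: "pscale c y \<in> rd n" by (rule ps.subspace_scale[OF rd_subspace y(2)])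
    show ?case
      using add[OF cy z(2) scale[OF y(2,1)] z(1)] ps.subspace_add[OF rd_subspace cy z(2)] by (simp add: rep_deg_def)
  qed
  then show ?thesis by blast
qed

lemma one_rd: "1 \<in> rd 0"
proof -
  have "homogeneous_word R B 0 (Word [])" using homogeneous_wordI[of "[]" "[]"] by simp
  then have "wd [] \<in> rd 0" unfolding rep_deg_def by (intro ps.span_base) blast
  then show ?thesis by (simp add: single_Word_Nil)
qed

lemma gen_mult_rd:
  assumes x: "x \<in> piece R m" "i \<in> B" "j \<in> B" and f: "f \<in> rd n"
  shows "gen x i j * f \<in> rd (m + n)"
proof (rule span_linear_mem[OF _ rd_subspace f[unfolded rep_deg_def]])
  show "Vector_Spaces.linear pscale pscale (\<lambda>f. gen x i j * f)"
    by (rule linearI) (simp_all add: vector_space_pscale distrib_left pscale_mult)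
  fix f :: "('k, 'r, 'v) rep_alg" assume "f \<in> {Poly_Mapping.single w 1 | w. homogeneous_word R B n w}"
  then obtain w ms where f: "f = Poly_Mapping.single w 1"
    "list_all2 (\<lambda>(x, i, j) m. x \<in> piece R m \<and> i \<in> B \<and> j \<in> B) (letters w) ms" "sum_list ms = n"
    unfolding homogeneous_word_def by blast
  have "homogeneous_word R B (sum_list (m # ms)) (Word ((x, i, j) # letters w))"
    using f(2) x by (intro homogeneous_wordI) simp
  then have "wd ((x, i, j) # letters w) \<in> rd (m + n)"
    unfolding rep_deg_def using f(3) by (intro ps.span_base) auto
  then show "gen x i j * f \<in> rd (m + n)" using f(1) by (simp add: single_Word_Cons)
qed

lemma gen_rd: "\<lbrakk>x \<in> piece R m; i \<in> B; j \<in> B\<rbrakk> \<Longrightarrow> gen x i j \<in> rd m"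
  by (rule gen_in_rep_deg)

lemma q_gen_commute_rd:
  assumes "f \<in> rd n" "x \<in> piece R m" "i \<in> B" "j \<in> B"
  shows "q (gen x i j * f) = q (ksign (m * n) * (f * gen x i j))"
  using assms(1)
proof (induction rule: rd_induct)
  case (gen_mult p n' y k l f)
  have "q (gen x i j * (gen y k l * f)) = q ((ksign (m * p) * (gen y k l * gen x i j)) * f)"
    unfolding mult.assoc[symmetric, of "gen x i j"]
    by (rule q_mult_cong[OF q_gen_commute[OF assms(2) gen_mult(1) assms(3,4) gen_mult(2,3)] refl])
  also have "\<dots> = ksign (m * p) * q (gen y k l * (gen x i j * f))"
    by (simp add: q_ksign mult.assoc)
  also have "q (gen y k l * (gen x i j * f)) = q (gen y k l * (ksign (m * n') * (f * gen x i j)))"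
    by (rule q_mult_cong[OF refl gen_mult(5)])
  finally show ?case
    by (cases "even m"; cases "even p"; cases "even n'") (simp_all add: q.neg mult.assoc)
qed (simp_all add: distrib_left distrib_right q.add q_ksign q.scale q.zero pscale_mult ksign_mult_left ksign_pscale[symmetric]
    ps.scale_right_distrib ps.scale_left_commute)

lemma q_commute: "f \<in> rd m \<Longrightarrow> g \<in> rd n \<Longrightarrow> q (f * g) = q (ksign (m * n) * (g * f))"
proof (induction rule: rd_induct)
  case (gen_mult p m' x i j f)
  have "q (gen x i j * f * g) = q (gen x i j * (ksign (m' * n) * (g * f)))"
    unfolding mult.assoc by (rule q_mult_cong[OF refl gen_mult(5)[OF gen_mult(6)]])
  also have "\<dots> = ksign (m' * n) * q ((gen x i j * g) * f)" by (simp add: ksign_mult_left q_ksign mult.assoc)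
  also have "q ((gen x i j * g) * f) = q ((ksign (p * n) * (g * gen x i j)) * f)"
    by (rule q_mult_cong[OF q_gen_commute_rd[OF gen_mult(6,1-3)] refl])
  finally show ?case
    by (cases "even p"; cases "even m'"; cases "even n") (simp_all add: q.neg distrib_right mult.assoc)
qed (simp_all add: distrib_left distrib_right q.add q_ksign q.scale q.zero pscale_mult ksign_mult_left ksign_pscale[symmetric]
    ps.scale_right_distrib ps.scale_left_commute)

end

subsection \<open>Skew derivations\<close>

text \<open>
  A map \<open>D\<close> of \<open>R\<close> with \<open>D(x y) = D(x) y + P(x) D(y)\<close> extends to \<open>R\<^sub>V\<close> by acting on the entries of the
  universal representation. Both the differential (with \<open>P\<close> the parity and degree \<open>-1\<close>) and the Euler
  derivation (with \<open>P\<close> the identity and degree \<open>0\<close>) are of this kind.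
\<close>

fun der_letters :: "('r \<Rightarrow> 'r) \<Rightarrow> ('r \<Rightarrow> 'r) \<Rightarrow> ('r \<times> 'v \<times> 'v) list \<Rightarrow> ('k::field, 'r, 'v) rep_alg" where
  "der_letters D P [] = 0"
| "der_letters D P ((x, i, j) # ls) =
     gen (D x) i j * Poly_Mapping.single (Word ls) 1 + gen (P x) i j * der_letters D P ls"

definition der_rep :: "('r \<Rightarrow> 'r) \<Rightarrow> ('r \<Rightarrow> 'r) \<Rightarrow> ('k::field, 'r, 'v) rep_alg \<Rightarrow> ('k, 'r, 'v) rep_alg" where
  "der_rep D P = lin_ext pscale (\<lambda>w. der_letters D P (letters w))"

definition map_rep :: "('r \<Rightarrow> 'r) \<Rightarrow> ('k::field, 'r, 'v) rep_alg \<Rightarrow> ('k, 'r, 'v) rep_alg" where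
  "map_rep P = lin_ext pscale (\<lambda>w. Poly_Mapping.single (Word (map (\<lambda>(x, i, j). (P x, i, j)) (letters w))) 1)"

lemma rep_dif_der:
  fixes R :: "('k::field, 'r::ring_1) dg_alg"
  shows "rep_dif R = (der_rep (dif R) (parity R) :: ('k, 'r, 'v) rep_alg \<Rightarrow> _)"
proof -
  have "dif_letters R ls = der_letters (dif R) (parity R) ls" for ls :: "('r \<times> 'v \<times> 'v) list"
    by (induction ls rule: dif_letters.induct) simp_all
  then show ?thesis by (simp add: rep_dif_def der_rep_def)
qed

lemma rep_parity_map: "rep_parity R = map_rep (parity R)"
  by (simp add: rep_parity_def map_rep_def)

locale skew_derivation = rep_algebra R B for R :: "('k::field, 'r::ring_1) dg_alg" and B :: "'v set" +
  fixes D P :: "'r \<Rightarrow> 'r" and e :: int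
  assumes D_linear: "Vector_Spaces.linear (scal R) (scal R) D"
    and P_linear: "Vector_Spaces.linear (scal R) (scal R) P"
    and D_mult: "D (x * y) = D x * y + P x * D y" and P_mult: "P (x * y) = P x * P y" and P_one: "P 1 = 1"
    and D_piece: "x \<in> piece R n \<Longrightarrow> D x \<in> piece R (n + e)"
    and P_piece: "x \<in> piece R n \<Longrightarrow> P x = ksign (e * n) * x"
begin

sublocale D: Vector_Spaces.linear "scal R" "scal R" D by (rule D_linear)
sublocale P: Vector_Spaces.linear "scal R" "scal R" P by (rule P_linear)

abbreviation der :: "('k, 'r, 'v) rep_alg \<Rightarrow> ('k, 'r, 'v) rep_alg" where "der \<equiv> der_rep D P"
abbreviation par :: "('k, 'r, 'v) rep_alg \<Rightarrow> ('k, 'r, 'v) rep_alg" where "par \<equiv> map_rep P"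

sublocale der: Vector_Spaces.linear pscale pscale der
  unfolding der_rep_def by (rule lin_ext_linear[OF vector_space_pscale])
sublocale par: Vector_Spaces.linear pscale pscale par
  unfolding map_rep_def by (rule lin_ext_linear[OF vector_space_pscale])

lemma D_one: "D 1 = 0"
  using D_mult[of 1 1] P_one by simp

lemma der_single: "der (Poly_Mapping.single w c) = pscale c (der_letters D P (letters w))"
  by (simp add: der_rep_def lin_ext_single[OF vector_space_pscale])

lemma par_single: "par (Poly_Mapping.single w c) = pscale c (wd (map (\<lambda>(x, i, j). (P x, i, j)) (letters w)))"
  by (simp add: map_rep_def lin_ext_single[OF vector_space_pscale])

lemma par_mult: "par (f * g) = par f * par g"
  unfolding map_rep_def
  by (rule lin_ext_mult[OF k_algebra_pscale]) (simp add: plus_word_def mult_single)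

lemma par_one: "par 1 = 1"
  using par_single[of "Word []" 1] by (simp add: single_Word_Nil)

lemma par_gen: "par (gen x i j) = gen (P x) i j"
  by (simp add: gen_def par_single)

lemma der_one: "der 1 = 0"
  using der_single[of "Word []" 1] by (simp add: single_Word_Nil)

lemma der_gen: "der (gen x i j) = gen (D x) i j"
  using der_single[of "Word [(x, i, j)]" 1] by (simp add: gen_def single_Word_Nil)

lemma der_gen_mult: "der (gen x i j * f) = gen (D x) i j * f + gen (P x) i j * der f"
proof -
  have "der (gen x i j * Poly_Mapping.single w c) = gen (D x) i j * Poly_Mapping.single w c + gen (P x) i j * der (Poly_Mapping.single w c)"
    for w and c :: 'k
  proof -
    have s: "Poly_Mapping.single w c = pscale c (wd (letters w))" by (simp add: pscale_single)
    have g: "gen x i j * wd (letters w) = wd ((x, i, j) # letters w)" by (simp add: single_Word_Cons)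
    show ?thesis
      unfolding s pscale_mult g der.scale der_single ps.scale_right_distrib[symmetric] by simp
  qed
  then show ?thesis
    by (induction f rule: pm_induct) (simp_all add: der.zero distrib_left der.add)
qed

lemma word_products_induct:
  assumes "\<Phi> 1" "\<And>x i j f. \<Phi> f \<Longrightarrow> \<Phi> (gen x i j * f)" "\<And>f g. \<Phi> f \<Longrightarrow> \<Phi> g \<Longrightarrow> \<Phi> (f + g)" "\<And>c f. \<Phi> f \<Longrightarrow> \<Phi> (pscale c f)"
  shows "\<Phi> (f :: ('k, 'r, 'v) rep_alg)"
proof -
  have word: "\<Phi> (wd ls)" for ls
    by (induction ls) (use assms(1,2) in \<open>auto simp: single_Word_Nil single_Word_Cons\<close>)
  have "\<Phi> (Poly_Mapping.single w c)" for w c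
    using assms(4)[OF word[of "letters w"], of c] by (simp add: pscale_single)
  moreover have "\<Phi> 0" using assms(4)[OF assms(1), of 0] by simp
  ultimately show ?thesis by (induction f rule: pm_induct) (auto intro: assms(3))
qed

lemma der_mult: "der (f * g) = der f * g + par f * der g"
  by (induction f rule: word_products_induct)
    (simp_all add: der_one par_one der_gen_mult par_mult par_gen distrib_left distrib_right mult.assoc
      der.add par.add der.scale par.scale pscale_mult ps.scale_right_distrib)

lemma par_relation:
  assumes "r \<in> rep_relations R B" shows "q (par r) = 0"
proof -
  have 1: "q (par (gen (x + y) i j - (gen x i j + gen y i j))) = 0"
    and 2: "q (par (gen (scal R c x) i j - pscale c (gen x i j))) = 0"
    and 3: "q (par (gen 1 i j - (if i = j then 1 else 0))) = 0"
    and 4: "q (par (gen (x * y) i j - (\<Sum>l\<in>B. gen x i l * gen y l j))) = 0" if "i \<in> B" "j \<in> B" for x y c i j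
    using that by (simp_all add: par.diff par.add par.scale par.sum par.zero par_mult par_gen par_one P_mult P_one P.add P.scale
        q.diff q.add q.scale q_gen_add q_gen_scale q_gen_one q_gen_mult q.zero)
  have 5: "q (par (gen x i j * gen y k l - ksign (m * n) * (gen y k l * gen x i j))) = 0"
    if "x \<in> piece R m" "y \<in> piece R n" "i \<in> B" "j \<in> B" "k \<in> B" "l \<in> B" for x y i j k l m n
  proof -
    have P: "P x \<in> piece R m" "P y \<in> piece R n" using that by (simp_all add: P_piece piece_ksign)
    show ?thesis
      using q_gen_commute[OF P that(3-6)]
      by (cases "even (m * n)") (simp_all add: par.diff par.neg par.add par_mult par_gen q.diff q.add q.neg)
  qed
  show ?thesis
    using assms 1 2 3 4 5 unfolding rep_relations_def Un_iff mem_Collect_eq by (elim disjE exE conjE) (simp_all only:)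
qed

text \<open>
  The only relations for which this is not formal are those of graded commutativity: there
  \<open>D [x, y] = [D x, y] \<plusminus> [x, D y]\<close> on matrix entries.
\<close>

lemma der_relation:
  assumes "r \<in> rep_relations R B" shows "q (der r) = 0"
proof -
  have 1: "q (der (gen (x + y) i j - (gen x i j + gen y i j))) = 0"
    and 2: "q (der (gen (scal R c x) i j - pscale c (gen x i j))) = 0"
    and 3: "q (der (gen 1 i j - (if i = j then 1 else 0))) = 0"
    and 4: "q (der (gen (x * y) i j - (\<Sum>l\<in>B. gen x i l * gen y l j))) = 0" if "i \<in> B" "j \<in> B" for x y c i j
    using that by (simp_all add: der.diff der.add der.scale der.sum der.zero der_mult der_gen par_gen der_one D_mult D_one D.add D.scale
        q.diff q.add q.scale q_gen_add q_gen_scale q_gen_mult q_gen_zero q.zero sum.distrib)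
  have 5: "q (der (gen x i j * gen y k l - ksign (m * n) * (gen y k l * gen x i j))) = 0"
    if x: "x \<in> piece R m" and y: "y \<in> piece R n" and B: "i \<in> B" "j \<in> B" "k \<in> B" "l \<in> B" for x y i j k l m n
  proof -
    have Px: "q (gen (P x) i j * h) = ksign (e * m) * q (gen x i j * h)" for h
      using q_mult_cong[OF q_gen_ksign[OF B(1,2), of "e * m" x] refl, of h] by (simp add: P_piece[OF x] mult.assoc q_ksign)
    have Py: "q (gen (P y) k l * h) = ksign (e * n) * q (gen y k l * h)" for h
      using q_mult_cong[OF q_gen_ksign[OF B(3,4), of "e * n" y] refl, of h] by (simp add: P_piece[OF y] mult.assoc q_ksign)
    note c = q_gen_commute[OF D_piece[OF x] y B] q_gen_commute[OF x D_piece[OF y] B]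
    show ?thesis
      by (cases "even m"; cases "even n"; cases "even e")
        (simp_all add: der.diff der.neg der.add der_mult der_gen par_gen q.diff q.add q.neg Px Py c)
  qed
  show ?thesis
    using assms 1 2 3 4 5 unfolding rep_relations_def Un_iff mem_Collect_eq by (elim disjE exE conjE) (simp_all only:)
qed

lemma par_ideal: assumes "f \<in> I" shows "par f \<in> I"
proof (rule span_linear_mem[OF par.linear_axioms ideal_subspace assms[unfolded rep_ideal_def]])
  fix x :: "('k, 'r, 'v) rep_alg" assume "x \<in> {f * g * h | f g h. g \<in> rep_relations R B}"
  then obtain a r h where x: "x = a * r * h" "r \<in> rep_relations R B" by blast
  then show "par x \<in> I" using par_relation[OF x(2)] by (simp add: par_mult q_zero_iff ideal_mult)
qed

lemma der_ideal: assumes "f \<in> I" shows "der f \<in> I"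
proof (rule span_linear_mem[OF der.linear_axioms ideal_subspace assms[unfolded rep_ideal_def]])
  fix x :: "('k, 'r, 'v) rep_alg" assume "x \<in> {f * g * h | f g h. g \<in> rep_relations R B}"
  then obtain a r h where x: "x = a * r * h" "r \<in> rep_relations R B" by blast
  have r: "der r \<in> I" "r \<in> I" "par r \<in> I"
    using der_relation[OF x(2)] par_relation[OF x(2)] relation_in_ideal[OF x(2)] by (simp_all add: q_zero_iff)
  have "der x = der a * r * h + par a * der r * h + par a * par r * der h"
    by (simp add: x(1) der_mult par_mult algebra_simps)
  also have "\<dots> \<in> I" by (intro ps.subspace_add[OF ideal_subspace] ideal_mult r)
  finally show "der x \<in> I" .
qed

lemma P_in_piece: "x \<in> piece R n \<Longrightarrow> P x \<in> piece R n"
  by (simp add: P_piece piece_ksign)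

lemma par_rd: "f \<in> rd n \<Longrightarrow> par f \<in> rd n"
  by (induction rule: rd_induct)
    (simp_all add: one_rd par_one par_mult par_gen par.zero par.add par.scale gen_mult_rd P_in_piece
      ps.subspace_0[OF rd_subspace] ps.subspace_add[OF rd_subspace] ps.subspace_scale[OF rd_subspace])

lemma der_rd: "f \<in> rd n \<Longrightarrow> der f \<in> rd (n + e)"
proof (induction rule: rd_induct)
  case (gen_mult m n x i j f)
  have "gen (D x) i j * f \<in> rd (m + e + n)" "gen (P x) i j * der f \<in> rd (m + (n + e))"
    using gen_mult by (auto intro!: gen_mult_rd D_piece P_in_piece)
  then show ?case by (simp add: der_gen_mult ps.subspace_add[OF rd_subspace] algebra_simps)
qed (simp_all add: der_one der.zero der.add der.scale
      ps.subspace_0[OF rd_subspace] ps.subspace_add[OF rd_subspace] ps.subspace_scale[OF rd_subspace])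

lemma q_par: "f \<in> rd n \<Longrightarrow> q (par f) = q (ksign (e * n) * f)"
proof (induction rule: rd_induct)
  case (gen_mult m n x i j f)
  have "q (par (gen x i j * f)) = q ((ksign (e * m) * gen x i j) * (ksign (e * n) * f))"
    unfolding par_mult par_gen P_piece[OF gen_mult(1)] by (rule q_mult_cong[OF q_gen_ksign[OF gen_mult(2,3)] gen_mult(5)])
  then show ?case by (cases "even e"; cases "even m"; cases "even n") simp_all
qed (simp_all add: par_one par.zero par.add par.scale q.add q.scale distrib_left pscale_mult q.zero)

end

section \<open>Kaehler differentials\<close>

context rep_algebra
begin

sublocale dif: skew_derivation R B "dif R" "parity R" "- 1"
proof
  show "x \<in> piece R n \<Longrightarrow> parity R x = ksign (- 1 * n) * x" for x n
    by (cases "even n") (simp_all add: parity_homog)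
  show "x \<in> piece R n \<Longrightarrow> dif R x \<in> piece R (n + - 1)" for x n using dif_piece[of x n] by simp
qed (simp_all add: dif_mult parity_mult parity_one dif_linear parity_linear)

lemma rep_dif_eq: "rep_dif R = dif.der" and rep_parity_eq: "rep_parity R = dif.par"
  by (simp_all add: rep_dif_der rep_parity_map)

lemma q_dif_cong: "q f = q g \<Longrightarrow> q (dif.der f) = q (dif.der g)"
  unfolding q_eq_iff dif.der.diff[symmetric] by (rule dif.der_ideal)

lemma q_dif_par: assumes "f \<in> rd n" shows "q (dif.par f) = ksign n * q f"
  using dif.q_par[OF assms] by (cases "even n") (simp_all add: q.neg)

lemma q_dif_of_par: assumes "f \<in> rd n" shows "q (dif.der (dif.par f)) = ksign n * q (dif.der f)"
proof -
  have "q (dif.par f) = q (ksign n * f)" using q_dif_par[OF assms] by (simp add: q_ksign)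
  from q_dif_cong[OF this] show ?thesis by (cases "even n") (simp_all add: dif.der.neg q.neg)
qed

lemma q_par_of_dif: assumes "f \<in> rd n" shows "q (dif.par (dif.der f)) = - (ksign n * q (dif.der f))"
proof -
  have "dif.der f \<in> rd (n - 1)" using dif.der_rd[OF assms] by simp
  from q_dif_par[OF this] show ?thesis by (cases "even n") simp_all
qed

text \<open>
  On words with letters outside of \<open>B \<times> B\<close> the square of the differential need not be in the ideal, whence the
  restriction to \<open>rd n\<close>.
\<close>

lemma dif_dif_rep: "f \<in> rd n \<Longrightarrow> q (dif.der (dif.der f)) = 0"
proof (induction rule: rd_induct)
  case (gen_mult m n x i j f)
  have "dif.der (dif.der (gen x i j * f)) = gen (dif R (dif R x)) i j * f + gen (parity R (dif R x)) i j * dif.der f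
      + (gen (dif R (parity R x)) i j * dif.der f + gen (parity R (parity R x)) i j * dif.der (dif.der f))"
    by (simp add: dif.der_gen_mult dif.der.add)
  moreover have "q (gen (dif R (dif R x)) i j * f) = q (0 * f)"
    by (rule q_mult_cong) (simp_all add: dif_dif q_gen_zero gen_mult q.zero)
  moreover have "q (gen (dif R (parity R x)) i j * dif.der f) = q (- gen (parity R (dif R x)) i j * dif.der f)"
    by (rule q_mult_cong) (simp_all add: dif_parity q_gen_neg gen_mult q.neg)
  moreover have "q (gen (parity R (parity R x)) i j * dif.der (dif.der f)) = q (gen (parity R (parity R x)) i j * 0)"
    by (rule q_mult_cong) (simp_all add: gen_mult q.zero)
  ultimately show ?case by (simp add: q.add q.neg q.zero)
qed (simp_all add: dif.der_one dif.der.zero dif.der.add dif.der.scale q.add q.scale q.zero)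

abbreviation null_RV :: "('k, 'r, 'v) rep_alg set" where "null_RV \<equiv> ps.span (insert 1 I)"

lemma RVbar_simps: "deg_part (RVbar R B) = rd" "null_part (RVbar R B) n = null_RV" "differential (RVbar R B) = dif.der"
  by (simp_all add: RVbar_def rep_dif_eq)

lemma ideal_null_RV: "f \<in> I \<Longrightarrow> f \<in> null_RV"
  by (rule ps.span_base) simp

lemma dif_null_RV: assumes "f \<in> null_RV" shows "dif.der f \<in> null_RV"
  by (rule span_linear_mem[OF dif.der.linear_axioms ps.subspace_span assms])
    (auto simp: dif.der_one ps.span_zero intro: ideal_null_RV dif.der_ideal)

lemma chain_complex_RVbar: "chain_complex (RVbar R B)"
proof (rule linear_chain_complex[OF vector_space_pscale], unfold RVbar_simps)
  show "x \<in> rd n \<Longrightarrow> dif.der x \<in> rd (n - 1)" for x n using dif.der_rd[of x n] by simp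
  show "x \<in> rd n \<Longrightarrow> dif.der (dif.der x) \<in> null_RV" for x n
    using dif_dif_rep[of x n] by (intro ideal_null_RV) (simp add: q_zero_iff)
qed (simp_all add: dif.der.linear_axioms rd_subspace dif_null_RV)

abbreviation K :: "('k, 'r, 'v) rep_forms set" where "K \<equiv> kaehler_null R B"
abbreviation kd :: "int \<Rightarrow> ('k, 'r, 'v) rep_forms set" where "kd \<equiv> kaehler_deg R B"

lemma K_subspace: "ps.subspace K"
  by (simp add: kaehler_null_def ps.subspace_span)

lemma tensor_null_K: "tensor_null pscale \<subseteq> K"
  unfolding kaehler_null_def by (intro subsetI ps.span_base UnI1)

abbreviation \<kappa> :: "('k, 'r, 'v) rep_forms \<Rightarrow> ('k, 'r, 'v) rep_forms" where "\<kappa> \<equiv> mod_out K"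

sublocale \<kappa>: tensor_projection pscale \<kappa>
  by (rule tensor_projection_mod_out[OF vector_space_pscale K_subspace tensor_null_K])

lemma \<kappa>_zero_iff: "\<kappa> t = 0 \<longleftrightarrow> t \<in> K" by (rule mod_out[OF K_subspace])

lemma \<kappa>_eq_iff: "\<kappa> t = \<kappa> u \<longleftrightarrow> t - u \<in> K"
  using \<kappa>_zero_iff[of "t - u"] by (simp add: \<kappa>.\<pi>.diff)

lemma \<kappa>_ideal: "f \<in> I \<Longrightarrow> \<kappa> (tens f g) = 0" "g \<in> I \<Longrightarrow> \<kappa> (tens f g) = 0"
proof -
  have "tens f g \<in> K" if "f \<in> I \<or> g \<in> I"
    unfolding kaehler_null_def by (rule ps.span_base) (use that in blast)
  then show "f \<in> I \<Longrightarrow> \<kappa> (tens f g) = 0" "g \<in> I \<Longrightarrow> \<kappa> (tens f g) = 0"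
    by (simp_all only: \<kappa>_zero_iff simp_thms)
qed

lemma \<kappa>_cong: assumes "q f = q f'" "q g = q g'" shows "\<kappa> (tens f g) = \<kappa> (tens f' g')"
proof -
  have "\<kappa> (tens (f - f') g) = 0" "\<kappa> (tens f' (g - g')) = 0"
    using assms by (simp_all add: q_eq_iff \<kappa>_ideal)
  then show ?thesis by (simp add: \<kappa>.tens_simps)
qed

lemma \<kappa>_leibniz:
  assumes "f \<in> rd m" "g \<in> rd p" "h \<in> rd r"
  shows "\<kappa> (tens f (g * h)) = \<kappa> (tens (f * g) h) + pscale (ksign (p * r)) (\<kappa> (tens (f * h) g))"
proof -
  have "tens f (g * h) - (tens (f * g) h + pscale (ksign (p * r)) (tens (f * h) g)) \<in> K"
    unfolding kaehler_null_def using assms by (intro ps.span_base) blast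
  then show ?thesis unfolding \<kappa>_eq_iff[symmetric] by (simp add: \<kappa>.tens_simps)
qed

lemma \<kappa>_one: "f \<in> rd m \<Longrightarrow> \<kappa> (tens f 1) = 0"
  using \<kappa>_leibniz[OF _ one_rd one_rd, of f m] by simp

lemma kd_subspace: "ps.subspace (kd n)"
  by (simp add: kaehler_deg_def ps.subspace_span)

lemma tens_in_kd: "\<lbrakk>f \<in> rd p; g \<in> rd r; p + r = n\<rbrakk> \<Longrightarrow> tens f g \<in> kd n"
  unfolding kaehler_deg_def by (rule ps.span_base) blast

abbreviation dK :: "('k, 'r, 'v) rep_forms \<Rightarrow> ('k, 'r, 'v) rep_forms" where "dK \<equiv> kaehler_dif R"

lemma dK_alt: "dK = lin_ext pscale (\<lambda>(f, g). tens (dif.der f) g + tens (dif.par f) (dif.der g))"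
  by (simp add: kaehler_dif_def rep_dif_eq rep_parity_eq)

sublocale dK: Vector_Spaces.linear pscale pscale dK
  unfolding dK_alt by (rule lin_ext_linear[OF vector_space_pscale])

lemma dK_tens: "dK (tens f g) = tens (dif.der f) g + tens (dif.par f) (dif.der g)"
  by (simp add: dK_alt lin_ext_tens vector_space_pscale)

lemma dK_deg: assumes "t \<in> kd n" shows "dK t \<in> kd (n - 1)"
proof (rule span_linear_mem[OF dK.linear_axioms kd_subspace assms[unfolded kaehler_deg_def]])
  fix x :: "('k, 'r, 'v) rep_forms" assume "x \<in> {tens f g | f g p r. f \<in> rd p \<and> g \<in> rd r \<and> p + r = n}"
  then obtain f g p r where x: "x = tens f g" "f \<in> rd p" "g \<in> rd r" "p + r = n" by blast
  have "tens (dif.der f) g \<in> kd (n - 1)" "tens (dif.par f) (dif.der g) \<in> kd (n - 1)"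
    using tens_in_kd[OF dif.der_rd[OF x(2)] x(3), of "n - 1"] tens_in_kd[OF dif.par_rd[OF x(2)] dif.der_rd[OF x(3)], of "n - 1"] x(4)
    by (simp_all add: algebra_simps)
  then show "dK x \<in> kd (n - 1)" by (simp add: x(1) dK_tens ps.subspace_add[OF kd_subspace])
qed

lemma \<kappa>_par:
  assumes "f \<in> rd n" shows "\<kappa> (tens (dif.par f) g) = pscale (ksign n) (\<kappa> (tens f g))"
    "\<kappa> (tens g (dif.par f)) = pscale (ksign n) (\<kappa> (tens g f))"
proof -
  have *: "q (dif.par f) = q (ksign n * f)" using q_dif_par[OF assms] by (simp add: q_ksign)
  show "\<kappa> (tens (dif.par f) g) = pscale (ksign n) (\<kappa> (tens f g))"
    using \<kappa>_cong[OF * refl, of g] by (cases "even n") (simp_all add: \<kappa>.tens_simps)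
  show "\<kappa> (tens g (dif.par f)) = pscale (ksign n) (\<kappa> (tens g f))"
    using \<kappa>_cong[OF refl *, of g] by (cases "even n") (simp_all add: \<kappa>.tens_simps)
qed

lemma \<kappa>_par_mult:
  assumes "f \<in> rd n" shows "\<kappa> (tens (h * dif.par f) g) = pscale (ksign n) (\<kappa> (tens (h * f) g))"
    "\<kappa> (tens (dif.par f * h) g) = pscale (ksign n) (\<kappa> (tens (f * h) g))"
proof -
  have *: "q (dif.par f) = q (ksign n * f)" using q_dif_par[OF assms] by (simp add: q_ksign)
  show "\<kappa> (tens (h * dif.par f) g) = pscale (ksign n) (\<kappa> (tens (h * f) g))"
    using \<kappa>_cong[OF q_mult_cong[OF refl *] refl, of h g] by (cases "even n") (simp_all add: \<kappa>.tens_simps)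
  show "\<kappa> (tens (dif.par f * h) g) = pscale (ksign n) (\<kappa> (tens (f * h) g))"
    using \<kappa>_cong[OF q_mult_cong[OF * refl] refl, of h g] by (cases "even n") (simp_all add: \<kappa>.tens_simps)
qed

lemma \<kappa>_par_mult_right:
  assumes "f \<in> rd n" shows "\<kappa> (tens g (dif.par f * h)) = pscale (ksign n) (\<kappa> (tens g (f * h)))"
proof -
  have *: "q (dif.par f) = q (ksign n * f)" using q_dif_par[OF assms] by (simp add: q_ksign)
  show ?thesis
    using \<kappa>_cong[OF refl q_mult_cong[OF * refl], of g h] by (cases "even n") (simp_all add: \<kappa>.tens_simps)
qed

text \<open>
  The differential of the Leibniz relation for \<open>f, g, h\<close> is a combination of those for \<open>d f, g, h\<close>, for
  \<open>f, d g, h\<close> and for \<open>f, g, d h\<close>.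
\<close>

lemma dK_leibniz_relation:
  assumes f: "f \<in> rd m" and g: "g \<in> rd p" and h: "h \<in> rd r"
  shows "\<kappa> (dK (tens f (g * h) - (tens (f * g) h + pscale (ksign (p * r)) (tens (f * h) g)))) = 0"
proof -
  note df = dif.der_rd[OF f] and dg = dif.der_rd[OF g] and dh = dif.der_rd[OF h]
  note L = \<kappa>_leibniz[OF df g h] \<kappa>_leibniz[OF f dg h] \<kappa>_leibniz[OF f g dh]
  note S = dK.diff dK.add dK.scale dK_tens dif.der_mult dif.par_mult \<kappa>.tens_simps
    \<kappa>_par[OF f] \<kappa>_par_mult[OF f] \<kappa>_par_mult[OF g] \<kappa>_par_mult[OF h] \<kappa>_par_mult_right[OF g] L ps.scale_right_distrib
  show ?thesis
    by (cases "even m"; cases "even p"; cases "even r") (simp_all add: S)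
qed

lemma dK_K: assumes "t \<in> K" shows "dK t \<in> K"
proof (rule span_linear_mem[OF dK.linear_axioms K_subspace assms[unfolded kaehler_null_def]])
  fix x :: "('k, 'r, 'v) rep_forms"
  assume "x \<in> tensor_null pscale \<union> {tens f g | f g. f \<in> I \<or> g \<in> I}
     \<union> {tens f (g * h) - (tens (f * g) h + pscale (ksign (p * q)) (tens (f * h) g)) | f g h m p q.
          f \<in> rd m \<and> g \<in> rd p \<and> h \<in> rd q}"
  then consider "x \<in> tensor_null pscale" | f g where "x = tens f g" "f \<in> I \<or> g \<in> I"
    | f g h m p r where "x = tens f (g * h) - (tens (f * g) h + pscale (ksign (p * r)) (tens (f * h) g))"
       "f \<in> rd m" "g \<in> rd p" "h \<in> rd r" by blast
  then show "dK x \<in> K"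
  proof cases
    case 1
    then show ?thesis
      unfolding dK_alt
      by (intro bilinear_tensor_null[OF vector_space_pscale K_subspace])
        (simp_all add: \<kappa>_zero_iff[symmetric] \<kappa>.tens_simps dif.der.add dif.der.scale dif.par.add dif.par.scale
          ps.scale_right_distrib)
  next
    case 2
    then have "\<kappa> (dK x) = 0"
      using dif.der_ideal dif.par_ideal by (auto simp: dK_tens \<kappa>.\<pi>.add \<kappa>_ideal)
    then show ?thesis by (simp only: \<kappa>_zero_iff)
  next
    case 3
    then show ?thesis using dK_leibniz_relation[OF 3(2-4)] by (simp add: \<kappa>_zero_iff)
  qed
qed

lemma dK_dK: assumes "t \<in> kd n" shows "dK (dK t) \<in> K"
proof -
  have "\<kappa> (dK (dK t)) \<in> {0}"
  proof (rule span_linear_mem[OF _ ps.subspace_single_0 assms[unfolded kaehler_deg_def]])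
    show "Vector_Spaces.linear pscale pscale (\<lambda>t. \<kappa> (dK (dK t)))"
      by (rule linearI) (simp_all add: vector_space_pscale dK.add dK.scale \<kappa>.tens_simps)
    fix x :: "('k, 'r, 'v) rep_forms" assume "x \<in> {tens f g | f g p r. f \<in> rd p \<and> g \<in> rd r \<and> p + r = n}"
    then obtain f g p r where x: "x = tens f g" "f \<in> rd p" "g \<in> rd r" by blast
    have "dif.der (dif.der f) \<in> I" "dif.der (dif.der g) \<in> I"
      using dif_dif_rep[OF x(2)] dif_dif_rep[OF x(3)] by (simp_all add: q_zero_iff)
    moreover have "\<kappa> (tens (dif.par (dif.der f)) (dif.der g)) = \<kappa> (tens (- dif.der (dif.par f)) (dif.der g))"
      using q_par_of_dif[OF x(2)] q_dif_of_par[OF x(2)] by (intro \<kappa>_cong) (simp_all add: q.neg)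
    ultimately show "\<kappa> (dK (dK x)) \<in> {0}"
      by (simp add: x(1) dK_tens dK.add \<kappa>.tens_simps \<kappa>_ideal)
  qed
  then show ?thesis by (simp add: \<kappa>_zero_iff)
qed

lemma Omega_com_simps: "deg_part (Omega_com R B) = kd" "null_part (Omega_com R B) n = K" "differential (Omega_com R B) = dK"
  by (simp_all add: Omega_com_def)

lemma chain_complex_Omega_com: "chain_complex (Omega_com R B)"
  by (rule linear_chain_complex[OF vector_space_pscale])
    (simp_all add: Omega_com_simps dK.linear_axioms kd_subspace K_subspace dK_deg dK_K dK_dK)

lemma de_rham_null:
  assumes "f \<in> null_RV" shows "de_rham f \<in> K"
proof -
  have "\<kappa> (de_rham f) \<in> {0}"
  proof (rule span_linear_mem[OF _ ps.subspace_single_0 assms])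
    show "Vector_Spaces.linear pscale pscale (\<lambda>f. \<kappa> (de_rham f))"
      by (rule linearI) (simp_all add: vector_space_pscale de_rham_def \<kappa>.tens_simps)
  qed (auto simp: de_rham_def \<kappa>_ideal \<kappa>_one[OF one_rd])
  then show ?thesis by (simp add: \<kappa>_zero_iff)
qed

lemma de_rham_chain_map: "chain_map (RVbar R B) (Omega_com R B) de_rham"
proof -
  have 1: "de_rham (f - g) - (de_rham f - de_rham g) \<in> K" for f g
    unfolding \<kappa>_zero_iff[symmetric] by (simp add: de_rham_def \<kappa>.tens_simps)
  have 2: "de_rham (dif.der f) - dK (de_rham f) \<in> K" for f
    unfolding \<kappa>_zero_iff[symmetric] by (simp add: de_rham_def dK_tens dif.der_one dif.par_one \<kappa>.tens_simps)
  have 3: "de_rham f \<in> kd n" if "f \<in> rd n" for f n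
    using tens_in_kd[OF one_rd that, of n] by (simp add: de_rham_def)
  show ?thesis
    unfolding chain_map_def graded_map_def RVbar_simps Omega_com_simps using 1 2 3 de_rham_null by auto
qed

lemma periodic_XplusV: "periodic (RVbar R B) (Omega_com R B) (\<lambda>_. 0) de_rham"
proof -
  have z: "0 \<in> rd n" "0 \<in> null_RV" "0 \<in> K" "de_rham 0 \<in> K" for n
    using ps.subspace_0[OF rd_subspace] ps.span_zero ps.subspace_0[OF K_subspace] de_rham_null[OF ps.span_zero] by auto
  have "chain_map (Omega_com R B) (RVbar R B) (\<lambda>_. 0)"
    unfolding chain_map_def graded_map_def RVbar_simps Omega_com_simps using z by (simp add: dif.der.zero)
  then show ?thesis
    unfolding periodic_def RVbar_simps Omega_com_simps
    using z de_rham_chain_map chain_complex_RVbar chain_complex_Omega_com by (simp add: RVbar_simps)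
qed

text \<open>
  As \<open>de_rham\<close> is linear modulo \<open>K\<close>, the span in the definition of \<open>Split\<close> consists of the forms that are
  congruent to some \<open>de_rham \<rho>\<close>.
\<close>

lemma Split_eq: "Split R B = split_cplx (RVbar R B) (Omega_com R B) de_rham"
proof -
  have "ps.span (K \<union> de_rham ` rd m) = null_part (coker_cplx (RVbar R B) (Omega_com R B) de_rham) m" for m
  proof
    show "ps.span (K \<union> de_rham ` rd m) \<subseteq> null_part (coker_cplx (RVbar R B) (Omega_com R B) de_rham) m"
    proof
      fix t assume "t \<in> ps.span (K \<union> de_rham ` rd m)"
      then have "\<exists>\<rho> \<in> rd m. t - de_rham \<rho> \<in> K"
      proof (induction rule: ps.span_induct_alt)
        case base
        show ?case using de_rham_null[OF ps.span_zero] ps.subspace_0[OF rd_subspace] ps.subspace_neg[OF K_subspace]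
          by (intro bexI[of _ 0]) auto
      next
        case (step c y z)
        then obtain \<rho> where \<rho>: "\<rho> \<in> rd m" "z - de_rham \<rho> \<in> K" by blast
        obtain \<sigma> where \<sigma>: "\<sigma> \<in> rd m" "y - de_rham \<sigma> \<in> K"
          using step(1)
        proof
          assume "y \<in> K"
          then have "y - de_rham 0 \<in> K" using de_rham_null[OF ps.span_zero] by (intro ps.subspace_diff[OF K_subspace])
          then show thesis using that ps.subspace_0[OF rd_subspace] by blast
        next
          assume "y \<in> de_rham ` rd m"
          then show thesis using that ps.subspace_0[OF K_subspace] by auto
        qed
        have "\<kappa> (pscale c y + z - de_rham (pscale c \<sigma> + \<rho>)) = 0"
          using \<rho>(2) \<sigma>(2) unfolding \<kappa>_zero_iff[symmetric] by (simp add: de_rham_def \<kappa>.tens_simps)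
        then show ?case
          unfolding \<kappa>_zero_iff
          using ps.subspace_add[OF rd_subspace ps.subspace_scale[OF rd_subspace \<sigma>(1)] \<rho>(1)] by blast
      qed
      then show "t \<in> null_part (coker_cplx (RVbar R B) (Omega_com R B) de_rham) m"
        by (simp add: coker_cplx_def RVbar_simps Omega_com_simps)
    qed
    show "null_part (coker_cplx (RVbar R B) (Omega_com R B) de_rham) m \<subseteq> ps.span (K \<union> de_rham ` rd m)"
    proof
      fix t assume "t \<in> null_part (coker_cplx (RVbar R B) (Omega_com R B) de_rham) m"
      then obtain \<rho> where "\<rho> \<in> rd m" "t - de_rham \<rho> \<in> K"
        by (auto simp: coker_cplx_def RVbar_simps Omega_com_simps)
      then have "(t - de_rham \<rho>) + de_rham \<rho> \<in> ps.span (K \<union> de_rham ` rd m)"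
        by (intro ps.span_add ps.span_base) auto
      then show "t \<in> ps.span (K \<union> de_rham ` rd m)" by simp
    qed
  qed
  then show ?thesis
    by (simp add: Split_def split_cplx_def RVbar_simps Omega_com_simps rep_dif_eq)
qed

end

section \<open>The de Rham differential is injective\<close>

locale free_rep = free_dga R X + rep_algebra R B
  for R :: "('k::field_char_0, 'r::ring_1) dg_alg" and X and B :: "'v set"
begin

sublocale eu: skew_derivation R B euler "\<lambda>x. x" 0
  by standard (simp_all add: euler.linear_axioms euler_mult euler_piece V.linear_ident)

text \<open>
  Contraction of Kaehler differentials with the Euler derivation of \<open>R\<^sub>V\<close>.
\<close>

definition contract_rep :: "('k, 'r, 'v) rep_forms \<Rightarrow> ('k, 'r, 'v) rep_alg" where
  "contract_rep = lin_ext pscale (\<lambda>(f, g). f * eu.der g)"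

sublocale contract_rep: Vector_Spaces.linear pscale pscale contract_rep
  unfolding contract_rep_def by (rule lin_ext_linear[OF vector_space_pscale])

lemma contract_rep_tens: "contract_rep (tens f g) = f * eu.der g"
  by (simp add: contract_rep_def lin_ext_tens vector_space_pscale)

lemma map_rep_id: "eu.par f = f"
proof (induction f rule: pm_induct)
  case (add t w c)
  have "map (\<lambda>(x, i, j). (x, i, j)) ls = ls" for ls :: "('r \<times> 'v \<times> 'v) list" by (induction ls) auto
  with add show ?case by (simp add: eu.par.add eu.par_single pscale_single)
qed (simp add: eu.par.zero)

lemma contract_rep_K: assumes "t \<in> K" shows "contract_rep t \<in> I"
proof (rule span_linear_mem[OF contract_rep.linear_axioms ideal_subspace assms[unfolded kaehler_null_def]])
  fix x :: "('k, 'r, 'v) rep_forms"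
  assume "x \<in> tensor_null pscale \<union> {tens f g | f g. f \<in> I \<or> g \<in> I}
     \<union> {tens f (g * h) - (tens (f * g) h + pscale (ksign (p * q)) (tens (f * h) g)) | f g h m p q.
          f \<in> rd m \<and> g \<in> rd p \<and> h \<in> rd q}"
  then consider "x \<in> tensor_null pscale" | f g where "x = tens f g" "f \<in> I \<or> g \<in> I"
    | f g h m p r where "x = tens f (g * h) - (tens (f * g) h + pscale (ksign (p * r)) (tens (f * h) g))"
       "f \<in> rd m" "g \<in> rd p" "h \<in> rd r" by blast
  then show "contract_rep x \<in> I"
  proof cases
    case 1
    then show ?thesis
      unfolding contract_rep_def
      by (intro bilinear_tensor_null[OF vector_space_pscale ideal_subspace])
        (simp_all add: eu.der.add eu.der.scale distrib_left distrib_right pscale_mult ps.subspace_0[OF ideal_subspace])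
  next
    case 2
    then show ?thesis by (auto simp: contract_rep_tens ideal_mult eu.der_ideal)
  next
    case 3
    have "eu.der g \<in> rd p" using eu.der_rd[OF 3(3)] by simp
    then have "q (f * (eu.der g * h)) = q (f * (ksign (p * r) * (h * eu.der g)))"
      by (intro q_mult_cong q_commute 3 refl)
    then have "q (contract_rep x) = 0"
      by (cases "even (p * r)")
        (simp_all add: 3(1) contract_rep.diff contract_rep.add contract_rep.neg contract_rep_tens eu.der_mult map_rep_id
          distrib_left q.diff q.add q.neg mult.assoc)
    then show ?thesis by (simp only: q_zero_iff)
  qed
qed

text \<open>
  Eigenvectors of the Euler derivation modulo the relations, with only scalars in weight \<open>0\<close>. The
  homogeneous elements lie in their span, because a product of entries of words is one of them; its
  weight is the total length of the words.
\<close>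

definition weight_vectors :: "('k, 'r, 'v) rep_alg set" where
  "weight_vectors = {f. \<exists>m. eu.der f - pscale (of_nat m) f \<in> I \<and> (m = 0 \<longrightarrow> f \<in> null_RV)}"

lemma ideal_weight_vectors: "f \<in> I \<Longrightarrow> f \<in> weight_vectors"
  unfolding weight_vectors_def by (auto intro!: exI[of _ 0] eu.der_ideal ideal_null_RV)

lemma weight_vectors_cong:
  assumes "g \<in> weight_vectors" "q f = q g" shows "f \<in> weight_vectors"
proof -
  obtain m where m: "eu.der g - pscale (of_nat m) g \<in> I" "m = 0 \<longrightarrow> g \<in> null_RV"
    using assms(1) by (auto simp: weight_vectors_def)
  have fg: "f - g \<in> I" using assms(2) by (simp add: q_eq_iff)
  have "eu.der f - pscale (of_nat m) f = (eu.der (f - g) - pscale (of_nat m) (f - g)) + (eu.der g - pscale (of_nat m) g)"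
    by (simp add: eu.der.diff ps.scale_right_diff_distrib)
  also have "\<dots> \<in> I"
    by (intro ps.subspace_add[OF ideal_subspace] ps.subspace_diff[OF ideal_subspace] ps.subspace_scale[OF ideal_subspace]
        eu.der_ideal fg m(1))
  finally have "eu.der f - pscale (of_nat m) f \<in> I" .
  moreover have "f \<in> null_RV" if "m = 0"
    using ps.span_add[OF ideal_null_RV[OF fg], of g] m(2) that by simp
  ultimately show ?thesis by (auto simp: weight_vectors_def)
qed

lemma gen_weight_vectors:
  assumes w: "w \<in> lists X" and B: "i \<in> B" "j \<in> B" and f: "f \<in> weight_vectors"
  shows "gen (prod_list w) i j * f \<in> weight_vectors"
proof (cases "w = []")
  case True
  have *: "q (gen (prod_list w) i j * f) = q ((if i = j then 1 else 0) * f)"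
    using True B by (intro q_mult_cong) (simp_all add: q_gen_one)
  show ?thesis
    by (rule weight_vectors_cong[OF _ *]) (simp add: f ideal_weight_vectors ps.subspace_0[OF ideal_subspace])
next
  case False
  obtain m where m: "eu.der f - pscale (of_nat m) f \<in> I" using f by (auto simp: weight_vectors_def)
  let ?g = "gen (prod_list w) i j" and ?l = "length w"
  have g: "q (eu.der ?g) = q (pscale (of_nat ?l) ?g)"
    by (simp add: eu.der_gen euler_word[OF w] q_gen_scale B q.scale)
  have "q (eu.der f) = q (pscale (of_nat m) f)" using m by (simp add: q_eq_iff)
  from q_mult_cong[OF refl this, of ?g] q_mult_cong[OF g refl, of f]
  have "q (eu.der (?g * f) - pscale (of_nat (?l + m)) (?g * f)) = 0"
    by (simp add: eu.der_mult map_rep_id q.diff q.add q.scale pscale_mult ps.scale_left_distrib)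
  then have "eu.der (?g * f) - pscale (of_nat (?l + m)) (?g * f) \<in> I" by (simp only: q_zero_iff)
  moreover have "?l + m \<noteq> 0" using False by simp
  ultimately show ?thesis unfolding weight_vectors_def by blast
qed

lemma rd_weight_vectors: "f \<in> rd n \<Longrightarrow> f \<in> ps.span weight_vectors"
proof (induction rule: rd_induct)
  case one
  have "1 \<in> weight_vectors"
    unfolding weight_vectors_def by (auto intro!: exI[of _ 0] ps.span_base simp: eu.der_one ps.subspace_0[OF ideal_subspace])
  then show ?case by (rule ps.span_base)
next
  case (gen_mult m n x i j f)
  show ?case
  proof (induction x rule: word_induct)
    case (word w)
    have lin: "Vector_Spaces.linear pscale pscale (\<lambda>f. gen (prod_list w) i j * f :: ('k, 'r, 'v) rep_alg)"
      by (rule linearI) (simp_all add: vector_space_pscale distrib_left pscale_mult)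
    have "gen (prod_list w) i j * g \<in> ps.span weight_vectors" if "g \<in> weight_vectors" for g
      by (rule ps.span_base[OF gen_weight_vectors[OF word gen_mult(2,3) that]])
    from span_linear_mem[OF lin ps.subspace_span gen_mult(5) this] show ?case .
  next
    case zero
    have "gen 0 i j \<in> I" using q_gen_zero[OF gen_mult(2,3)] unfolding q_zero_iff .
    from ps.span_base[OF ideal_weight_vectors[OF ideal_mult(2)[OF this]]] show ?case .
  next
    case (add x y)
    have "gen (x + y) i j - (gen x i j + gen y i j) \<in> I"
      using q_gen_add[OF gen_mult(2,3)] by (simp add: q_eq_iff[symmetric] q.add)
    from ps.span_add[OF ps.span_base[OF ideal_weight_vectors[OF ideal_mult(2)[OF this, of f]]] ps.span_add[OF add(1,2)]]
    have "(gen (x + y) i j - (gen x i j + gen y i j)) * f + (gen x i j * f + gen y i j * f) \<in> ps.span weight_vectors" .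
    then show ?case by (simp add: algebra_simps)
  next
    case (scale c x)
    have "gen (scal R c x) i j - pscale c (gen x i j) \<in> I"
      using q_gen_scale[OF gen_mult(2,3)] by (simp add: q_eq_iff[symmetric] q.scale)
    from ps.span_add[OF ps.span_base[OF ideal_weight_vectors[OF ideal_mult(2)[OF this, of f]]] ps.span_scale[OF scale(1)]]
    have "(gen (scal R c x) i j - pscale c (gen x i j)) * f + pscale c (gen x i j * f) \<in> ps.span weight_vectors" .
    then show ?case by (simp add: algebra_simps pscale_mult)
  qed
qed (simp_all add: ps.span_zero ps.span_add ps.span_scale)

text \<open>
  The argument for \<open>kernel_univ_der\<close>, with the ideal of relations of \<open>R\<^sub>V\<close> instead of \<open>[R, R]\<close>.
\<close>

lemma de_rham_injective:
  assumes f: "f \<in> rd n" and null: "de_rham f \<in> K" shows "f \<in> null_RV"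
proof -
  have "eu.der f = contract_rep (de_rham f)" by (simp add: de_rham_def contract_rep_tens)
  then have df: "eu.der f \<in> I" using contract_rep_K[OF null] by simp
  have "weight_vectors \<subseteq> ps.span (insert 1 (I \<union> {v. \<exists>m>0. eu.der v - pscale (of_nat m) v \<in> I}))" (is "_ \<subseteq> ps.span ?W")
  proof
    fix v assume "v \<in> weight_vectors"
    then obtain m where m: "eu.der v - pscale (of_nat m) v \<in> I" "m = 0 \<longrightarrow> v \<in> null_RV"
      by (auto simp: weight_vectors_def)
    show "v \<in> ps.span ?W"
    proof (cases "m = 0")
      case True
      then show ?thesis using m(2) ps.span_mono[of "insert 1 I" ?W] by blast
    next
      case False
      then show ?thesis using m(1) by (intro ps.span_base) blast
    qed
  qed
  then have "f \<in> ps.span ?W" using rd_weight_vectors[OF f] ps.span_minimal[OF _ ps.subspace_span] by blast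
  from kernel_of_euler_operator[OF eu.der.linear_axioms ideal_subspace eu.der_ideal _ this df]
  show ?thesis by (simp add: eu.der_one ps.subspace_0[OF ideal_subspace])
qed

lemma split_periodic_XplusV: "split_periodic (RVbar R B) (Omega_com R B) de_rham"
  unfolding split_periodic_def split_periodic_axioms_def
  using periodic_XplusV de_rham_injective by (auto simp: RVbar_simps Omega_com_simps)

end

section \<open>Traces\<close>

context rep_algebra
begin

abbreviation tr :: "'r \<Rightarrow> ('k, 'r, 'v) rep_alg" where "tr \<equiv> tr_alg B"
abbreviation trf :: "('k, 'r) tensors \<Rightarrow> ('k, 'r, 'v) rep_forms" where "trf \<equiv> tr_form B"

lemma q_tr_add: "q (tr (x + y)) = q (tr x) + q (tr y)"
  and q_tr_scale: "q (tr (scal R c x)) = pscale c (q (tr x))"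
  and q_tr_diff: "q (tr (x - y)) = q (tr x) - q (tr y)"
  by (simp_all add: tr_alg_def q.sum q_gen_add q_gen_scale q_gen_diff sum.distrib sum_subtractf ps.scale_sum_right)

lemma q_tr_mult: "q (tr (x * y)) = (\<Sum>i\<in>B. \<Sum>l\<in>B. q (gen x i l * gen y l i))"
  by (simp add: tr_alg_def q.sum q_gen_mult)

text \<open>
  \<open>\<Sum> x\<^sub>i\<^sub>l y\<^sub>l\<^sub>i = \<plusminus> \<Sum> y\<^sub>l\<^sub>i x\<^sub>i\<^sub>l\<close> in the graded commutative algebra \<open>R\<^sub>V\<close>.
\<close>

lemma tr_commutator: "q (tr (commutator R x y)) = 0"
proof (induction x rule: homogeneous_induct)
  case x: (homogeneous m x)
  show ?case
  proof (induction y rule: homogeneous_induct)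
    case y: (homogeneous n y)
    have "(\<Sum>i\<in>B. \<Sum>l\<in>B. q (gen x i l * gen y l i)) = (\<Sum>i\<in>B. \<Sum>l\<in>B. q (ksign (m * n) * (gen y l i * gen x i l)))"
      by (intro sum.cong refl q_gen_commute x y)
    also have "\<dots> = (\<Sum>l\<in>B. \<Sum>i\<in>B. ksign (m * n) * q (gen y l i * gen x i l))"
      unfolding q_ksign by (rule sum.swap)
    also have "\<dots> = ksign (m * n) * q (tr (y * x))"
      by (simp add: q_tr_mult sum_distrib_left)
    finally have "q (tr (x * y)) = ksign (m * n) * q (tr (y * x))" by (simp add: q_tr_mult)
    moreover have "q (tr (ksign (m * n) * (y * x))) = ksign (m * n) * q (tr (y * x))"
      using q_tr_scale[of "ksign (m * n)" "y * x"] by (simp add: ksign_scal ksign_pscale)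
    ultimately show ?case by (simp add: commutator_homog[OF x y] q_tr_diff)
  qed (simp add: commutator_add q_tr_add)
qed (simp add: commutator_add q_tr_add)

lemma tr_one: "q (tr 1) = q (pscale (of_nat (card B)) 1)"
  by (simp add: tr_alg_def q.sum q_gen_one q.scale ps.sum_constant_scale del: sum_constant)

lemma tr_null:
  assumes "x \<in> V.span (insert 1 {commutator R x y | x y. True})" shows "tr x \<in> null_RV"
  using assms
proof (induction rule: V.span_induct_alt)
  case base
  have "q (tr 0) = 0" using q_tr_scale[of 0 0] by simp
  then show ?case by (intro ideal_null_RV) (simp only: q_zero_iff)
next
  case (step c y z)
  have y: "tr y \<in> null_RV"
  proof (cases "y = 1")
    case True
    have "tr 1 - pscale (of_nat (card B)) 1 \<in> null_RV"
      using tr_one by (intro ideal_null_RV) (simp only: q_eq_iff)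
    moreover have "pscale (of_nat (card B)) 1 \<in> null_RV" by (intro ps.span_scale ps.span_base) simp
    ultimately have "tr 1 - pscale (of_nat (card B)) 1 + pscale (of_nat (card B)) 1 \<in> null_RV" by (rule ps.span_add)
    then show ?thesis using True by simp
  next
    case False
    then obtain a b where ab: "y = commutator R a b" using step(1) by blast
    have "tr y \<in> I" using tr_commutator[of a b] unfolding ab q_zero_iff .
    then show ?thesis by (rule ideal_null_RV)
  qed
  have "tr (scal R c y + z) - (pscale c (tr y) + tr z) \<in> null_RV"
    by (intro ideal_null_RV) (simp add: q_eq_iff[symmetric] q_tr_add q_tr_scale q.add q.scale)
  from ps.span_add[OF this ps.span_add[OF ps.span_scale[OF y, of c] step(2)]]
  show ?case by simp
qed

lemma tr_deg: "x \<in> piece R n \<Longrightarrow> tr x \<in> rd n"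
  unfolding tr_alg_def by (intro ps.subspace_sum[OF rd_subspace] gen_rd)

lemma tr_dif: "dif.der (tr x) = tr (dif R x)"
  by (simp add: tr_alg_def dif.der.sum dif.der_gen)

lemma tr_diff_null: "tr (x - y) - (tr x - tr y) \<in> null_RV"
  by (intro ideal_null_RV) (simp add: q_eq_iff[symmetric] q_tr_diff q.diff)

lemma tr_chain_map_nat: "chain_map (Rbar_nat R) (RVbar R B) tr"
  unfolding chain_map_def graded_map_def Rbar_nat_simps RVbar_simps
  using tr_deg tr_diff_null tr_null by (simp add: tr_dif ps.span_zero)

lemma tr_chain_map: "chain_map (Rbar R) (RVbar R B) tr"
proof -
  have "V.span {1} \<subseteq> V.span (insert 1 {commutator R x y | x y. True})" by (rule V.span_mono) simp
  then have "tr x \<in> null_RV" if "x \<in> V.span {1}" for x using tr_null that by blast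
  then show ?thesis
    unfolding chain_map_def graded_map_def Rbar_simps RVbar_simps
    using tr_deg tr_diff_null by (simp add: tr_dif ps.span_zero)
qed

lemma tr_beta: "tr (beta R t) \<in> null_RV"
proof (rule tr_null, rule span_linear_mem[OF beta.linear_axioms V.subspace_span span_tens])
  fix x :: "('k, 'r) tensors" assume "x \<in> {tens a b | a b. True}"
  then obtain a b where x: "x = tens a b" by blast
  show "beta R x \<in> V.span (insert 1 {commutator R x y | x y. True})"
    unfolding x beta_tens by (rule V.span_base) blast
qed

lemma trf_alt: "trf t = lin_ext pscale (\<lambda>(a, b). \<Sum>i\<in>B. \<Sum>l\<in>B. tens (gen a i l) (gen b l i)) t"
proof (rule span_linear_eq[OF _ _ span_tens[of t]])
  show "Vector_Spaces.linear pscale pscale trf"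
    by (rule linearI) (simp_all add: vector_space_pscale tr_form_def form_matrix_def lin_ext_pscale sum.distrib ps.scale_sum_right)
  show "Vector_Spaces.linear pscale pscale (lin_ext pscale (\<lambda>(a, b). \<Sum>i\<in>B. \<Sum>l\<in>B. tens (gen a i l) (gen b l i)))"
    by (rule lin_ext_linear[OF vector_space_pscale])
  fix x :: "('k, 'r) tensors" assume "x \<in> {tens a b | a b. True}"
  then show "trf x = lin_ext pscale (\<lambda>(a, b). \<Sum>i\<in>B. \<Sum>l\<in>B. tens (gen a i l) (gen b l i)) x"
    by (auto simp: tr_form_def form_matrix_def lin_ext_tens vector_space_pscale)
qed

sublocale trf: Vector_Spaces.linear pscale pscale trf
  unfolding trf_alt[abs_def] by (rule lin_ext_linear[OF vector_space_pscale])

lemma trf_tens: "trf (tens a b) = (\<Sum>i\<in>B. \<Sum>l\<in>B. tens (gen a i l) (gen b l i))"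
  by (simp add: trf_alt lin_ext_tens vector_space_pscale)

lemma trf_deg: assumes "t \<in> tens_deg R n" shows "trf t \<in> kd n"
proof (rule span_linear_mem[OF trf.linear_axioms kd_subspace assms[unfolded tens_deg_def]])
  fix x :: "('k, 'r) tensors" assume "x \<in> {tens a b | a b p q. a \<in> piece R p \<and> b \<in> piece R q \<and> p + q = n}"
  then obtain a b p r where x: "x = tens a b" "a \<in> piece R p" "b \<in> piece R r" "p + r = n" by blast
  show "trf x \<in> kd n"
    unfolding x(1) trf_tens
    by (intro ps.subspace_sum[OF kd_subspace] tens_in_kd[OF gen_rd[OF x(2)] gen_rd[OF x(3)] x(4)])
qed

lemma trf_dif: "trf (tens_dif R t) = dK (trf t)"
proof (rule span_linear_eq[OF _ _ span_tens[of t]])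
  show "Vector_Spaces.linear pscale pscale (\<lambda>t. trf (tens_dif R t))" "Vector_Spaces.linear pscale pscale (\<lambda>t. dK (trf t))"
    by (auto intro!: linearI vector_space_pscale simp: trf.add trf.scale tdif.add tdif.scale dK.add dK.scale)
  fix x :: "('k, 'r) tensors" assume "x \<in> {tens a b | a b. True}"
  then show "trf (tens_dif R x) = dK (trf x)"
    by (auto simp: tdif_tens trf.add trf_tens dK.sum dK_tens dif.der_gen dif.par_gen sum.distrib)
qed

lemma \<kappa>_gen_simps:
  assumes "i \<in> B" "j \<in> B"
  shows "\<kappa> (tens (gen (x + y) i j) g) = \<kappa> (tens (gen x i j) g) + \<kappa> (tens (gen y i j) g)"
    "\<kappa> (tens f (gen (x + y) i j)) = \<kappa> (tens f (gen x i j)) + \<kappa> (tens f (gen y i j))"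
    "\<kappa> (tens (gen (scal R c x) i j) g) = pscale c (\<kappa> (tens (gen x i j) g))"
    "\<kappa> (tens f (gen (scal R c x) i j)) = pscale c (\<kappa> (tens f (gen x i j)))"
    "\<kappa> (tens (gen (x * y) i j) g) = (\<Sum>l\<in>B. \<kappa> (tens (gen x i l * gen y l j) g))"
    "\<kappa> (tens f (gen (x * y) i j)) = (\<Sum>l\<in>B. \<kappa> (tens f (gen x i l * gen y l j)))"
    "\<kappa> (tens (gen 1 i j) g) = (if i = j then \<kappa> (tens 1 g) else 0)"
    "\<kappa> (tens f (gen 1 i j)) = (if i = j then \<kappa> (tens f 1) else 0)"
proof -
  have a: "q (gen (x + y) i j) = q (gen x i j + gen y i j)" and s: "q (gen (scal R c x) i j) = q (pscale c (gen x i j))"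
    using assms by (simp_all add: q_gen_add q_gen_scale q.add q.scale)
  note m = q_gen_mult[OF assms, of x y] and o = q_gen_one[OF assms]
  show "\<kappa> (tens (gen (x + y) i j) g) = \<kappa> (tens (gen x i j) g) + \<kappa> (tens (gen y i j) g)"
    "\<kappa> (tens f (gen (x + y) i j)) = \<kappa> (tens f (gen x i j)) + \<kappa> (tens f (gen y i j))"
    "\<kappa> (tens (gen (scal R c x) i j) g) = pscale c (\<kappa> (tens (gen x i j) g))"
    "\<kappa> (tens f (gen (scal R c x) i j)) = pscale c (\<kappa> (tens f (gen x i j)))"
    "\<kappa> (tens (gen (x * y) i j) g) = (\<Sum>l\<in>B. \<kappa> (tens (gen x i l * gen y l j) g))"
    "\<kappa> (tens f (gen (x * y) i j)) = (\<Sum>l\<in>B. \<kappa> (tens f (gen x i l * gen y l j)))"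
    "\<kappa> (tens (gen 1 i j) g) = (if i = j then \<kappa> (tens 1 g) else 0)"
    "\<kappa> (tens f (gen 1 i j)) = (if i = j then \<kappa> (tens f 1) else 0)"
    using \<kappa>_cong[OF a refl, of g] \<kappa>_cong[OF refl a, of f] \<kappa>_cong[OF s refl, of g] \<kappa>_cong[OF refl s, of f]
      \<kappa>_cong[OF m refl, of g] \<kappa>_cong[OF refl m, of f] \<kappa>_cong[OF o refl, of g] \<kappa>_cong[OF refl o, of f]
    by (simp_all add: \<kappa>.tens_simps)
qed

lemma trf_tensor_null: assumes "t \<in> tensor_null (scal R)" shows "\<kappa> (trf t) = 0"
proof -
  have "trf t \<in> K"
    unfolding trf_alt
    by (rule bilinear_tensor_null[OF vector_space_pscale K_subspace _ _ _ _ assms])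
      (simp_all add: \<kappa>_zero_iff[symmetric] \<kappa>.\<pi>.sum \<kappa>.\<pi>.diff \<kappa>.\<pi>.add \<kappa>.\<pi>.scale \<kappa>_gen_simps sum.distrib ps.scale_sum_right)
  then show ?thesis by (simp only: \<kappa>_zero_iff)
qed

text \<open>
  For \<open>\<omega> = \<Sum> a \<partial>b\<close> the trace of \<open>\<omega> x\<close> is \<open>\<Sum> a\<^sub>j\<^sub>l \<partial>(b\<^sub>l\<^sub>i x\<^sub>i\<^sub>j)\<close>. In its expansion by the Leibniz rule, one half is
  up to sign the trace of \<open>x \<omega>\<close>, and the other is \<open>\<Sum> (a b)\<^sub>j\<^sub>i \<partial>x\<^sub>i\<^sub>j\<close>, which vanishes on \<open>\<Omega>\<^sup>1(R)\<close>.
\<close>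

lemma trf_cyclic:
  assumes x: "x \<in> piece R m" and w: "\<omega> \<in> tens_deg R n"
  shows "\<kappa> (trf (lact x \<omega> - pscale (ksign (m * n)) (ract \<omega> x)))
    = - pscale (ksign (m * n)) (\<Sum>j\<in>B. \<Sum>i\<in>B. \<kappa> (tens (gen (tens_mult R \<omega>) j i) (gen x i j)))"
proof (rule span_linear_eq[OF _ _ w[unfolded tens_deg_def]])
  show "Vector_Spaces.linear pscale pscale (\<lambda>\<omega>. \<kappa> (trf (lact x \<omega> - pscale (ksign (m * n)) (ract \<omega> x))))"
    by (rule linearI) (simp_all add: vector_space_pscale lact_simps ract_simps trf.add trf.diff trf.scale \<kappa>.tens_simps
        ps.scale_right_distrib ps.scale_right_diff_distrib mult.commute)
  show "Vector_Spaces.linear pscale pscale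
     (\<lambda>\<omega>. - pscale (ksign (m * n)) (\<Sum>j\<in>B. \<Sum>i\<in>B. \<kappa> (tens (gen (tens_mult R \<omega>) j i) (gen x i j))))"
    by (rule linearI) (simp_all add: vector_space_pscale tmult.add tmult.scale \<kappa>_gen_simps sum.distrib
        ps.scale_right_distrib ps.scale_sum_right[symmetric] mult.commute)
  fix t :: "('k, 'r) tensors" assume "t \<in> {tens a b | a b p q. a \<in> piece R p \<and> b \<in> piece R q \<and> p + q = n}"
  then obtain a b p r where t: "t = tens a b" "a \<in> piece R p" "b \<in> piece R r" "n = p + r" by blast
  let ?s = "ksign (m * n) :: 'k"
  define A where "A = (\<Sum>i\<in>B. \<Sum>l\<in>B. \<Sum>j\<in>B. \<kappa> (tens (gen x i j * gen a j l) (gen b l i)))"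
  define G where "G = (\<Sum>j\<in>B. \<Sum>i\<in>B. \<Sum>l\<in>B. \<kappa> (tens (gen a j l * gen b l i) (gen x i j)))"
  have 1: "\<kappa> (trf (lact x t)) = A"
    by (simp add: t(1) lact_simps trf_tens \<kappa>.\<pi>.sum \<kappa>_gen_simps A_def)
  have 2: "\<kappa> (tens (gen a j l) (gen b l i * gen x i j))
      = \<kappa> (tens (gen a j l * gen b l i) (gen x i j)) + pscale ?s (\<kappa> (tens (gen x i j * gen a j l) (gen b l i)))"
    if B: "i \<in> B" "j \<in> B" "l \<in> B" for i j l
  proof -
    have "\<kappa> (tens (gen a j l * gen x i j) (gen b l i)) = \<kappa> (tens (ksign (p * m) * (gen x i j * gen a j l)) (gen b l i))"
      by (rule \<kappa>_cong[OF q_gen_commute[OF t(2) x] refl]) (use B in simp_all)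
    then show ?thesis
      using \<kappa>_leibniz[OF gen_rd[OF t(2)] gen_rd[OF t(3)] gen_rd[OF x], of j l l i i j] B t(4)
      by (cases "even m"; cases "even p"; cases "even r") (simp_all add: \<kappa>.tens_simps)
  qed
  have "\<kappa> (trf (ract t x)) = (\<Sum>j\<in>B. \<Sum>l\<in>B. \<Sum>i\<in>B. \<kappa> (tens (gen a j l) (gen b l i * gen x i j)))"
    by (simp add: t(1) ract_simps trf_tens \<kappa>.\<pi>.sum \<kappa>_gen_simps)
  also have "\<dots> = (\<Sum>j\<in>B. \<Sum>l\<in>B. \<Sum>i\<in>B. \<kappa> (tens (gen a j l * gen b l i) (gen x i j))
      + pscale ?s (\<kappa> (tens (gen x i j * gen a j l) (gen b l i))))"
    by (intro sum.cong refl 2)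
  also have "\<dots> = (\<Sum>j\<in>B. \<Sum>l\<in>B. \<Sum>i\<in>B. \<kappa> (tens (gen a j l * gen b l i) (gen x i j)))
      + pscale ?s (\<Sum>j\<in>B. \<Sum>l\<in>B. \<Sum>i\<in>B. \<kappa> (tens (gen x i j * gen a j l) (gen b l i)))"
    by (simp add: sum.distrib ps.scale_sum_right)
  also have "(\<Sum>j\<in>B. \<Sum>l\<in>B. \<Sum>i\<in>B. \<kappa> (tens (gen a j l * gen b l i) (gen x i j))) = G"
    unfolding G_def by (intro sum.cong refl sum.swap)
  also have "(\<Sum>j\<in>B. \<Sum>l\<in>B. \<Sum>i\<in>B. \<kappa> (tens (gen x i j * gen a j l) (gen b l i))) = A"
  proof -
    have "(\<Sum>j\<in>B. \<Sum>l\<in>B. \<Sum>i\<in>B. \<kappa> (tens (gen x i j * gen a j l) (gen b l i)))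
        = (\<Sum>j\<in>B. \<Sum>i\<in>B. \<Sum>l\<in>B. \<kappa> (tens (gen x i j * gen a j l) (gen b l i)))"
      by (intro sum.cong refl sum.swap)
    also have "\<dots> = (\<Sum>i\<in>B. \<Sum>j\<in>B. \<Sum>l\<in>B. \<kappa> (tens (gen x i j * gen a j l) (gen b l i)))" by (rule sum.swap)
    also have "\<dots> = A" unfolding A_def by (intro sum.cong refl sum.swap)
    finally show ?thesis .
  qed
  finally have 3: "\<kappa> (trf (ract t x)) = G + pscale ?s A" .
  have "(\<Sum>j\<in>B. \<Sum>i\<in>B. \<kappa> (tens (gen (tens_mult R t) j i) (gen x i j))) = G"
    by (simp add: t(1) tmult_tens \<kappa>_gen_simps G_def)
  then show "\<kappa> (trf (lact x t - pscale ?s (ract t x)))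
      = - pscale ?s (\<Sum>j\<in>B. \<Sum>i\<in>B. \<kappa> (tens (gen (tens_mult R t) j i) (gen x i j)))"
    by (cases "even (m * n)") (simp_all add: trf.diff trf.scale trf.add trf.neg \<kappa>.\<pi>.diff \<kappa>.\<pi>.scale \<kappa>.\<pi>.add \<kappa>.\<pi>.neg 1 3)
qed

lemma trf_form_null: assumes "t \<in> form_null" shows "trf t \<in> K"
proof (rule span_linear_mem[OF trf.linear_axioms K_subspace assms[unfolded form_null_def]])
  fix t assume "t \<in> tensor_null (scal R) \<union>
     {lact x \<omega> - pscale (ksign (m * n)) (ract \<omega> x) | x \<omega> m n. x \<in> piece R m \<and> \<omega> \<in> deg_part (Omega R) n}"
  then consider "t \<in> tensor_null (scal R)" | x \<omega> m n where
    "t = lact x \<omega> - pscale (ksign (m * n)) (ract \<omega> x)" "x \<in> piece R m" "\<omega> \<in> deg_part (Omega R) n" by blast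
  then have "\<kappa> (trf t) = 0"
  proof cases
    case 2
    have w: "\<omega> \<in> tens_deg R n" "tens_mult R \<omega> = 0" using 2(3) by (simp_all add: Omega_deg)
    have "\<kappa> (tens (gen 0 j i) g) = 0" if "i \<in> B" "j \<in> B" for i j g
      using q_gen_zero[OF that(2,1)] by (intro \<kappa>_ideal) (simp only: q_zero_iff)
    then show ?thesis unfolding 2(1) trf_cyclic[OF 2(2) w(1)] w(2) by simp
  qed (rule trf_tensor_null)
  then show "trf t \<in> K" by (simp only: \<kappa>_zero_iff)
qed

lemma trf_chain_map: "chain_map (Omega_nat R) (Omega_com R B) trf"
  by (rule linear_chain_mapI[OF trf.linear_axioms])
    (simp_all add: Omega_nat_simps Omega_com_simps K_subspace Omega_deg trf_deg trf_form_null trf_dif ps.subspace_0[OF K_subspace])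

text \<open>
  The two summands \<open>1 \<otimes> x\<close> and \<open>x \<otimes> 1\<close> of \<open>\<partial>x\<close> have the traces \<open>\<Sum> \<partial>x\<^sub>i\<^sub>i\<close> and \<open>\<Sum> x\<^sub>i\<^sub>i \<partial>1 = 0\<close>.
\<close>

lemma trf_univ_der:
  assumes x: "x \<in> piece R n" shows "trf (univ_der x) - de_rham (tr x) \<in> K"
proof -
  have "\<kappa> (trf (univ_der x)) = (\<Sum>i\<in>B. \<kappa> (tens 1 (gen x i i)) - \<kappa> (tens (gen x i i) 1))"
    using finite_B by (simp add: univ_der_def trf.diff trf_tens \<kappa>.\<pi>.diff \<kappa>.\<pi>.sum \<kappa>_gen_simps sum_subtractf)
  also have "\<dots> = (\<Sum>i\<in>B. \<kappa> (tens 1 (gen x i i)))"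
    by (intro sum.cong refl) (simp add: \<kappa>_one[OF gen_rd[OF x]])
  also have "\<dots> = \<kappa> (de_rham (tr x))" by (simp add: de_rham_def tr_alg_def \<kappa>.tens_simps)
  finally show ?thesis by (simp add: \<kappa>_eq_iff)
qed

definition Tr_X :: "(nat \<Rightarrow> 'r \<times> ('k, 'r) tensors) \<Rightarrow> nat \<Rightarrow> ('k, 'r, 'v) rep_alg \<times> ('k, 'r, 'v) rep_forms" where
  "Tr_X u j = (tr (fst (u j)), trf (snd (u j)))"

lemma Tr_X_chain_map: "chain_map (Xplus R) (XplusV R B) Tr_X"
proof -
  have "Tr_X = (\<lambda>u j. (tr (fst (u j)), trf (snd (u j))))" by (intro ext) (simp add: Tr_X_def)
  then show ?thesis
    unfolding Xplus_def XplusV_def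
    using Tot_chain_map[OF periodic_Xplus periodic_XplusV tr_chain_map trf_chain_map]
    by (simp add: Rbar_simps RVbar_simps Omega_nat_simps Omega_com_simps tr_beta trf_univ_der)
qed

end

section \<open>The two commuting squares\<close>

context free_rep
begin

interpretation EX: exact_periodic "Rbar R" "Omega_nat R" "beta R" univ_der "Rbar_nat R"
  by (rule exact_periodic_Xplus)
interpretation SP: split_periodic "RVbar R B" "Omega_com R B" de_rham
  by (rule split_periodic_XplusV)
interpretation TX: chain_map_between "Xplus R" "XplusV R B" Tr_X
  using Tr_X_chain_map EX.chain_complex_Tot SP.chain_complex_Tot by (simp add: chain_map_between_def Xplus_def XplusV_def)
interpretation TR: chain_map_between "Rbar_nat R" "RVbar R B" tr
  using tr_chain_map_nat chain_complex_Rbar_nat chain_complex_RVbar by (simp add: chain_map_between_def)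

lemma HC_redE:
  assumes "c \<in> HC_red R n"
  obtains r u where "r \<in> cycles (Rbar_nat R) n" "c = r +o boundaries (Rbar_nat R) n" "EX.lifts n r u"
  using assms EX.lift_exists unfolding homology_def by blast

lemma connes_S_class:
  assumes "r \<in> cycles (Rbar_nat R) n" "EX.lifts n r u"
  shows "connes_S R n (r +o boundaries (Rbar_nat R) n) = fst (shift2 u 0) +o boundaries (Rbar_nat R) (n - 2)"
  unfolding connes_S_def cycle_lift_def Xplus_def by (rule EX.periodicity_class[OF assms(2,1)])

lemma connes_B_class:
  assumes "r \<in> cycles (Rbar_nat R) n"
  shows "connes_B R n (r +o boundaries (Rbar_nat R) n) = (0, univ_der r) +o boundaries (X2plus R) (n + 1)"
  unfolding connes_B_def cycle_lift_def Xplus_def X2plus_def by (rule EX.connecting_class[OF assms])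

text \<open>
  Lifts of homologous cycles differ by a boundary (\<open>lift_unique\<close>), and \<open>Tr_X\<close> is a chain map. The inverse of
  \<open>split_iso\<close> cancels \<open>to_split\<close>.
\<close>

lemma Tr_tilde_class:
  assumes r: "r \<in> cycles (Rbar_nat R) n" and u: "EX.lifts n r u"
  shows "Tr_tilde R B n (r +o boundaries (Rbar_nat R) n) = Tr_X u +o boundaries (XplusV R B) n"
proof -
  have "induced SP.S n (\<lambda>r y. \<exists>u. EX.lifts n r u \<and> y = to_split (Tr_X u)) (r +o boundaries (Rbar_nat R) n)
      = to_split (Tr_X u) +o boundaries SP.S n"
  proof (rule EX.induced_lift_class[OF SP.chain_complex_S u r])
    fix u u' assume h: "u - u' \<in> boundaries EX.T n" "u \<in> cycles EX.T n" "u' \<in> cycles EX.T n"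
    then have "Tr_X u - Tr_X u' \<in> boundaries SP.T n"
      using TX.boundaries_diff[of u n u'] unfolding Xplus_def XplusV_def by blast
    moreover have "Tr_X u \<in> cycles SP.T n" "Tr_X u' \<in> cycles SP.T n"
      using h TX.cycles[of _ n] unfolding Xplus_def XplusV_def by blast+
    ultimately show "to_split (Tr_X u) - to_split (Tr_X u') \<in> boundaries SP.S n"
      by (intro SP.to_split.boundaries_diff)
  qed
  moreover have "to_split (Tr_X u) = (tr (fst (u 0)), \<lambda>j. trf (snd (u j)))" for u
    by (simp add: to_split_def Tr_X_def)
  moreover have "Tr_X u \<in> cycles SP.T n" using u TX.cycles[of u n] unfolding Xplus_def XplusV_def by blast
  ultimately show ?thesis
    unfolding Tr_tilde_def split_iso_def Split_eq XplusV_def cycle_lift_def Xplus_def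
    using SP.split_iso_inv[of "Tr_X u" n] by simp
qed

lemma S_rep_class:
  assumes v: "v \<in> cycles (XplusV R B) n"
  shows "S_rep R B n (v +o boundaries (XplusV R B) n) = shift2 v +o boundaries (XplusV R B) (n - 2)"
proof -
  have v': "v \<in> cycles SP.T n" using v by (simp add: XplusV_def)
  have "induced SP.S (n - 2)
        (\<lambda>(r, \<omega>) (r', \<omega>'). r' \<in> rd (n - 2) \<and> de_rham r' - dK (\<omega> 0) \<in> K \<and> (\<forall>j. \<omega>' j = \<omega> (Suc j)))
        (to_split v +o boundaries SP.S n) = to_split (shift2 v) +o boundaries SP.S (n - 2)"
    using SP.split_periodicity[OF v'] by (simp only: RVbar_simps Omega_com_simps)
  then show ?thesis
    unfolding S_rep_def split_iso_def Split_eq XplusV_def SP.to_split.induced_map_class[OF v']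
    using SP.split_iso_inv[OF SP.shift2_cycles[OF v']] by simp
qed

text \<open>
  Projection to the second component anticommutes with the differentials, because the internal
  differential on forms has the opposite sign in \<open>Tot\<close>. So the boundary of
  \<open>(s, \<eta>)\<close> is sent to the boundary of the trace of \<open>- \<eta>\<close>.
\<close>

lemma Tr_HH_class:
  assumes z: "z \<in> cycles (X2plus R) (n + 1)"
  shows "Tr_HH R B n (z +o boundaries (X2plus R) (n + 1)) = trf (snd z) +o boundaries (Omega_com R B) n"
    and "trf (snd z) \<in> cycles (Omega_com R B) n"
proof -
  have X2: "chain_complex (X2plus R)" unfolding X2plus_def by (rule EX.chain_complex_Tot2)
  show "Tr_HH R B n (z +o boundaries (X2plus R) (n + 1)) = trf (snd z) +o boundaries (Omega_com R B) n"
    unfolding Tr_HH_def induced_map_def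
  proof (rule induced_class[OF X2 chain_complex_Omega_com])
    show "trf (snd z) = (case z of (r, \<omega>) \<Rightarrow> trf \<omega>)" by (simp add: case_prod_unfold)
    fix x y assume x: "x - z \<in> boundaries (X2plus R) (n + 1)" and y: "y = (case x of (r, \<omega>) \<Rightarrow> trf \<omega>)"
    obtain v where v: "v \<in> deg_part (X2plus R) (n + 1 + 1)"
      "x - z - differential (X2plus R) v \<in> null_part (X2plus R) (n + 1)" "x - z \<in> deg_part (X2plus R) (n + 1)"
      using x unfolding boundaries_def by blast
    obtain s \<eta> where [simp]: "v = (s, \<eta>)" by (cases v)
    have \<eta>: "\<eta> \<in> deg_part (Omega R) (n + 1)" using v(1) by (auto simp: X2plus_def Tot2_def Omega_nat_simps add.commute)
    have d: "snd x - snd z + tens_dif R \<eta> \<in> form_null" "snd x - snd z \<in> deg_part (Omega R) n"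
      using v(2,3) by (auto simp: X2plus_def Tot2_def Omega_nat_simps mem_Times_iff)
    have "y - trf (snd z) - dK (trf (- \<eta>)) = trf (snd x - snd z + tens_dif R \<eta>)"
      by (simp add: y case_prod_unfold trf.add trf.diff trf.neg dK.neg trf_dif)
    then have 1: "y - trf (snd z) - dK (trf (- \<eta>)) \<in> K" using trf_form_null[OF d(1)] by simp
    have "\<eta> \<in> tens_deg R (n + 1)" "snd x - snd z \<in> tens_deg R n" using \<eta> d(2) unfolding Omega_deg by blast+
    from trf_deg[OF this(1)] trf_deg[OF this(2)]
    have 2: "trf (- \<eta>) \<in> kd (n + 1)" "y - trf (snd z) \<in> kd n"
      by (simp_all only: trf.neg y case_prod_unfold trf.diff ps.subspace_neg[OF kd_subspace])
    from 2(1) 1 2(2) show "y - trf (snd z) \<in> boundaries (Omega_com R B) n"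
      by (intro boundariesI[of "trf (- \<eta>)"]) (simp_all only: Omega_com_simps)
  qed
  have "snd z \<in> deg_part (Omega R) n" "- tens_dif R (snd z) \<in> form_null"
    using z by (auto simp: cycles_def X2plus_def Tot2_def Omega_nat_simps mem_Times_iff case_prod_unfold)
  then have "trf (snd z) \<in> kd n" "- dK (trf (snd z)) \<in> K"
    using trf_deg[of "snd z" n] trf_form_null[of "- tens_dif R (snd z)"]
    unfolding Omega_deg trf.neg trf_dif by blast+
  moreover from this(2) have "dK (trf (snd z)) \<in> K"
    using ps.subspace_neg[OF K_subspace, of "- dK (trf (snd z))"] by simp
  ultimately show "trf (snd z) \<in> cycles (Omega_com R B) n"
    by (simp add: cycles_def Omega_com_simps)
qed

lemma periodicity_square:
  shows "connes_S R n \<in> HC_red R n \<rightarrow> HC_red R (n - 2)"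
    and "Tr_tilde R B n \<in> HC_red R n \<rightarrow> HC_rep R B n"
    and "S_rep R B n \<in> HC_rep R B n \<rightarrow> HC_rep R B (n - 2)"
    and "c \<in> HC_red R n \<Longrightarrow> S_rep R B n (Tr_tilde R B n c) = Tr_tilde R B (n - 2) (connes_S R n c)"
proof -
  have lift: "fst (shift2 u 0) \<in> cycles (Rbar_nat R) (n - 2) \<and> EX.lifts (n - 2) (fst (shift2 u 0)) (shift2 u)"
    if "EX.lifts n r u" for r u
  proof -
    have "shift2 u \<in> cycles EX.T (n - 2)" by (rule EX.shift2_cycles[OF conjunct1[OF that]])
    moreover from this have "fst (shift2 u 0) \<in> cycles (Rbar_nat R) (n - 2)" by (rule EX.fst_cycle)
    moreover have "fst (shift2 u 0) - fst (shift2 u 0) \<in> null_part (Rbar_nat R) (n - 2)"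
      using subgrp_zero[OF EX.nQ] by (simp only: diff_self)
    ultimately show ?thesis by blast
  qed
  have tr: "Tr_X u \<in> cycles (XplusV R B) n" if "EX.lifts n r u" for r u
    using TX.cycles[of u n] conjunct1[OF that] unfolding Xplus_def .
  show "connes_S R n \<in> HC_red R n \<rightarrow> HC_red R (n - 2)"
  proof
    fix c assume "c \<in> HC_red R n"
    then obtain r u where "r \<in> cycles (Rbar_nat R) n" "c = r +o boundaries (Rbar_nat R) n" "EX.lifts n r u"
      by (rule HC_redE)
    then show "connes_S R n c \<in> HC_red R (n - 2)" using lift connes_S_class unfolding homology_def by blast
  qed
  show "Tr_tilde R B n \<in> HC_red R n \<rightarrow> HC_rep R B n"
  proof
    fix c assume "c \<in> HC_red R n"
    then obtain r u where "r \<in> cycles (Rbar_nat R) n" "c = r +o boundaries (Rbar_nat R) n" "EX.lifts n r u"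
      by (rule HC_redE)
    then show "Tr_tilde R B n c \<in> HC_rep R B n" using tr Tr_tilde_class unfolding homology_def by blast
  qed
  show "S_rep R B n \<in> HC_rep R B n \<rightarrow> HC_rep R B (n - 2)"
  proof
    fix h assume "h \<in> HC_rep R B n"
    then obtain v where v: "v \<in> cycles (XplusV R B) n" "h = v +o boundaries (XplusV R B) n" unfolding homology_def by blast
    have "shift2 v \<in> cycles (XplusV R B) (n - 2)" using SP.shift2_cycles v(1) by (simp add: XplusV_def)
    then show "S_rep R B n h \<in> HC_rep R B (n - 2)" unfolding v(2) S_rep_class[OF v(1)] homology_def by blast
  qed
  show "S_rep R B n (Tr_tilde R B n c) = Tr_tilde R B (n - 2) (connes_S R n c)" if c: "c \<in> HC_red R n"
  proof -
    obtain r u where r: "r \<in> cycles (Rbar_nat R) n" "c = r +o boundaries (Rbar_nat R) n" and u: "EX.lifts n r u"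
      by (rule HC_redE[OF c])
    have eq: "shift2 (Tr_X u) = Tr_X (shift2 u)" by (intro ext) (simp add: shift2_def Tr_X_def)
    show ?thesis
      unfolding r(2) Tr_tilde_class[OF r(1) u] S_rep_class[OF tr[OF u]] connes_S_class[OF r(1) u] eq
        Tr_tilde_class[OF conjunct1[OF lift[OF u]] conjunct2[OF lift[OF u]]] ..
  qed
qed

lemma connes_square:
  shows "connes_B R n \<in> HC_red R n \<rightarrow> HH_red R (n + 1)"
    and "Tr_HC R B n \<in> HC_red R n \<rightarrow> H_rep R B n"
    and "Tr_HH R B n \<in> HH_red R (n + 1) \<rightarrow> H_forms R B n"
    and "B_rep R B n \<in> H_rep R B n \<rightarrow> H_forms R B n"
    and "c \<in> HC_red R n \<Longrightarrow> B_rep R B n (Tr_HC R B n c) = Tr_HH R B n (connes_B R n c)"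
proof -
  have cyc: "(0, univ_der r) \<in> cycles (X2plus R) (n + 1)" if "r \<in> cycles (Rbar_nat R) n" for r
    unfolding X2plus_def by (rule EX.connecting_cycle[OF that])
  show "connes_B R n \<in> HC_red R n \<rightarrow> HH_red R (n + 1)"
    using connes_B_class cyc unfolding homology_def by blast
  show "Tr_HC R B n \<in> HC_red R n \<rightarrow> H_rep R B n"
    unfolding Tr_HC_def by (rule TR.induced_map_homology)
  show "Tr_HH R B n \<in> HH_red R (n + 1) \<rightarrow> H_forms R B n"
    using Tr_HH_class unfolding homology_def by blast
  show "B_rep R B n \<in> H_rep R B n \<rightarrow> H_forms R B n"
    unfolding B_rep_def by (rule SP.e.induced_map_homology)
  assume "c \<in> HC_red R n"
  then obtain r where r: "r \<in> cycles (Rbar_nat R) n" "c = r +o boundaries (Rbar_nat R) n"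
    unfolding homology_def by blast
  have rp: "r \<in> piece R n" using r(1) by (simp add: cycles_def Rbar_nat_simps)
  have "de_rham (tr r) - trf (univ_der r) \<in> boundaries (Omega_com R B) n"
  proof (rule null_is_boundary[OF chain_complex_Omega_com])
    have "univ_der r \<in> tens_deg R n" using univ_der_deg[OF rp] unfolding Omega_deg by blast
    then have "trf (univ_der r) \<in> kd n" by (rule trf_deg)
    moreover have "de_rham (tr r) \<in> kd n"
      using tens_in_kd[OF one_rd tr_deg[OF rp], of n] by (simp add: de_rham_def)
    ultimately show "de_rham (tr r) - trf (univ_der r) \<in> deg_part (Omega_com R B) n"
      unfolding Omega_com_simps by (intro ps.subspace_diff[OF kd_subspace])
    show "de_rham (tr r) - trf (univ_der r) \<in> null_part (Omega_com R B) n"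
      using ps.subspace_neg[OF K_subspace trf_univ_der[OF rp]] unfolding Omega_com_simps minus_diff_eq .
  qed
  note eq = homology_class_eq[OF chain_complex_Omega_com this]
  show "B_rep R B n (Tr_HC R B n c) = Tr_HH R B n (connes_B R n c)"
    unfolding r(2) Tr_HC_def TR.induced_map_class[OF r(1)] B_rep_def SP.e.induced_map_class[OF TR.cycles[OF r(1)]]
      connes_B_class[OF r(1)] Tr_HH_class(1)[OF cyc[OF r(1)]] snd_conv by (rule eq)
qed

end

theorem theorem5p2:
  fixes R :: "('k::field_char_0, 'r::ring_1) dg_alg"
    and sA :: "'k \<Rightarrow> 'a::{ring, monoid_mult} \<Rightarrow> 'a"
    and p :: "'r \<Rightarrow> 'a"
    and sV :: "'k \<Rightarrow> 'v::ab_group_add \<Rightarrow> 'v"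
    and B :: "'v set"
    and n :: int
  assumes "k_algebra sA"
    and "almost_free_resolution R sA p"
    and "finite_dimensional_vector_space sV B"
    and "\<exists>v::'v. v \<noteq> 0"
    and "n \<ge> 0"
  shows
    "(connes_S R n \<in> HC_red R n \<rightarrow> HC_red R (n - 2) \<and>
      Tr_tilde R B n \<in> HC_red R n \<rightarrow> HC_rep R B n \<and>
      Tr_tilde R B (n - 2) \<in> HC_red R (n - 2) \<rightarrow> HC_rep R B (n - 2) \<and>
      S_rep R B n \<in> HC_rep R B n \<rightarrow> HC_rep R B (n - 2) \<and>
      (\<forall>c \<in> HC_red R n. S_rep R B n (Tr_tilde R B n c) = Tr_tilde R B (n - 2) (connes_S R n c))) \<and>
     (connes_B R n \<in> HC_red R n \<rightarrow> HH_red R (n + 1) \<and>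
      Tr_HC R B n \<in> HC_red R n \<rightarrow> H_rep R B n \<and>
      Tr_HH R B n \<in> HH_red R (n + 1) \<rightarrow> H_forms R B n \<and>
      B_rep R B n \<in> H_rep R B n \<rightarrow> H_forms R B n \<and>
      (\<forall>c \<in> HC_red R n. B_rep R B n (Tr_HC R B n c) = Tr_HH R B n (connes_B R n c)))"
proof -
  have R: "dg_algebra R" "free_graded_algebra R" using assms(2) by (simp_all add: almost_free_resolution_def)
  obtain X where X: "X \<subseteq> (\<Union>n. piece R n)" "inj_on prod_list (lists X)"
    "\<not> module.dependent (scal R) (prod_list ` lists X)" "module.span (scal R) (prod_list ` lists X) = UNIV"
    using R(2) unfolding free_graded_algebra_def by blast
  interpret finite_dimensional_vector_space sV B by (rule assms(3))
  interpret free_rep R X B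
    by unfold_locales (use R X finite_Basis in auto)
  show ?thesis
    using periodicity_square connes_square by blast
qed

end
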